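(* Let $\lambda$ be a partition of a positive integer $n$, let $(\rho_\lambda,V_\lambda)$ be the irreducible complex representation of $S_n$ indexed by $\lambda$, and let $w_n=(1\,2\,\dots\,n)\in S_n$. The minimal polynomial $p(x)$ of $\rho_\lambda(w_n)$ is $x^n-1$, except in the following cases, where $p(x)$ is as indicated: 1. $\lambda=(n)$ with $n>1$, where $p(x)=x-1$; 2. $\lambda=(n-1,1)$, where $p(x)=\frac{x^n-1}{x-1}$; 3. $\lambda=(2,1^{n-2})$, where $p(x)=\frac{x^n-1}{x-(-1)^{n-1}}$; 4. $\lambda=(1^n)$, where $p(x)=x-(-1)^{n-1}$; 5. $\lambda=(3,3)$, where $p(x)=\frac{x^6-1}{(x-\zeta)(x-\bar\zeta)}$ and $\zeta$ is a primitive $6$th root of unity; 6. $\lambda=(2,2,2)$, where $p(x)=\frac{x^6-1}{(x-\zeta)(x-\bar\zeta)}$ and $\zeta$ is a primitive $6$th root of unity; 7. $\lambda=(2,2)$, where $p(x)=\frac{x^4-1}{x^2+1}$.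
   Context: Representations are over $\mathbb{C}$, and the irreducible representations of $S_n$ are indexed by partitions of $n$ in the standard way ($V_{(n)}$ trivial, $V_{(1^n)}$ sign). Exponents in partitions denote repeated parts. A listed case applies only when the displayed $\lambda$ is a partition of $n$.
   Formalization: In case 5, λ=(3,3), ζ is taken to be a primitive 3rd root of unity instead of a primitive 6th root: the eigenvalues of the 6-cycle missing on V_(3,3) are the primitive cube roots of unity, so the printed formula is false there. *)

theory Defs
  imports
    Complex_Main
    "HOL-Library.Function_Algebras"
    "HOL-Computational_Algebra.Polynomial"
    "HOL-Combinatorics.Combinatorics"
begin

section \<open>Minimal polynomials of operators on spaces of complex-valued functions\<close>

definition cscale :: "complex \<Rightarrow> ('a \<Rightarrow> complex) \<Rightarrow> 'a \<Rightarrow> complex" where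
  "cscale c f = (\<lambda>x. c * f x)"

interpretation cfun: vector_space "cscale :: complex \<Rightarrow> ('a \<Rightarrow> complex) \<Rightarrow> 'a \<Rightarrow> complex"
  by unfold_locales (auto simp: cscale_def fun_eq_iff algebra_simps)

definition poly_op ::
    "complex poly \<Rightarrow> (('a \<Rightarrow> complex) \<Rightarrow> 'a \<Rightarrow> complex) \<Rightarrow> ('a \<Rightarrow> complex) \<Rightarrow> 'a \<Rightarrow> complex" where
  "poly_op p T v = (\<Sum>i\<le>degree p. cscale (coeff p i) ((T ^^ i) v))"

definition annihilates ::
    "complex poly \<Rightarrow> ('a \<Rightarrow> complex) set \<Rightarrow> (('a \<Rightarrow> complex) \<Rightarrow> 'a \<Rightarrow> complex) \<Rightarrow> bool" where
  "annihilates p V T \<longleftrightarrow> (\<forall>v\<in>V. poly_op p T v = 0)"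

text \<open>\<open>V\<close> is meant to be a \<open>T\<close>-invariant subspace; \<open>p\<close> is the minimal polynomial of the
  restriction of \<open>T\<close> to \<open>V\<close>.\<close>

definition is_minimal_polynomial ::
    "complex poly \<Rightarrow> ('a \<Rightarrow> complex) set \<Rightarrow> (('a \<Rightarrow> complex) \<Rightarrow> 'a \<Rightarrow> complex) \<Rightarrow> bool" where
  "is_minimal_polynomial p V T \<longleftrightarrow>
     lead_coeff p = 1 \<and> annihilates p V T \<and>
     (\<forall>q. q \<noteq> 0 \<and> annihilates q V T \<longrightarrow> degree p \<le> degree q)"

definition primitive_root_of_unity :: "nat \<Rightarrow> complex \<Rightarrow> bool" where
  "primitive_root_of_unity k z \<longleftrightarrow> k > 0 \<and> z ^ k = 1 \<and> (\<forall>j. 0 < j \<and> j < k \<longrightarrow> z ^ j \<noteq> 1)"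

section \<open>Partitions, tableaux and tabloids\<close>

definition partition_of :: "nat list \<Rightarrow> nat \<Rightarrow> bool" where
  "partition_of lam n \<longleftrightarrow> sorted_wrt (\<ge>) lam \<and> 0 \<notin> set lam \<and> sum_list lam = n"

text \<open>Rows and columns are numbered from 0, entries of tableaux from 1.\<close>

definition young_diagram :: "nat list \<Rightarrow> (nat \<times> nat) set" where
  "young_diagram lam = {(i, j). i < length lam \<and> j < lam ! i}"

definition tableau :: "nat list \<Rightarrow> (nat \<times> nat \<Rightarrow> nat) \<Rightarrow> bool" where
  "tableau lam t \<longleftrightarrow> bij_betw t (young_diagram lam) {1..sum_list lam}"

text \<open>A tabloid, i.e. a tableau up to permutations of the entries within each row, is represented
  by the sequence of the sets of entries of its rows (with empty sets below the last row).\<close>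

type_synonym tabloid = "nat \<Rightarrow> nat set"

definition tabloid_of :: "nat list \<Rightarrow> (nat \<times> nat \<Rightarrow> nat) \<Rightarrow> tabloid" where
  "tabloid_of lam t = (\<lambda>i. t ` {b \<in> young_diagram lam. fst b = i})"

definition perm_tabloid :: "(nat \<Rightarrow> nat) \<Rightarrow> tabloid \<Rightarrow> tabloid" where
  "perm_tabloid \<pi> X = (\<lambda>i. \<pi> ` X i)"

definition column_of :: "nat list \<Rightarrow> (nat \<times> nat \<Rightarrow> nat) \<Rightarrow> nat \<Rightarrow> nat set" where
  "column_of lam t j = t ` {b \<in> young_diagram lam. snd b = j}"

definition column_stabilizer :: "nat list \<Rightarrow> (nat \<times> nat \<Rightarrow> nat) \<Rightarrow> (nat \<Rightarrow> nat) set" where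
  "column_stabilizer lam t =
     {\<pi>. \<pi> permutes {1..sum_list lam} \<and> (\<forall>j. \<pi> ` column_of lam t j = column_of lam t j)}"

section \<open>Specht modules\<close>

text \<open>The vector space with the tabloids as a basis is realised by functions on tabloids, the
  basis vector of \<open>X\<close> being the indicator function of \<open>X\<close>. The irreducible representation of the
  symmetric group (the permutations of \<open>{1..n}\<close>) indexed by a partition \<open>lam\<close> of \<open>n\<close> is the Specht
  module of \<open>lam\<close>, the span of all polytabloids; it is trivial for \<open>lam = [n]\<close> and it is the sign
  representation for \<open>lam = replicate n 1\<close>.\<close>

definition basis_tabloid :: "tabloid \<Rightarrow> tabloid \<Rightarrow> complex" where
  "basis_tabloid X = (\<lambda>Y. if Y = X then 1 else 0)"

definition polytabloid :: "nat list \<Rightarrow> (nat \<times> nat \<Rightarrow> nat) \<Rightarrow> tabloid \<Rightarrow> complex" where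
  "polytabloid lam t =
     (\<Sum>\<pi>\<in>column_stabilizer lam t.
        cscale (of_int (sign \<pi>)) (basis_tabloid (perm_tabloid \<pi> (tabloid_of lam t))))"

definition specht_module :: "nat list \<Rightarrow> (tabloid \<Rightarrow> complex) set" where
  "specht_module lam = cfun.span {polytabloid lam t | t. tableau lam t}"

text \<open>The linear action that sends the basis vector of \<open>X\<close> to that of \<open>perm_tabloid \<pi> X\<close>. The same
  formula serves all shapes; the representation indexed by \<open>lam\<close> is its restriction to
  \<open>specht_module lam\<close>.\<close>

definition specht_rep :: "(nat \<Rightarrow> nat) \<Rightarrow> (tabloid \<Rightarrow> complex) \<Rightarrow> tabloid \<Rightarrow> complex" where
  "specht_rep \<pi> f = (\<lambda>X. f (perm_tabloid (inv \<pi>) X))"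

lemma specht_rep_comp:
  assumes "\<pi> permutes S" and "\<sigma> permutes S"
  shows "specht_rep (\<pi> \<circ> \<sigma>) f = specht_rep \<pi> (specht_rep \<sigma> f)"
proof -
  have "inv (\<pi> \<circ> \<sigma>) = inv \<sigma> \<circ> inv \<pi>"
    using assms by (intro o_inv_distrib) (auto dest: permutes_bij)
  then show ?thesis
    by (simp add: specht_rep_def perm_tabloid_def image_comp)
qed

lemma specht_rep_id: "specht_rep id f = f"
  by (simp add: specht_rep_def perm_tabloid_def)

lemma specht_rep_add: "specht_rep \<pi> (f + g) = specht_rep \<pi> f + specht_rep \<pi> g"
  by (simp add: specht_rep_def fun_eq_iff)

lemma specht_rep_cscale: "specht_rep \<pi> (cscale c f) = cscale c (specht_rep \<pi> f)"
  by (simp add: specht_rep_def cscale_def)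

lemma specht_rep_basis:
  assumes "\<pi> permutes S"
  shows "specht_rep \<pi> (basis_tabloid X) = basis_tabloid (perm_tabloid \<pi> X)"
proof -
  have "perm_tabloid (inv \<pi>) Y = X \<longleftrightarrow> Y = perm_tabloid \<pi> X" for Y
  proof
    assume "perm_tabloid (inv \<pi>) Y = X"
    then have "X = perm_tabloid (inv \<pi>) Y" ..
    then show "Y = perm_tabloid \<pi> X"
      using permutes_inv_o[OF assms] by (simp add: perm_tabloid_def image_comp)
  next
    assume "Y = perm_tabloid \<pi> X"
    then show "perm_tabloid (inv \<pi>) Y = X"
      using permutes_inv_o[OF assms] by (simp add: perm_tabloid_def image_comp)
  qed
  then show ?thesis
    by (simp add: specht_rep_def basis_tabloid_def fun_eq_iff)
qed

end

theory Submission
  imports Defs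
begin

text \<open>
  The long cycle \<open>w\<close> has order \<open>n\<close>, so \<open>x\<^sup>n - 1\<close> kills every Specht module, and it is the minimal
  polynomial as soon as the \<open>n\<close> vectors \<open>w\<^sup>i e\<close>, \<open>i < n\<close>, are linearly independent for some polytabloid
  \<open>e\<close>. A tabloid occurs in the polytabloid of a tableau only if its rows separate the
  entries of each column, and the tabloids of tableaux with the same columns do occur, with coefficient
  \<open>1\<close> or \<open>- 1\<close> (\<open>polytabloid_eq_0\<close> and \<open>polytabloid_apply_column_perm\<close>). So independence follows from a
  purely combinatorial construction: arrange the cells of the diagram on a circle of \<open>n\<close> places, such that
  each proper rotation moves two cells of some column onto the places of two cells of some row
  (\<open>minimal_polynomial_shift_separating\<close>).

  For most shapes the arrangement is a closed walk through the diagram with steps along rows and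
  columns. It has the required property unless its sequence of row and column steps is
  periodic (\<open>shift_separating_linked_segments\<close>). Walking through the columns one after the other gives an
  aperiodic sequence if the columns are not all of the same length, and a small change of this walk
  works for the rectangles with at least three rows and three columns. Hooks and rectangles
  with two rows get arrangements that are not walks; the remaining shapes are obtained by exchanging
  rows and columns. This covers all shapes but the exceptional ones
  (\<open>separable_young_diagram\<close>).

  In the exceptional cases, linear relations between the rotations of a polytabloid give an annihilating
  polynomial of smaller degree. One row, one column and the shape with a second row of length one are treated
  directly; otherwise the relations come from the sign rule for permutations inside the columns, from
  reordering columns of the same length and from the exchange relation \<open>polytabloid_exchange\<close>. A triangular matrix of values of
  rotated polytabloids shows in each case that the degree cannot be smaller still
  (\<open>annihilating_degree_ge\<close>).
\<close>

section \<open>Polynomials in an operator\<close>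

lemma sum_fun_apply: "(\<Sum>x\<in>A. f x) y = (\<Sum>x\<in>A. f x y)"
  for f :: "'a \<Rightarrow> 'b \<Rightarrow> 'c::comm_monoid_add"
  by (induction A rule: infinite_finite_induct) (auto simp: zero_fun_def plus_fun_def)

lemma poly_op_apply: "poly_op p T v y = (\<Sum>i\<le>degree p. coeff p i * (T ^^ i) v y)"
  by (simp add: poly_op_def sum_fun_apply cscale_def)

lemma poly_op_apply_bound:
  assumes "degree p < d"
  shows "poly_op p T v y = (\<Sum>i<d. coeff p i * (T ^^ i) v y)"
  unfolding poly_op_apply using assms
  by (intro sum.mono_neutral_left) (auto simp: coeff_eq_0)

lemma specht_rep_funpow:
  assumes "\<pi> permutes S"
  shows "specht_rep \<pi> ^^ i = specht_rep (\<pi> ^^ i)"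
proof (induction i)
  case 0
  show ?case by (rule ext) (simp add: specht_rep_id id_def[symmetric])
next
  case (Suc i)
  show ?case
  proof
    fix f
    have "specht_rep (\<pi> ^^ Suc i) f = specht_rep \<pi> (specht_rep (\<pi> ^^ i) f)"
      using specht_rep_comp[OF assms permutes_funpow[OF assms], of i f] by (simp only: funpow.simps)
    then show "(specht_rep \<pi> ^^ Suc i) f = specht_rep (\<pi> ^^ Suc i) f"
      by (simp only: funpow.simps comp_apply Suc)
  qed
qed

lemma annihilates_span:
  assumes "\<And>v. v \<in> B \<Longrightarrow> poly_op p (specht_rep \<pi>) v = 0" and "\<pi> permutes S"
  shows "annihilates p (cfun.span B) (specht_rep \<pi>)"
  unfolding annihilates_def
proof
  fix v assume "v \<in> cfun.span B"
  then show "poly_op p (specht_rep \<pi>) v = 0"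
  proof (induction rule: cfun.span_induct_alt)
    case base
    then show ?case
      unfolding fun_eq_iff poly_op_apply specht_rep_funpow[OF assms(2)] by (simp add: specht_rep_def)
  next
    case (step c x y)
    have "poly_op p (specht_rep \<pi>) (cscale c x + y) X =
        c * poly_op p (specht_rep \<pi>) x X + poly_op p (specht_rep \<pi>) y X" for X
      by (simp add: poly_op_apply specht_rep_funpow[OF assms(2)] specht_rep_add specht_rep_cscale
            algebra_simps sum.distrib sum_distrib_left) (simp add: cscale_def mult.left_commute)
    then show ?case
      using step assms(1) by (intro ext) (simp add: fun_eq_iff del: plus_fun_apply)
  qed
qed

text \<open>The values of \<open>v, T v, \<dots>, T\<^sup>d\<^sup>-\<^sup>1 v\<close> at suitable points form a triangular matrix, so these
  vectors are linearly independent and no polynomial of smaller degree kills \<open>v\<close>.\<close>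

lemma annihilating_degree_ge:
  assumes v: "v \<in> V"
    and tri: "\<And>j. j < d \<Longrightarrow> \<exists>y. (T ^^ j) v y \<noteq> 0 \<and> (\<forall>i. j < i \<and> i < d \<longrightarrow> (T ^^ i) v y = 0)"
    and q: "q \<noteq> 0" "annihilates q V T"
  shows "d \<le> degree q"
proof (rule ccontr)
  assume "\<not> d \<le> degree q"
  then have deg: "degree q < d" by simp
  have "coeff q j = 0" if "j < d" for j
    using that
  proof (induction j rule: less_induct)
    case (less j)
    obtain y where y: "(T ^^ j) v y \<noteq> 0" "\<And>i. j < i \<Longrightarrow> i < d \<Longrightarrow> (T ^^ i) v y = 0"
      using tri[OF less.prems] by blast
    have "0 = (\<Sum>i<d. coeff q i * (T ^^ i) v y)"
      using q(2) v by (simp add: annihilates_def poly_op_apply_bound[OF deg, symmetric])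
    also have "\<dots> = (\<Sum>i<d. if i = j then coeff q j * (T ^^ j) v y else 0)"
    proof (rule sum.cong)
      fix i assume "i \<in> {..<d}"
      then show "coeff q i * (T ^^ i) v y = (if i = j then coeff q j * (T ^^ j) v y else 0)"
        using less.IH[of i] y(2)[of i] by (cases i j rule: linorder_cases) auto
    qed simp
    also have "\<dots> = coeff q j * (T ^^ j) v y"
      using less.prems by simp
    finally show ?case
      using y(1) by simp
  qed
  then have "coeff q (degree q) = 0"
    using deg by blast
  with q(1) show False by simp
qed

section \<open>Polytabloids\<close>

lemma finite_young_diagram: "finite (young_diagram lam)"
proof -
  have "young_diagram lam = (SIGMA i:{..<length lam}. {..<lam ! i})"
    by (auto simp: young_diagram_def)
  then show ?thesis by simp
qed

lemma card_young_diagram: "card (young_diagram lam) = sum_list lam"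
proof -
  have "young_diagram lam = (SIGMA i:{..<length lam}. {..<lam ! i})"
    by (auto simp: young_diagram_def)
  then have "card (young_diagram lam) = (\<Sum>i<length lam. lam ! i)"
    by simp
  then show ?thesis
    by (simp add: sum_list_sum_nth lessThan_atLeast0)
qed

lemma perm_tabloid_tabloid_of: "perm_tabloid \<pi> (tabloid_of lam t) = tabloid_of lam (\<pi> \<circ> t)"
  by (auto simp: perm_tabloid_def tabloid_of_def fun_eq_iff image_image)

lemma column_of_comp: "column_of lam (\<pi> \<circ> t) j = \<pi> ` column_of lam t j"
  by (auto simp: column_of_def)

lemma column_stabilizer_permutes:
  "\<pi> \<in> column_stabilizer lam t \<Longrightarrow> \<pi> permutes {1..sum_list lam}"
  by (simp add: column_stabilizer_def)

lemma finite_column_stabilizer: "finite (column_stabilizer lam t)"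
  by (rule finite_subset[OF _ finite_permutations[of "{1..sum_list lam}"]])
     (auto simp: column_stabilizer_def)

lemma column_stabilizer_comp:
  assumes "\<pi> \<in> column_stabilizer lam t" "\<sigma> \<in> column_stabilizer lam t"
  shows "\<pi> \<circ> \<sigma> \<in> column_stabilizer lam t"
  unfolding column_stabilizer_def
proof (intro CollectI conjI allI)
  show "\<pi> \<circ> \<sigma> permutes {1..sum_list lam}"
    using assms by (intro permutes_compose column_stabilizer_permutes)
  show "(\<pi> \<circ> \<sigma>) ` column_of lam t j = column_of lam t j" for j
    using assms unfolding image_comp[symmetric] by (simp add: column_stabilizer_def)
qed

lemma column_stabilizer_inv:
  assumes "\<pi> \<in> column_stabilizer lam t"
  shows "inv \<pi> \<in> column_stabilizer lam t"
proof -
  have p: "\<pi> permutes {1..sum_list lam}" "\<And>j. \<pi> ` column_of lam t j = column_of lam t j"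
    using assms by (auto simp: column_stabilizer_def)
  have "inv \<pi> ` column_of lam t j = column_of lam t j" for j
  proof -
    have "inv \<pi> ` (\<pi> ` column_of lam t j) = column_of lam t j"
      using permutes_inj[OF p(1)] by (simp add: image_image)
    then show ?thesis by (simp add: p(2))
  qed
  then show ?thesis
    using permutes_inv[OF p(1)] by (simp add: column_stabilizer_def)
qed

lemma polytabloid_apply:
  "polytabloid lam t Y =
     (\<Sum>\<pi>\<in>column_stabilizer lam t. if Y = tabloid_of lam (\<pi> \<circ> t) then of_int (sign \<pi>) else 0)"
  unfolding polytabloid_def sum_fun_apply
  by (rule sum.cong) (auto simp: cscale_def basis_tabloid_def perm_tabloid_tabloid_of)

lemma column_stabilizer_of_comp:
  assumes s: "\<sigma> permutes {1..sum_list lam}"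
  shows "column_stabilizer lam (\<sigma> \<circ> t) = (\<lambda>\<pi>. \<sigma> \<circ> \<pi> \<circ> inv \<sigma>) ` column_stabilizer lam t"
proof -
  have sub: "\<sigma> \<circ> \<pi> \<circ> inv \<sigma> \<in> column_stabilizer lam (\<sigma> \<circ> t)"
    if "\<sigma> permutes {1..sum_list lam}" "\<pi> \<in> column_stabilizer lam t" for \<sigma> \<pi> t
  proof -
    have "(\<sigma> \<circ> \<pi> \<circ> inv \<sigma>) ` \<sigma> ` column_of lam t j = \<sigma> ` column_of lam t j" for j
    proof -
      have "(\<sigma> \<circ> \<pi> \<circ> inv \<sigma>) ` \<sigma> ` column_of lam t j = \<sigma> ` \<pi> ` column_of lam t j"
        using permutes_inverses(2)[OF that(1)] by (simp add: image_image)
      then show ?thesis using that(2) by (simp add: column_stabilizer_def)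
    qed
    then show ?thesis
      using that by (auto simp: column_stabilizer_def column_of_comp
          intro!: permutes_compose permutes_inv)
  qed
  have "\<pi> \<in> (\<lambda>\<pi>. \<sigma> \<circ> \<pi> \<circ> inv \<sigma>) ` column_stabilizer lam t"
    if "\<pi> \<in> column_stabilizer lam (\<sigma> \<circ> t)" for \<pi>
  proof
    have "inv \<sigma> \<circ> \<pi> \<circ> inv (inv \<sigma>) \<in> column_stabilizer lam (inv \<sigma> \<circ> (\<sigma> \<circ> t))"
      by (rule sub[OF permutes_inv[OF s] that])
    then show "inv \<sigma> \<circ> \<pi> \<circ> \<sigma> \<in> column_stabilizer lam t"
      using permutes_inv_o[OF s] permutes_inv_inv[OF s] by (simp add: comp_assoc[symmetric])
    show "\<pi> = \<sigma> \<circ> (inv \<sigma> \<circ> \<pi> \<circ> \<sigma>) \<circ> inv \<sigma>"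
      using permutes_inverses[OF s] by (simp add: fun_eq_iff)
  qed
  then show ?thesis using sub[OF s] by blast
qed

lemma specht_rep_polytabloid:
  assumes s: "\<sigma> permutes {1..sum_list lam}"
  shows "specht_rep \<sigma> (polytabloid lam t) = polytabloid lam (\<sigma> \<circ> t)"
proof
  fix Y
  have inj: "inj_on (\<lambda>\<pi>. \<sigma> \<circ> \<pi> \<circ> inv \<sigma>) (column_stabilizer lam t)"
  proof (rule inj_onI)
    fix p q assume "\<sigma> \<circ> p \<circ> inv \<sigma> = \<sigma> \<circ> q \<circ> inv \<sigma>"
    then have "inv \<sigma> \<circ> (\<sigma> \<circ> p \<circ> inv \<sigma>) \<circ> \<sigma> = inv \<sigma> \<circ> (\<sigma> \<circ> q \<circ> inv \<sigma>) \<circ> \<sigma>"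
      by simp
    then show "p = q"
      using permutes_inverses[OF s] by (simp add: fun_eq_iff)
  qed
  have sgn: "sign (\<sigma> \<circ> \<pi> \<circ> inv \<sigma>) = sign \<pi>" if "\<pi> \<in> column_stabilizer lam t" for \<pi>
  proof -
    have "permutation \<sigma>" "permutation \<pi>"
      using s column_stabilizer_permutes[OF that] by (auto simp: permutation_permutes)
    then show ?thesis
      by (simp add: sign_compose permutation_compose permutation_inverse sign_inverse)
  qed
  have eq: "perm_tabloid (inv \<sigma>) Y = tabloid_of lam (\<pi> \<circ> t) \<longleftrightarrow>
      Y = tabloid_of lam (\<sigma> \<circ> \<pi> \<circ> inv \<sigma> \<circ> (\<sigma> \<circ> t))" for \<pi>
  proof -
    have "\<sigma> \<circ> \<pi> \<circ> inv \<sigma> \<circ> (\<sigma> \<circ> t) = \<sigma> \<circ> (\<pi> \<circ> t)"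
      using permutes_inverses[OF s] by (simp add: fun_eq_iff)
    moreover have "perm_tabloid (inv \<sigma>) Y = X \<longleftrightarrow> Y = perm_tabloid \<sigma> X" for X
    proof -
      have "specht_rep \<sigma> (basis_tabloid X) Y = basis_tabloid (perm_tabloid \<sigma> X) Y"
        by (simp add: specht_rep_basis[OF s])
      then show ?thesis by (simp add: specht_rep_def basis_tabloid_def split: if_splits)
    qed
    ultimately show ?thesis by (simp add: perm_tabloid_tabloid_of)
  qed
  show "specht_rep \<sigma> (polytabloid lam t) Y = polytabloid lam (\<sigma> \<circ> t) Y"
    unfolding specht_rep_def polytabloid_apply column_stabilizer_of_comp[OF s]
    by (subst sum.reindex[OF inj]) (simp add: eq sgn cong: if_cong)
qed

lemma polytabloid_column_perm:
  assumes p: "\<pi> \<in> column_stabilizer lam t"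
  shows "polytabloid lam (\<pi> \<circ> t) = cscale (of_int (sign \<pi>)) (polytabloid lam t)"
proof
  fix Y
  have pp: "\<pi> permutes {1..sum_list lam}"
    using p by (rule column_stabilizer_permutes)
  have cs: "column_stabilizer lam (\<pi> \<circ> t) = column_stabilizer lam t"
    using p by (simp add: column_stabilizer_def column_of_comp)
  have bij: "bij_betw (\<lambda>\<sigma>. \<sigma> \<circ> \<pi>) (column_stabilizer lam t) (column_stabilizer lam t)"
    using p permutes_inverses[OF pp]
    by (intro bij_betwI[where g = "\<lambda>\<sigma>. \<sigma> \<circ> inv \<pi>"])
       (auto simp: column_stabilizer_comp column_stabilizer_inv fun_eq_iff)
  have sgn: "sign (\<sigma> \<circ> \<pi>) = sign \<sigma> * sign \<pi>" if "\<sigma> \<in> column_stabilizer lam t" for \<sigma>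
    using pp column_stabilizer_permutes[OF that] by (intro sign_compose) (auto simp: permutation_permutes)
  have sq: "of_int (sign \<pi>) * of_int (sign \<pi>) = (1::complex)"
    by (simp add: sign_def)
  have "polytabloid lam t Y = (\<Sum>\<sigma>\<in>column_stabilizer lam t.
      if Y = tabloid_of lam (\<sigma> \<circ> \<pi> \<circ> t) then of_int (sign (\<sigma> \<circ> \<pi>)) else 0)"
    unfolding polytabloid_apply by (rule sum.reindex_bij_betw[OF bij, symmetric])
  also have "\<dots> = of_int (sign \<pi>) * polytabloid lam (\<pi> \<circ> t) Y"
    unfolding polytabloid_apply cs sum_distrib_left
    by (rule sum.cong) (auto simp: sgn comp_assoc)
  finally show "polytabloid lam (\<pi> \<circ> t) Y = cscale (of_int (sign \<pi>)) (polytabloid lam t) Y"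
    using sq by (simp add: cscale_def mult.assoc[symmetric])
qed

lemma polytabloid_support:
  assumes "polytabloid lam t Y \<noteq> 0"
  obtains \<pi> where "\<pi> \<in> column_stabilizer lam t" "Y = tabloid_of lam (\<pi> \<circ> t)"
proof -
  have "\<exists>\<pi>\<in>column_stabilizer lam t. Y = tabloid_of lam (\<pi> \<circ> t)"
  proof (rule ccontr)
    assume "\<not> ?thesis"
    then have "polytabloid lam t Y = 0"
      unfolding polytabloid_apply by (intro sum.neutral) auto
    with assms show False by simp
  qed
  then show ?thesis using that by blast
qed

lemma tableau_eqD:
  assumes "tableau lam t" "t b = t b'" "b \<in> young_diagram lam" "b' \<in> young_diagram lam"
  shows "b = b'"
  using assms by (auto simp: tableau_def bij_betw_def dest: inj_onD)

lemma column_of_unique: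
  assumes "tableau lam t" "x \<in> column_of lam t j" "x \<in> column_of lam t k"
  shows "j = k"
  using assms(2,3) tableau_eqD[OF assms(1)] by (auto simp: column_of_def)

lemma row_of_unique:
  assumes "tableau lam t" "x \<in> tabloid_of lam t i" "x \<in> tabloid_of lam t k"
  shows "i = k"
  using assms(2,3) tableau_eqD[OF assms(1)] by (auto simp: tabloid_of_def)

lemma column_ofI: "b \<in> young_diagram lam \<Longrightarrow> t b \<in> column_of lam t (snd b)"
  by (auto simp: column_of_def)

lemma tabloid_ofI: "b \<in> young_diagram lam \<Longrightarrow> t b \<in> tabloid_of lam t (fst b)"
  by (auto simp: tabloid_of_def)

text \<open>The tabloids that occur in a polytabloid arise from its own tabloid by permuting each column,
  which never brings two entries of a column into the same row.\<close>

lemma polytabloid_eq_0: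
  assumes t: "tableau lam t"
    and uv: "u \<in> column_of lam t j" "v \<in> column_of lam t j" "u \<noteq> v" "u \<in> Y r" "v \<in> Y r"
  shows "polytabloid lam t Y = 0"
proof (rule ccontr)
  assume "polytabloid lam t Y \<noteq> 0"
  then obtain \<pi> where p: "\<pi> \<in> column_stabilizer lam t" and Y: "Y = tabloid_of lam (\<pi> \<circ> t)"
    by (rule polytabloid_support)
  have inj: "inj \<pi>"
    using permutes_inj[OF column_stabilizer_permutes[OF p]] .
  have *: "\<exists>b \<in> young_diagram lam. b = (r, j) \<and> x = \<pi> (t b)"
    if x: "x \<in> column_of lam t j" "x \<in> Y r" for x
  proof -
    obtain b where b: "b \<in> young_diagram lam" "fst b = r" "x = \<pi> (t b)"
      using x(2) by (auto simp: Y tabloid_of_def)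
    have "x \<in> \<pi> ` column_of lam t j"
      using x(1) p by (simp add: column_stabilizer_def)
    then have "t b \<in> column_of lam t j"
      using b(3) by (simp add: inj_image_mem_iff[OF inj])
    then have "snd b = j"
      using column_of_unique[OF t column_ofI[OF b(1)]] by simp
    then show ?thesis using b by auto
  qed
  show False
    using *[OF uv(1,4)] *[OF uv(2,5)] uv(3) by auto
qed

text \<open>A permutation that preserves all columns and whose effect on the rows is known is determined,
  since a row and a column meet in a single cell. So no cancellation occurs in the sum that defines
  a polytabloid.\<close>

lemma polytabloid_apply_column_perm:
  assumes t: "tableau lam t" and p: "\<pi> \<in> column_stabilizer lam t"
  shows "polytabloid lam t (tabloid_of lam (\<pi> \<circ> t)) = of_int (sign \<pi>)"
proof -
  have uniq: "\<sigma> = \<pi>"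
    if s: "\<sigma> \<in> column_stabilizer lam t" and eq: "tabloid_of lam (\<pi> \<circ> t) = tabloid_of lam (\<sigma> \<circ> t)" for \<sigma>
  proof
    fix x
    show "\<sigma> x = \<pi> x"
    proof (cases "x \<in> {1..sum_list lam}")
      case False
      then show ?thesis
        using column_stabilizer_permutes[OF s] column_stabilizer_permutes[OF p]
        by (metis permutes_def)
    next
      case True
      then have "x \<in> t ` young_diagram lam"
        using t by (simp add: tableau_def bij_betw_def)
      then obtain b where b: "b \<in> young_diagram lam" "x = t b"
        by blast
      have "\<sigma> x \<in> tabloid_of lam (\<sigma> \<circ> t) (fst b)"
        using b by (auto simp: tabloid_of_def)
      then have "\<sigma> x \<in> tabloid_of lam (\<pi> \<circ> t) (fst b)"
        by (simp add: eq)
      then obtain b' where b': "b' \<in> young_diagram lam" "fst b' = fst b" "\<sigma> x = \<pi> (t b')"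
        by (auto simp: tabloid_of_def)
      have "x \<in> column_of lam t (snd b)"
        using b by (auto simp: column_of_def)
      then have "\<sigma> x \<in> column_of lam t (snd b)"
        using s by (auto simp: column_stabilizer_def)
      moreover have "t b' \<in> column_of lam t (snd b')"
        using b' by (auto simp: column_of_def)
      then have "\<sigma> x \<in> column_of lam t (snd b')"
        using b'(3) p by (auto simp: column_stabilizer_def)
      ultimately have "snd b = snd b'"
        by (rule column_of_unique[OF t])
      then have "b' = b"
        using b' by (simp add: prod_eq_iff)
      then show ?thesis
        using b b' by simp
    qed
  qed
  have "polytabloid lam t (tabloid_of lam (\<pi> \<circ> t)) =
      (\<Sum>\<sigma>\<in>column_stabilizer lam t. if \<sigma> = \<pi> then of_int (sign \<pi>) else 0)"
    unfolding polytabloid_apply using uniq by (intro sum.cong) auto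
  also have "\<dots> = of_int (sign \<pi>)"
    using p finite_column_stabilizer by simp
  finally show ?thesis .
qed

lemma tableau_comp:
  assumes "tableau lam t" "\<pi> permutes {1..sum_list lam}"
  shows "tableau lam (\<pi> \<circ> t)"
  using assms unfolding tableau_def by (auto intro: bij_betw_trans permutes_imp_bij)

lemma polytabloid_cong:
  assumes "\<And>b. b \<in> young_diagram lam \<Longrightarrow> t b = t' b"
  shows "polytabloid lam t = polytabloid lam t'"
proof -
  have "column_of lam t = column_of lam t'"
    using assms by (auto simp: column_of_def fun_eq_iff)
  moreover have "tabloid_of lam t = tabloid_of lam t'"
    using assms by (auto simp: tabloid_of_def fun_eq_iff)
  ultimately show ?thesis
    by (simp add: polytabloid_def column_stabilizer_def)
qed

text \<open>Any two tableaux of the same shape differ by a permutation of the entries.\<close>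

lemma tableaux_conjugate:
  assumes t: "tableau lam t" and t': "tableau lam t'"
  obtains \<pi> where "\<pi> permutes {1..sum_list lam}" "\<And>b. b \<in> young_diagram lam \<Longrightarrow> t' b = \<pi> (t b)"
proof
  define \<pi> where "\<pi> x = (if x \<in> {1..sum_list lam} then t' (inv_into (young_diagram lam) t x) else x)" for x
  have "bij_betw (t' \<circ> inv_into (young_diagram lam) t) {1..sum_list lam} {1..sum_list lam}"
    using t t' unfolding tableau_def by (intro bij_betw_trans[OF bij_betw_inv_into])
  then have "bij_betw \<pi> {1..sum_list lam} {1..sum_list lam}"
    by (subst bij_betw_cong[where g = "t' \<circ> inv_into (young_diagram lam) t"]) (auto simp: \<pi>_def)
  then show "\<pi> permutes {1..sum_list lam}"
    by (rule bij_imp_permutes) (auto simp: \<pi>_def)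
  show "t' b = \<pi> (t b)" if "b \<in> young_diagram lam" for b
    using t that unfolding tableau_def \<pi>_def by (auto simp: bij_betw_def inv_into_f_f)
qed

lemma polytabloid_apply_same_columns:
  assumes t: "tableau lam t" and t': "tableau lam t'"
    and col: "\<And>j. column_of lam t' j = column_of lam t j"
  shows "polytabloid lam t (tabloid_of lam t') \<noteq> 0"
proof -
  obtain \<pi> where p: "\<pi> permutes {1..sum_list lam}"
      "\<And>b. b \<in> young_diagram lam \<Longrightarrow> t' b = \<pi> (t b)"
    using tableaux_conjugate[OF t t'] by blast
  have "column_of lam t' j = \<pi> ` column_of lam t j" for j
    using p(2) by (auto simp: column_of_def)
  then have "\<pi> \<in> column_stabilizer lam t"
    using p(1) col by (simp add: column_stabilizer_def)
  from polytabloid_apply_column_perm[OF t this]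
  have "polytabloid lam t (tabloid_of lam (\<pi> \<circ> t)) \<noteq> 0"
    by (simp add: sign_def)
  moreover have "tabloid_of lam (\<pi> \<circ> t) = tabloid_of lam t'"
    using p(2) by (auto simp: tabloid_of_def fun_eq_iff)
  ultimately show ?thesis by simp
qed

text \<open>The exchange (Garnir) relation: the signed sum over the coset representatives \<open>(h b)\<close> of
  the antisymmetrisation of \<open>t\<close> over a whole column together with one more entry \<open>b\<close> is
  antisymmetric under all transpositions of these entries. There are more of them than rows
  available to them, so each tabloid that occurs is fixed by one such
  transposition.\<close>

lemma polytabloid_exchange:
  assumes t: "tableau lam t"
    and b: "b \<in> column_of lam t k" and jk: "j \<noteq> k"
    and len: "\<And>i. (i, k) \<in> young_diagram lam \<Longrightarrow> (i, j) \<in> young_diagram lam"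
  shows "polytabloid lam t Y = (\<Sum>a\<in>column_of lam t j. polytabloid lam (transpose a b \<circ> t) Y)"
proof -
  define A where "A = column_of lam t j"
  define H where "H = insert b A"
  define G where "G Y = (\<Sum>h\<in>H. of_int (sign (transpose h b)) * polytabloid lam (transpose h b \<circ> t) Y)" for Y
  have finA: "finite A"
    unfolding A_def column_of_def using finite_young_diagram by simp
  have ran: "t ` young_diagram lam = {1..sum_list lam}"
    using t by (simp add: tableau_def bij_betw_def)
  have bA: "b \<notin> A"
    using b jk column_of_unique[OF t] unfolding A_def by blast
  have Hsub: "H \<subseteq> {1..sum_list lam}"
    using b ran by (auto simp: H_def A_def column_of_def)
  have transp: "transpose u v permutes {1..sum_list lam}" if "u \<in> H" "v \<in> H" for u v
    using that Hsub by (intro permutes_swap_id) auto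
  have bH: "b \<in> H" by (simp add: H_def)
  have anti: "G (perm_tabloid (inv (transpose u v)) Y) = - G Y"
    if uv: "u \<in> H" "v \<in> H" "u \<noteq> v" for u v Y
  proof -
    define \<sigma> where "\<sigma> = transpose u v"
    have s: "\<sigma> permutes {1..sum_list lam}"
      using transp uv by (simp add: \<sigma>_def)
    have sH: "\<sigma> permutes H"
      using uv by (simp add: \<sigma>_def permutes_swap_id)
    have *: "of_int (sign (transpose h b)) * polytabloid lam (\<sigma> \<circ> (transpose h b \<circ> t)) Y
        = - (of_int (sign (transpose (\<sigma> h) b)) * polytabloid lam (transpose (\<sigma> h) b \<circ> t) Y)"
      if h: "h \<in> H" for h
    proof -
      define \<tau> where "\<tau> = transpose (\<sigma> h) b \<circ> \<sigma> \<circ> transpose h b"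
      have sh: "\<sigma> h \<in> H"
        using sH h by (simp add: permutes_in_image)
      have tp: "\<tau> permutes {1..sum_list lam}"
        unfolding \<tau>_def by (intro permutes_compose transp s h sh bH)
      have tH: "\<tau> permutes H"
        unfolding \<tau>_def by (intro permutes_compose sH permutes_swap_id h sh bH)
      have tb: "\<tau> b = b"
        by (simp add: \<tau>_def)
      have tA: "\<tau> ` A = A"
      proof -
        have "\<tau> ` (H - {b}) = H - {b}"
          using permutes_image[OF tH] permutes_inj[OF tH] tb
          by (metis image_set_diff image_empty image_insert)
        then show ?thesis using bA by (simp add: H_def)
      qed
      have tid: "\<tau> x = x" if "x \<notin> A" for x
        using that tb tH by (cases "x = b") (auto simp: H_def permutes_def)
      have "\<tau> ` column_of lam t i = column_of lam t i" for i
      proof (cases "i = j")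
        case True
        then show ?thesis using tA by (simp add: A_def)
      next
        case False
        then have "column_of lam t i \<inter> A = {}"
          using column_of_unique[OF t] unfolding A_def by blast
        then have "\<tau> ` column_of lam t i = id ` column_of lam t i"
          using tid by (intro image_cong) auto
        then show ?thesis by simp
      qed
      then have tc: "\<tau> \<in> column_stabilizer lam t"
        using tp by (simp add: column_stabilizer_def)
      have "\<sigma> \<circ> (transpose h b \<circ> t) = transpose (\<sigma> h) b \<circ> (\<tau> \<circ> t)"
        by (simp add: \<tau>_def fun_eq_iff)
      then have "polytabloid lam (\<sigma> \<circ> (transpose h b \<circ> t)) =
          specht_rep (transpose (\<sigma> h) b) (polytabloid lam (\<tau> \<circ> t))"
        using specht_rep_polytabloid[OF transp[OF sh bH]] by simp
      also have "\<dots> = cscale (of_int (sign \<tau>)) (polytabloid lam (transpose (\<sigma> h) b \<circ> t))"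
        using specht_rep_polytabloid[OF transp[OF sh bH]]
        by (simp add: polytabloid_column_perm[OF tc] specht_rep_cscale)
      finally have 1: "polytabloid lam (\<sigma> \<circ> (transpose h b \<circ> t)) Y =
          of_int (sign \<tau>) * polytabloid lam (transpose (\<sigma> h) b \<circ> t) Y"
        by (simp add: cscale_def)
      have "sign \<tau> = - sign (transpose (\<sigma> h) b) * sign (transpose h b)"
        using uv(3) by (simp add: \<tau>_def \<sigma>_def sign_compose permutation_compose
            permutation_swap_id sign_swap_id)
      then show ?thesis
        unfolding 1 by (simp add: sign_def)
    qed
    have "G (perm_tabloid (inv \<sigma>) Y) =
        (\<Sum>h\<in>H. of_int (sign (transpose h b)) * polytabloid lam (\<sigma> \<circ> (transpose h b \<circ> t)) Y)"
      unfolding G_def specht_rep_polytabloid[OF s, symmetric] by (simp add: specht_rep_def)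
    also have "\<dots> = (\<Sum>h\<in>H. - (of_int (sign (transpose (\<sigma> h) b)) * polytabloid lam (transpose (\<sigma> h) b \<circ> t) Y))"
      using * by (rule sum.cong[OF refl])
    also have "\<dots> = - G Y"
      unfolding G_def sum_negf
      by (subst sum.reindex_bij_betw[OF permutes_imp_bij[OF sH], symmetric]) simp
    finally show ?thesis by (simp add: \<sigma>_def)
  qed
  have "G Y = 0"
  proof (rule ccontr)
    assume "G Y \<noteq> 0"
    then obtain h where h: "h \<in> H" "polytabloid lam (transpose h b \<circ> t) Y \<noteq> 0"
      unfolding G_def by (metis (mono_tags, lifting) mult_zero_right sum.neutral)
    obtain \<pi> where p: "\<pi> \<in> column_stabilizer lam (transpose h b \<circ> t)"
        and Y: "Y = tabloid_of lam (\<pi> \<circ> (transpose h b \<circ> t))"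
      using polytabloid_support[OF h(2)] by blast
    define t' where "t' = \<pi> \<circ> (transpose h b \<circ> t)"
    have t': "tableau lam t'"
      unfolding t'_def by (intro tableau_comp t transp h bH column_stabilizer_permutes[OF p])
    define C where "C = {i. (i, j) \<in> young_diagram lam}"
    \<comment> \<open>In \<open>t'\<close> the entries of \<open>H\<close> still lie in the columns \<open>j\<close> and \<open>k\<close>, hence in the rows \<open>C\<close>.\<close>
    have "\<exists>i\<in>C. x \<in> Y i" if x: "x \<in> H" for x
    proof -
      have "transpose h b x \<in> H"
        using permutes_in_image[OF permutes_swap_id[OF h(1) bH]] x by simp
      then obtain c where c: "transpose h b x \<in> column_of lam t c" "c = j \<or> c = k"
        using b by (auto simp: H_def A_def)
      then have "transpose h b (transpose h b x) \<in> column_of lam (transpose h b \<circ> t) c"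
        unfolding column_of_comp by blast
      then have "x \<in> column_of lam (transpose h b \<circ> t) c" by simp
      then have "x \<in> column_of lam t' c"
        using p unfolding t'_def column_of_comp[of lam \<pi>] by (simp add: column_stabilizer_def)
      then obtain i where i: "(i, c) \<in> young_diagram lam" "x = t' (i, c)"
        by (auto simp: column_of_def)
      then have "x \<in> Y i"
        using tabloid_ofI[OF i(1), of t'] by (simp add: Y t'_def)
      then show ?thesis
        using i(1) c(2) len unfolding C_def by blast
    qed
    then obtain f where f: "\<And>x. x \<in> H \<Longrightarrow> f x \<in> C \<and> x \<in> Y (f x)"
      by metis
    have "card C = card A"
    proof -
      have "A = (\<lambda>i. t (i, j)) ` C"
        unfolding A_def C_def column_of_def by auto
      moreover have "inj_on (\<lambda>i. t (i, j)) C"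
        using tableau_eqD[OF t] unfolding inj_on_def C_def by blast
      ultimately show ?thesis by (simp add: card_image)
    qed
    moreover have "finite C"
      using finite_imageI[OF finite_young_diagram[of lam], of fst]
      by (rule rev_finite_subset) (auto simp: C_def image_iff intro!: bexI[of _ "(_, j)"])
    moreover have "card H = Suc (card A)"
      using finA bA by (simp add: H_def)
    ultimately have "\<not> inj_on f H"
      using card_inj_on_le[of f H C] f by fastforce
    then obtain u v where uv: "u \<in> H" "v \<in> H" "u \<noteq> v" "f u = f v"
      by (auto simp: inj_on_def)
    have "Y i = transpose u v ` Y i" for i
    proof (cases "i = f u")
      case True
      then show ?thesis
        using f[OF uv(1)] f[OF uv(2)] uv(4)
        by (intro permutes_image[symmetric] permutes_swap_id) auto
    next
      case False
      have "u \<notin> Y i" "v \<notin> Y i"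
        using f[OF uv(1)] f[OF uv(2)] uv(4) False row_of_unique[OF t']
        unfolding Y t'_def[symmetric] by metis+
      then have "transpose u v ` Y i = id ` Y i"
        by (intro image_cong) (auto simp: transpose_def)
      then show ?thesis by simp
    qed
    then have "perm_tabloid (inv (transpose u v)) Y = Y"
      by (simp add: perm_tabloid_def fun_eq_iff flip: inv_equality)
    then show False
      using anti[OF uv(1-3), of Y] \<open>G Y \<noteq> 0\<close> by simp
  qed
  moreover have "G Y = polytabloid lam t Y - (\<Sum>a\<in>A. polytabloid lam (transpose a b \<circ> t) Y)"
  proof -
    have "(\<Sum>h\<in>A. of_int (sign (transpose h b)) * polytabloid lam (transpose h b \<circ> t) Y) =
        (\<Sum>h\<in>A. - polytabloid lam (transpose h b \<circ> t) Y)"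
      using bA by (intro sum.cong) (auto simp: sign_swap_id)
    then show ?thesis
      unfolding G_def H_def using finA bA by (simp add: sum_negf)
  qed
  ultimately show ?thesis by (simp add: A_def)
qed

section \<open>The long cycle\<close>

definition long_cycle :: "nat \<Rightarrow> nat \<Rightarrow> nat" where
  "long_cycle n = cycle_of_list [1..<Suc n]"

lemma long_cycle_permutes: "long_cycle n permutes {1..n}"
  using cycle_permutes[of "[1..<Suc n]"] by (simp add: long_cycle_def atLeastLessThanSuc_atLeastAtMost del: upt_Suc)

lemma long_cycle_funpow_permutes: "long_cycle n ^^ i permutes {1..n}"
  by (rule permutes_funpow[OF long_cycle_permutes])

lemma long_cycle_funpow_apply:
  assumes "x < n"
  shows "(long_cycle n ^^ i) (Suc x) = Suc ((x + i) mod n)"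
proof -
  have "map (long_cycle n ^^ i) [1..<Suc n] ! x = rotate i [1..<Suc n] ! x"
    unfolding long_cycle_def by (subst cyclic_rotation) simp_all
  then show ?thesis
    using assms by (simp add: nth_rotate add.commute del: upt_Suc)
qed

lemma long_cycle_funpow_apply':
  assumes "x \<in> {1..n}"
  shows "(long_cycle n ^^ i) x = Suc ((x - 1 + i) mod n)"
  using long_cycle_funpow_apply[of "x - 1" n i] assms by (cases x) auto

lemma long_cycle_funpow_period: "long_cycle n ^^ n = id"
proof
  fix x
  show "(long_cycle n ^^ n) x = id x"
  proof (cases "x \<in> {1..n}")
    case True
    then show ?thesis using long_cycle_funpow_apply'[OF True, of n] by (cases x) auto
  next
    case False
    then show ?thesis using long_cycle_funpow_permutes[of n n] unfolding permutes_def by simp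
  qed
qed

lemma sign_cycle_of_list: "distinct cs \<Longrightarrow> sign (cycle_of_list cs) = (-1) ^ (length cs - 1)"
proof (induction cs rule: cycle_of_list.induct)
  case (1 i j cs)
  have "permutation (cycle_of_list (j # cs))"
    using cycle_permutes[of "j # cs"] by (auto simp: permutation_permutes)
  then show ?case
    using 1 sign_compose[of "transpose i j" "cycle_of_list (j # cs)"]
    by (simp add: permutation_swap_id sign_swap_id comp_def)
qed (auto simp: id_def[symmetric])

lemma sign_long_cycle: "sign (long_cycle n) = (-1) ^ (n - 1)"
  unfolding long_cycle_def by (subst sign_cycle_of_list) simp_all

section \<open>A criterion for the minimal polynomial\<close>

lemma specht_rep_funpow_polytabloid:
  assumes "sum_list lam = n"
  shows "(specht_rep (long_cycle n) ^^ i) (polytabloid lam t) = polytabloid lam (long_cycle n ^^ i \<circ> t)"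
  using specht_rep_polytabloid[of "long_cycle n ^^ i" lam t] long_cycle_funpow_permutes assms
  by (simp add: specht_rep_funpow[OF long_cycle_permutes])

lemma poly_op_polytabloid:
  assumes "sum_list lam = n"
  shows "poly_op p (specht_rep (long_cycle n)) (polytabloid lam t) Y =
    (\<Sum>i\<le>degree p. coeff p i * polytabloid lam (long_cycle n ^^ i \<circ> t) Y)"
  by (simp add: poly_op_apply specht_rep_funpow_polytabloid[OF assms])

text \<open>Since the powers of the long cycle send polytabloids to polytabloids, both halves of minimality
  reduce to statements about values of polytabloids: a linear relation that holds for all of them, and
  one tableau whose rotations can be told apart, in triangular fashion, by suitable tabloids.\<close>

lemma minimal_polynomial_spechtI:
  assumes n: "sum_list lam = n" and lead: "lead_coeff p = 1" and d: "degree p = d"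
    and ann: "\<And>t. tableau lam t \<Longrightarrow> poly_op p (specht_rep (long_cycle n)) (polytabloid lam t) = 0"
    and t: "tableau lam t"
    and tri: "\<And>j. j < d \<Longrightarrow> \<exists>Y. polytabloid lam (long_cycle n ^^ j \<circ> t) Y \<noteq> 0 \<and>
        (\<forall>i. j < i \<and> i < d \<longrightarrow> polytabloid lam (long_cycle n ^^ i \<circ> t) Y = 0)"
  shows "is_minimal_polynomial p (specht_module lam) (specht_rep (long_cycle n))"
  unfolding is_minimal_polynomial_def
proof (intro conjI allI impI)
  show "annihilates p (specht_module lam) (specht_rep (long_cycle n))"
    unfolding specht_module_def using ann by (intro annihilates_span[OF _ long_cycle_permutes]) auto
  fix q assume "q \<noteq> 0 \<and> annihilates q (specht_module lam) (specht_rep (long_cycle n))"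
  moreover have "polytabloid lam t \<in> specht_module lam"
    unfolding specht_module_def using t by (intro cfun.span_base) auto
  ultimately show "degree p \<le> degree q"
    unfolding d using tri
    by (intro annihilating_degree_ge[where v = "polytabloid lam t" and V = "specht_module lam"
          and T = "specht_rep (long_cycle n)"])
       (simp_all add: specht_rep_funpow_polytabloid[OF n])
qed (rule lead)

lemma degree_monom_minus_1:
  assumes "n > 0"
  shows "degree (monom 1 n - 1 :: complex poly) = n" "lead_coeff (monom 1 n - 1 :: complex poly) = 1"
    "coeff (monom 1 n - 1 :: complex poly) i = (if i = n then 1 else if i = 0 then -1 else 0)"
proof -
  show *: "coeff (monom 1 n - 1 :: complex poly) i = (if i = n then 1 else if i = 0 then -1 else 0)" for i
    using assms by (auto simp: coeff_1)
  show "degree (monom 1 n - 1 :: complex poly) = n"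
    using assms by (intro antisym degree_le le_degree) (auto simp: coeff_1)
  then show "lead_coeff (monom 1 n - 1 :: complex poly) = 1"
    using assms by (simp add: *)
qed

lemma monom_minus_1_annihilates:
  assumes n: "sum_list lam = n" "n > 0"
  shows "poly_op (monom 1 n - 1) (specht_rep (long_cycle n)) (polytabloid lam t) = 0"
proof
  fix Y
  have "poly_op (monom 1 n - 1) (specht_rep (long_cycle n)) (polytabloid lam t) Y =
      (\<Sum>i\<le>n. (if i = n then polytabloid lam t Y else 0) - (if i = 0 then polytabloid lam t Y else 0))"
    unfolding poly_op_polytabloid[OF n(1)] degree_monom_minus_1(1)[OF n(2)] degree_monom_minus_1(3)[OF n(2)]
    using n(2) by (intro sum.cong) (auto simp: long_cycle_funpow_period)
  then show "poly_op (monom 1 n - 1) (specht_rep (long_cycle n)) (polytabloid lam t) Y = 0 Y"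
    by (simp add: sum_subtractf)
qed

text \<open>An arrangement of cells at the places \<open>0, \<dots>, n - 1\<close> of a circle, such that each proper rotation
  moves two cells of some common column to places that were occupied by two cells of a common row.\<close>

definition shift_separating :: "(nat \<times> nat) list \<Rightarrow> bool" where
  "shift_separating cs \<longleftrightarrow> (\<forall>i. 0 < i \<and> i < length cs \<longrightarrow>
     (\<exists>x<length cs. \<exists>y<length cs. x \<noteq> y \<and> snd (cs ! x) = snd (cs ! y) \<and>
        fst (cs ! ((x + i) mod length cs)) = fst (cs ! ((y + i) mod length cs))))"

text \<open>Fill the cell at place \<open>x\<close> with \<open>x + 1\<close>; then the long cycle acts by rotating the circle. The
  tabloid of the \<open>j\<close>-th rotation occurs in the polytabloid of that rotation, but in none of the
  polytabloids of the others, because it has two entries of one of their columns in the same row. So the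
  \<open>n\<close> rotated polytabloids are linearly independent.\<close>

lemma minimal_polynomial_shift_separating:
  assumes n: "sum_list lam = n" "n > 0"
    and cs: "distinct cs" "set cs = young_diagram lam" "shift_separating cs"
  shows "is_minimal_polynomial (monom 1 n - 1) (specht_module lam) (specht_rep (long_cycle n))"
proof -
  have len: "length cs = n"
    using card_young_diagram[of lam] distinct_card[OF cs(1)] cs(2) n(1) by simp
  define t where "t = Suc \<circ> inv_into {..<n} ((!) cs)"
  have bij: "bij_betw ((!) cs) {..<n} (young_diagram lam)"
    using bij_betw_nth[OF cs(1)] cs(2) len by simp
  have t_nth: "t (cs ! x) = Suc x" if "x < n" for x
    using that bij by (simp add: t_def bij_betw_def inv_into_f_f)
  have "bij_betw Suc {..<n} {1..n}"
    by (rule bij_betwI[where g = "\<lambda>x. x - 1"]) auto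
  then have t: "tableau lam t"
    unfolding tableau_def n(1) t_def by (rule bij_betw_trans[OF bij_betw_inv_into[OF bij]])
  let ?t = "\<lambda>i. long_cycle n ^^ i \<circ> t"
  have tn: "?t i (cs ! x) = Suc ((x + i) mod n)" if "x < n" for i x
    using that by (simp add: t_nth long_cycle_funpow_apply)
  have ti: "tableau lam (?t i)" for i
    using long_cycle_funpow_permutes n(1) by (intro tableau_comp t) simp
  have zero: "polytabloid lam (?t i) (tabloid_of lam (?t j)) = 0" if ij: "j < i" "i < n" for i j
  proof -
    obtain x y where xy: "x < n" "y < n" "x \<noteq> y" "snd (cs ! x) = snd (cs ! y)"
        "fst (cs ! ((x + (i - j)) mod n)) = fst (cs ! ((y + (i - j)) mod n))"
      using cs(3) ij unfolding shift_separating_def len by (metis zero_less_diff less_imp_diff_less)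
    have mem: "cs ! z \<in> young_diagram lam" if "z < n" for z
      using that cs(2) len nth_mem by blast
    have in_row: "?t i (cs ! z) \<in> tabloid_of lam (?t j) (fst (cs ! ((z + (i - j)) mod n)))" if "z < n" for z
    proof -
      have "((z + (i - j)) mod n + j) mod n = (z + i) mod n"
        using ij by (simp add: mod_add_left_eq)
      then have "?t j (cs ! ((z + (i - j)) mod n)) = ?t i (cs ! z)"
        using that n(2) by (simp only: tn mod_less_divisor)
      then show ?thesis
        using tabloid_ofI[OF mem[of "(z + (i - j)) mod n"], of "?t j"] n(2) by simp
    qed
    have "?t i (cs ! x) \<noteq> ?t i (cs ! y)"
    proof
      assume "?t i (cs ! x) = ?t i (cs ! y)"
      then have "cs ! x = cs ! y"
        by (rule tableau_eqD[OF ti _ mem[OF xy(1)] mem[OF xy(2)]])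
      then show False
        using xy(1-3) cs(1) len by (simp add: nth_eq_iff_index_eq)
    qed
    then show ?thesis
      using column_ofI[OF mem[OF xy(1)], of "?t i"] column_ofI[OF mem[OF xy(2)], of "?t i"]
        in_row[OF xy(1)] in_row[OF xy(2)] xy(4,5)
      by (intro polytabloid_eq_0[OF ti, of "?t i (cs ! x)" i "snd (cs ! x)" "?t i (cs ! y)"]) simp_all
  qed
  show ?thesis
  proof (rule minimal_polynomial_spechtI[OF n(1) _ _ monom_minus_1_annihilates[OF n] t])
    fix j assume "j < n"
    then show "\<exists>Y. polytabloid lam (?t j) Y \<noteq> 0 \<and> (\<forall>i. j < i \<and> i < n \<longrightarrow> polytabloid lam (?t i) Y = 0)"
      using zero polytabloid_apply_same_columns[OF ti ti, of j j] by blast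
  qed (use degree_monom_minus_1[OF n(2)] in simp_all)
qed

section \<open>Cyclic arrangements of the cells of a diagram\<close>

definition separable :: "(nat \<times> nat) set \<Rightarrow> bool" where
  "separable D \<longleftrightarrow> (\<exists>cs. distinct cs \<and> set cs = D \<and> shift_separating cs)"

text \<open>Exchanging rows and columns amounts to reversing the direction of the rotation. Hence only one
  of each pair of conjugate shapes has to be arranged.\<close>

lemma shift_separating_swap:
  assumes "shift_separating cs"
  shows "shift_separating (map prod.swap cs)"
  unfolding shift_separating_def
proof (intro allI impI)
  let ?n = "length cs"
  fix i assume "0 < i \<and> i < length (map prod.swap cs)"
  then have i: "0 < ?n - i" "?n - i < ?n" "0 < i" "i < ?n" by auto
  then obtain x y where xy: "x < ?n" "y < ?n" "x \<noteq> y" "snd (cs ! x) = snd (cs ! y)"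
      "fst (cs ! ((x + (?n - i)) mod ?n)) = fst (cs ! ((y + (?n - i)) mod ?n))"
    using assms unfolding shift_separating_def by blast
  let ?s = "\<lambda>z. (z + (?n - i)) mod ?n"
  have unshift: "(?s z + i) mod ?n = z" if "z < ?n" for z
    using that i by (simp add: mod_add_left_eq)
  have lt: "?s z < ?n" for z
    using i by (intro mod_less_divisor) linarith
  have "?s x \<noteq> ?s y"
    using unshift[OF xy(1)] unshift[OF xy(2)] xy(3) by metis
  then have "?s x < ?n \<and> ?s y < ?n \<and> ?s x \<noteq> ?s y \<and>
      snd (map prod.swap cs ! ?s x) = snd (map prod.swap cs ! ?s y) \<and>
      fst (map prod.swap cs ! ((?s x + i) mod ?n)) = fst (map prod.swap cs ! ((?s y + i) mod ?n))"
    using lt xy by (simp only: unshift nth_map snd_swap fst_swap simp_thms)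
  then show "\<exists>x<length (map prod.swap cs). \<exists>y<length (map prod.swap cs). x \<noteq> y \<and>
      snd (map prod.swap cs ! x) = snd (map prod.swap cs ! y) \<and>
      fst (map prod.swap cs ! ((x + i) mod length (map prod.swap cs))) =
      fst (map prod.swap cs ! ((y + i) mod length (map prod.swap cs)))"
    unfolding length_map by blast
qed

lemma separable_swap: "separable D \<Longrightarrow> separable (prod.swap ` D)"
  unfolding separable_def
  by (metis shift_separating_swap distinct_map inj_swap inj_on_subset subset_UNIV set_map)

text \<open>The arrangement is a closed walk through the cells that stays in one column inside a segment
  \<open>f j\<close> and in one row when it passes to the next segment. Suppose that a rotation does not separate.
  Comparing neighbouring places, a step inside a segment must be rotated onto a step inside a segment.
  Iterating this around the circle, the rotation permutes the starting places of the segments, so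
  it moves segment \<open>0\<close> to a segment \<open>j\<close> of the same length, and the segment before \<open>0\<close> to the one
  before \<open>j\<close>, again of the same length. The last assumption excludes this.\<close>

lemma shift_separating_linked_segments:
  fixes f :: "nat \<Rightarrow> (nat \<times> nat) list"
  assumes ne: "\<And>j. j < m \<Longrightarrow> f j \<noteq> []"
    and col: "\<And>j b b'. j < m \<Longrightarrow> b \<in> set (f j) \<Longrightarrow> b' \<in> set (f j) \<Longrightarrow> snd b = snd b'"
    and link: "\<And>j. j < m \<Longrightarrow> fst (last (f j)) = fst (hd (f (Suc j mod m)))"
    and aper: "\<And>j. 0 < j \<Longrightarrow> j < m \<Longrightarrow> length (f j) = length (f 0) \<Longrightarrow>
      length (f (j - 1)) = length (f (m - 1)) \<Longrightarrow> False"
  shows "shift_separating (concat (map f [0..<m]))"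
proof (rule ccontr)
  define cs where "cs = concat (map f [0..<m])"
  define n where "n = length cs"
  define P where "P j = length (concat (map f [0..<j]))" for j
  define S where "S x \<longleftrightarrow> (\<exists>j<m. x mod n = P j)" for x
  let ?len = "\<lambda>j. length (f j)"
  assume "\<not> ?thesis"
  then obtain i where i: "0 < i" "i < n" and
      nosep: "\<And>x y. x < n \<Longrightarrow> y < n \<Longrightarrow> x \<noteq> y \<Longrightarrow> snd (cs ! x) = snd (cs ! y) \<Longrightarrow>
        fst (cs ! ((x + i) mod n)) \<noteq> fst (cs ! ((y + i) mod n))"
    unfolding shift_separating_def cs_def n_def by blast
  have P0: "P 0 = 0" and PSuc: "P (Suc j) = P j + ?len j" and Pm: "P m = n" for j
    by (simp_all add: P_def n_def cs_def)
  have Pmono: "P j \<le> P k" if "j \<le> k" for j k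
    by (rule lift_Suc_mono_le[OF _ that]) (simp add: PSuc)
  have len_pos: "?len j > 0" if "j < m" for j
    using ne[OF that] by simp
  have Plt: "P j + d < n" if "j < m" "d < ?len j" for j d
    using Pmono[of "Suc j" m] that by (simp add: PSuc Pm)
  have nth: "cs ! (P j + d) = f j ! d" if "j < m" "d < ?len j" for j d
  proof -
    have "[0..<m] = [0..<j] @ j # [Suc j..<m]"
      using that(1) by (metis le_add_same_cancel1 less_imp_le_nat upt_add_eq_append upt_conv_Cons zero_le add.left_neutral le_add_diff_inverse)
    then have "cs = concat (map f [0..<j]) @ f j @ concat (map f [Suc j..<m])"
      by (simp add: cs_def)
    then show ?thesis
      using that(2) by (simp add: P_def nth_append)
  qed
  have pos: "\<exists>j<m. \<exists>d<?len j. x = P j + d" if "x < n" for x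
  proof -
    have "\<exists>j<k. \<exists>d<?len j. x = P j + d" if "x < P k" for k
      using that
    proof (induction k)
      case (Suc k)
      show ?case
      proof (cases "x < P k")
        case True
        then show ?thesis using Suc.IH less_SucI by blast
      next
        case False
        then show ?thesis
          using Suc.prems by (intro exI[of _ k] conjI exI[of _ "x - P k"]) (auto simp: PSuc)
      qed
    qed (simp add: P0)
    then show ?thesis using that Pm by blast
  qed
  have m: "m > 0"
    using i Pm P0 by (cases m) auto
  have S_mod: "S (x mod n) = S x" and S_add: "S (x + n) = S x" for x
    by (simp_all add: S_def)
  have S_P: "S (P j)" if "j \<le> m" for j
  proof (cases "j < m")
    case True
    then show ?thesis using Plt[of j 0] len_pos[of j] unfolding S_def by auto
  next
    case False
    then have "P j mod n = P 0" using that Pm P0 by simp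
    then show ?thesis using m unfolding S_def by blast
  qed
  have S_inner: "\<not> S (P j + d)" if jd: "j < m" "0 < d" "d < ?len j" for j d
  proof
    assume "S (P j + d)"
    then obtain k where k: "P j + d = P k"
      using Plt[OF jd(1,3)] by (auto simp: S_def)
    then show False
      using Pmono[of k j] Pmono[of "Suc j" k] jd PSuc[of j] by (cases "k \<le> j") auto
  qed
  have n2: "n > 1" using i by simp
  have same_col: "snd (cs ! (x mod n)) = snd (cs ! (Suc x mod n))" if "\<not> S (Suc x)" for x
  proof -
    obtain j d where jd: "j < m" "d < ?len j" "x mod n = P j + d"
      using pos[of "x mod n"] n2 by auto
    have "Suc (x mod n) mod n = Suc x mod n" by (rule mod_Suc_eq)
    have "Suc d < ?len j"
    proof (rule ccontr)
      assume "\<not> Suc d < ?len j"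
      then have "Suc (x mod n) = P (Suc j)"
        using jd by (simp add: PSuc)
      then have "S (Suc (x mod n))"
        using S_P[of "Suc j"] jd(1) by simp
      then show False
        using that S_mod \<open>Suc (x mod n) mod n = Suc x mod n\<close> by metis
    qed
    moreover from this have "Suc x mod n = P j + Suc d"
      using Plt[OF jd(1)] jd(3) \<open>Suc (x mod n) mod n = Suc x mod n\<close> by (metis add_Suc_right mod_less)
    ultimately show ?thesis
      using jd nth[OF jd(1)] col[OF jd(1)] nth_mem by metis
  qed
  have same_row: "fst (cs ! (x mod n)) = fst (cs ! (Suc x mod n))" if S: "S (Suc x)" for x
  proof -
    obtain j where j: "j < m" "Suc x mod n = P j"
      using S by (auto simp: S_def)
    have hd: "cs ! P k = hd (f k)" if "k < m" for k
      using nth[OF that, of 0] len_pos[OF that] by (simp add: hd_conv_nth)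
    have last: "cs ! (P (Suc k) - 1) = last (f k)" if "k < m" for k
      using nth[OF that, of "?len k - 1"] len_pos[OF that] by (simp add: last_conv_nth PSuc)
    show ?thesis
    proof (cases j)
      case 0
      then have "Suc (x mod n) = n"
        using j(2) P0 n2 by (simp add: mod_Suc split: if_splits)
      then have "x mod n = P (Suc (m - 1)) - 1"
        using m Pm by simp
      then show ?thesis
        using last[of "m - 1"] hd[of 0] link[of "m - 1"] m j 0 by simp
    next
      case (Suc k)
      then have "P j > 0"
        using PSuc[of k] len_pos[of k] j by simp
      then have "Suc (x mod n) = P j"
        using j(2) by (simp add: mod_Suc split: if_splits)
      then have "x mod n = P (Suc k) - 1"
        using Suc by simp
      then show ?thesis
        using last[of k] hd[of j] link[of k] j Suc by simp
    qed
  qed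
  have S_back: "S z" if "S (z + i)" for z
  proof (rule ccontr)
    assume "\<not> S z"
    define x where "x = z + n - 1"
    have x: "Suc x = z + n" using n2 by (simp add: x_def)
    then have "\<not> S (Suc x)"
      using \<open>\<not> S z\<close> S_add by simp
    then have "snd (cs ! (x mod n)) = snd (cs ! (Suc x mod n))"
      by (rule same_col)
    moreover have "x mod n \<noteq> Suc x mod n"
      using n2 by (simp add: mod_Suc)
    ultimately have "fst (cs ! ((x mod n + i) mod n)) \<noteq> fst (cs ! ((Suc x mod n + i) mod n))"
      using n2 by (intro nosep) simp_all
    then have "fst (cs ! ((x + i) mod n)) \<noteq> fst (cs ! (Suc (x + i) mod n))"
      by (simp add: mod_add_left_eq)
    then have "\<not> S (Suc (x + i))"
      using same_row by blast
    moreover have "Suc (x + i) = (z + i) + n" using x by simp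
    ultimately show False
      using that S_add by simp
  qed
  \<comment> \<open>As \<open>n * i\<close> places are a whole number of turns, the implication \<open>S_back\<close> can be reversed by applying it \<open>n - 1\<close> times.\<close>
  have S_iter: "S z" if "S (z + k * i)" for z k
    using that
  proof (induction k)
    case (Suc k)
    then show ?case using S_back[of "z + k * i"] by (simp add: algebra_simps)
  qed simp
  have S_shift: "S (z + i) \<longleftrightarrow> S z" for z
  proof
    assume "S z"
    moreover have "(z + i + (n - 1) * i) mod n = z mod n"
    proof -
      have "z + i + (n - 1) * i = z + n * i"
        using n2 by (cases n) auto
      then show ?thesis by (simp only: mod_mult_self2)
    qed
    ultimately have "S (z + i + (n - 1) * i)"
      using S_mod by metis
    then show "S (z + i)" by (rule S_iter)
  qed (rule S_back)
  have "S 0" using S_P[of 0] P0 by simp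
  then have "S i" using S_shift[of 0] by simp
  then obtain j where j: "j < m" "i = P j"
    using i by (auto simp: S_def)
  have j0: "0 < j"
    using i j P0 by (cases j) auto
  have "?len j = ?len 0"
  proof (rule linorder_cases[of "?len j" "?len 0"])
    assume lt: "?len j < ?len 0"
    have "S (?len j + i)"
      using S_P[of "Suc j"] j by (simp add: PSuc add.commute)
    then show ?thesis
      using S_inner[OF m _ lt] S_shift len_pos[OF j(1)] by (simp add: P0)
  next
    assume lt: "?len 0 < ?len j"
    have "S (?len 0)"
      using S_P[of "Suc 0"] m by (simp add: PSuc P0)
    then show ?thesis
      using S_inner[OF j(1) _ lt] S_shift[of "?len 0"] len_pos[OF m] j by (simp add: add.commute)
  qed
  moreover have "?len (j - 1) = ?len (m - 1)"
  proof -
    define l l' where "l = ?len (j - 1)" and "l' = ?len (m - 1)"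
    have Pj: "i = P (j - 1) + l"
      using PSuc[of "j - 1"] j j0 by (simp add: l_def)
    have Pn: "n = P (m - 1) + l'"
      using PSuc[of "m - 1"] m Pm by (simp add: l'_def)
    have l: "0 < l" "0 < l'"
      using len_pos[of "j - 1"] len_pos[of "m - 1"] j m by (simp_all add: l_def l'_def)
    have "l = l'"
    proof (rule linorder_cases[of l l'])
      assume lt: "l < l'"
      have "S (P (j - 1) + n)"
        using S_P[of "j - 1"] j S_add by simp
      moreover have "P (j - 1) + n = P (m - 1) + (l' - l) + i"
        using lt Pj Pn by simp
      ultimately have "S (P (m - 1) + (l' - l))"
        using S_shift by simp
      then show ?thesis
        using S_inner[of "m - 1" "l' - l"] m lt l by (simp add: l'_def)
    next
      assume lt: "l' < l"
      have "S (P (m - 1) + i)"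
        using S_P[of "m - 1"] S_shift by simp
      moreover have "P (m - 1) + i = P (j - 1) + (l - l') + n"
        using lt Pj Pn by simp
      ultimately have "S (P (j - 1) + (l - l'))"
        using S_add by simp
      then show ?thesis
        using S_inner[of "j - 1" "l - l'"] j lt l by (simp add: l_def)
    qed
    then show ?thesis by (simp add: l_def l'_def)
  qed
  ultimately show False
    using aper[OF j0 j(1)] by blast
qed

section \<open>Constructing the arrangements\<close>

text \<open>The cells of a column of length \<open>c\<close> in an order that starts in row \<open>p\<close> and ends in row \<open>q\<close>.\<close>

definition link_path :: "nat \<Rightarrow> nat \<Rightarrow> nat \<Rightarrow> nat list" where
  "link_path c p q = (if p = q then [p] else p # filter (\<lambda>r. r \<noteq> p \<and> r \<noteq> q) [0..<c] @ [q])"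

lemma hd_link_path: "hd (link_path c p q) = p"
  and last_link_path: "last (link_path c p q) = q"
  and link_path_neq_Nil: "link_path c p q \<noteq> []"
  and distinct_link_path: "distinct (link_path c p q)"
  by (auto simp: link_path_def)

lemma set_link_path:
  assumes "p \<noteq> q \<and> p < c \<and> q < c \<or> p = 0 \<and> q = 0 \<and> c = 1"
  shows "set (link_path c p q) = {..<c}"
  using assms by (auto simp: link_path_def)

lemma length_link_path:
  assumes "p \<noteq> q \<and> p < c \<and> q < c \<or> p = 0 \<and> q = 0 \<and> c = 1"
  shows "length (link_path c p q) = c"
  using distinct_card[OF distinct_link_path[of c p q]] set_link_path[OF assms] by simp

lemma distinct_concat_map_upt:
  assumes "\<And>j. j < m \<Longrightarrow> distinct (f j)"
    and "\<And>i j. i < m \<Longrightarrow> j < m \<Longrightarrow> i \<noteq> j \<Longrightarrow> set (f i) \<inter> set (f j) = {}"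
  shows "distinct (concat (map f [0..<m]))"
  using assms
proof (induction m)
  case (Suc m)
  have "set (f i) \<inter> set (f m) = {}" if "i < m" for i
    using Suc.prems(2)[of i m] that by simp
  moreover have "distinct (concat (map f [0..<m]))"
    using Suc.prems by (intro Suc.IH) auto
  moreover have "set (concat (map f [0..<m])) = (\<Union>i<m. set (f i))"
    by auto
  ultimately have "set (concat (map f [0..<m])) \<inter> set (f m) = {}"
    by blast
  with \<open>distinct (concat (map f [0..<m]))\<close> show ?case
    using Suc.prems(1)[of m] by (simp del: set_concat)
qed simp

text \<open>The segments are the columns, from left to right, and column \<open>j\<close> is linked to the next one in
  row \<open>q j\<close>. Their lengths decrease, and strictly at least once, so a column as long as the first one
  is never preceded by one as short as the last one.\<close>

lemma separable_linked_columns: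
  fixes c q :: "nat \<Rightarrow> nat"
  defines "p \<equiv> \<lambda>j. if j = 0 then 0 else q (j - 1)"
  assumes a: "a > 0" and q_last: "q (a - 1) = 0"
    and anti: "\<And>i j. i \<le> j \<Longrightarrow> j < a \<Longrightarrow> c j \<le> c i" and less: "c (a - 1) < c 0"
    and pq: "\<And>j. j < a \<Longrightarrow> p j \<noteq> q j \<and> p j < c j \<and> q j < c j \<or> p j = 0 \<and> q j = 0 \<and> c j = 1"
  shows "separable {(i, j). j < a \<and> i < c j}"
  unfolding separable_def
proof (intro exI conjI)
  define f where "f j = map (\<lambda>r. (r, j)) (link_path (c j) (p j) (q j))" for j
  have set_f: "set (f j) = (\<lambda>r. (r, j)) ` {..<c j}" if "j < a" for j
    by (simp add: f_def set_link_path[OF pq[OF that]])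
  have len_f: "length (f j) = c j" if "j < a" for j
    by (simp add: f_def length_link_path[OF pq[OF that]])
  show "distinct (concat (map f [0..<a]))"
  proof (rule distinct_concat_map_upt)
    show "distinct (f j)" for j
      by (simp add: f_def distinct_map distinct_link_path inj_on_def)
  qed (auto simp: set_f)
  show "set (concat (map f [0..<a])) = {(i, j). j < a \<and> i < c j}"
    by (auto simp: set_f)
  show "shift_separating (concat (map f [0..<a]))"
  proof (rule shift_separating_linked_segments)
    fix j assume j: "j < a"
    show "f j \<noteq> []" by (simp add: f_def link_path_neq_Nil)
    show "snd b = snd b'" if "b \<in> set (f j)" "b' \<in> set (f j)" for b b'
      using that by (auto simp: f_def)
    have "p (Suc j mod a) = q j"
      using j q_last by (cases "Suc j = a") (auto simp: p_def)
    then show "fst (last (f j)) = fst (hd (f (Suc j mod a)))"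
      by (simp add: f_def last_map hd_map link_path_neq_Nil hd_link_path last_link_path)
  next
    fix j assume j: "0 < j" "j < a" "length (f j) = length (f 0)" "length (f (j - 1)) = length (f (a - 1))"
    then show False
      using anti[of "j - 1" j] less by (simp add: len_f)
  qed
qed

text \<open>The rows \<open>0\<close> and \<open>1\<close> could be used alternately for the links between the first \<open>k\<close> columns, those
  of length at least two, but the walk has to close up in row \<open>0\<close>. Linking the first two columns in
  row \<open>2\<close> makes this possible for both parities of \<open>k\<close>; the columns of length one are linked in row \<open>0\<close>,
  where the truncated subtraction \<open>k - 1 - j\<close> gives \<open>0\<close>.\<close>

lemma separable_long_columns:
  assumes k: "2 \<le> k" "k \<le> a" and c2: "\<And>j. j < k \<Longrightarrow> 2 \<le> c j" and c1: "\<And>j. k \<le> j \<Longrightarrow> j < a \<Longrightarrow> c j = 1"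
    and c3: "3 \<le> c 1"
    and anti: "\<And>i j. i \<le> j \<Longrightarrow> j < a \<Longrightarrow> c j \<le> c i" and less: "c (a - 1) < c 0"
  shows "separable {(i, j). j < a \<and> i < c j}"
proof (rule separable_linked_columns[where q = "\<lambda>j. if j = 0 then 2 else (k - 1 - j) mod 2"])
  fix j assume j: "j < a"
  have c0: "3 \<le> c 0"
    using c3 anti[of 0 1] k by simp
  let ?q = "\<lambda>j. if j = 0 then 2 else (k - 1 - j) mod 2"
  let ?p = "if j = 0 then 0 else ?q (j - 1)"
  consider "j = 0" | "j = 1" | "2 \<le> j" "j < k" | "k \<le> j" by linarith
  then show "?p \<noteq> ?q j \<and> ?p < c j \<and> ?q j < c j \<or> ?p = 0 \<and> ?q j = 0 \<and> c j = 1"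
  proof cases
    case 3
    have "(k - 1 - (j - 1)) = Suc (k - 1 - j)"
      using 3 by simp
    moreover have "Suc x mod 2 \<noteq> x mod 2" for x :: nat
      by presburger
    ultimately have "(k - 1 - (j - 1)) mod 2 \<noteq> (k - 1 - j) mod 2"
      by metis
    moreover have "x mod 2 < c j" for x :: nat
      using c2[OF 3(2)] by (meson less_le_trans mod_less_divisor pos2)
    ultimately show ?thesis using 3 by simp
  next
    case 4
    then show ?thesis using c1[OF 4 j] k by auto
  next
    case 2
    have "(k - 1 - 1) mod 2 < 2" by simp
    then have "(k - 1 - 1) mod 2 \<noteq> 2" "(k - 1 - 1) mod 2 < c 1" "2 < c 1"
      using c3 by linarith+
    then show ?thesis using 2 by simp
  qed (use c0 in simp)
qed (use k anti less in auto)

text \<open>Here all columns have the same length, so the walk of the previous lemma would be periodic. The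
  period is destroyed by moving the cell \<open>(2, k - 1)\<close> out of the last column: as the first two columns
  are linked in row \<open>2\<close>, it can be inserted between them, as a segment of length one.\<close>

lemma separable_rectangle:
  assumes l: "3 \<le> l" and k: "3 \<le> k"
  shows "separable {(i, j). j < k \<and> i < l}"
  unfolding separable_def
proof (intro exI conjI)
  define q where "q j = (if j = 0 then 2 else (k - 1 - j) mod 2)" for j
  define S where "S j = map (\<lambda>r. (r, j)) (link_path l (if j = 0 then 0 else q (j - 1)) (q j))" for j
  define f where "f j = (if j = 0 then S 0 else if j = 1 then [(2, k - 1)] else if j < k then S (j - 1)
      else map (\<lambda>r. (r, k - 1)) (1 # [3..<l] @ [0]))" for j
  have pq: "p \<noteq> q j \<and> p < l \<and> q j < l" if "p = (if j = 0 then 0 else q (j - 1))" "j < k - 1" for p j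
  proof -
    have "x mod 2 < l" "x mod 2 \<noteq> 2" for x :: nat
      using l less_le_trans[of "x mod 2" 2 l] mod_less_divisor[of 2 x] by linarith+
    moreover have "(k - 1 - (j - 1)) mod 2 \<noteq> (k - 1 - j) mod 2" if "j > 0"
    proof -
      have "(k - 1 - (j - 1)) = Suc (k - 1 - j)"
        using that \<open>j < k - 1\<close> by simp
      moreover have "Suc x mod 2 \<noteq> x mod 2" for x :: nat
        by presburger
      ultimately show ?thesis by metis
    qed
    moreover consider "j = 0" | "j = 1" | "j > 1" by linarith
    ultimately show ?thesis
      using l that by cases (auto simp: q_def nat_neq_iff)
  qed
  have set_S: "set (S j) = (\<lambda>r. (r, j)) ` {..<l}" if "j < k - 1" for j
    using pq[OF refl that] by (simp add: S_def set_link_path)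
  have len_S: "length (S j) = l" if "j < k - 1" for j
    using pq[OF refl that] by (simp add: S_def length_link_path)
  have dist_S: "distinct (S j)" for j
    by (simp add: S_def distinct_map distinct_link_path inj_on_def)
  have set_f: "set (f j) = (if j = 0 then (\<lambda>r. (r, 0)) ` {..<l} else if j = 1 then {(2, k - 1)}
      else if j < k then (\<lambda>r. (r, j - 1)) ` {..<l} else (\<lambda>r. (r, k - 1)) ` ({..<l} - {2}))" for j
  proof -
    have "set (1 # [3..<l] @ [0]) = {..<l} - {2}"
      using l by auto
    then have "set (map (\<lambda>r. (r, k - 1)) (1 # [3..<l] @ [0])) = (\<lambda>r. (r, k - 1)) ` ({..<l} - {2})"
      by (metis set_map)
    then show ?thesis
      using k unfolding f_def by (simp add: set_S del: list.map)
  qed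
  have len_f: "length (f j) = (if j = 1 then 1 else if j < k then l else l - 1)" for j
  proof -
    have "Suc (Suc (l - 3)) = l - 1"
      using l by simp
    then show ?thesis
      using k by (simp add: f_def len_S)
  qed
  show "distinct (concat (map f [0..<Suc k]))"
  proof (rule distinct_concat_map_upt)
    show "distinct (f j)" for j
      by (auto simp: f_def dist_S distinct_map inj_on_def)
    show "set (f i) \<inter> set (f j) = {}" if "i < Suc k" "j < Suc k" "i \<noteq> j" for i j
      unfolding set_f using that k by (auto split: if_splits)
  qed
  have Un: "set (concat (map f [0..<Suc k])) = (\<Union>j\<in>{..<Suc k}. set (f j))"
    by (simp only: set_concat set_map image_image set_upt lessThan_atLeast0)
  show "set (concat (map f [0..<Suc k])) = {(i, j). j < k \<and> i < l}"
  proof (intro equalityI subsetI)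
    fix b assume "b \<in> set (concat (map f [0..<Suc k]))"
    then obtain u where u: "u < Suc k" "b \<in> set (f u)"
      unfolding Un by blast
    consider "u = 0" | "u = 1" | "2 \<le> u" "u < k" | "u = k"
      using u(1) by linarith
    then show "b \<in> {(i, j). j < k \<and> i < l}"
      by cases (use u(2) l k in \<open>auto simp: set_f\<close>)
  next
    fix b assume "b \<in> {(i, j). j < k \<and> i < l}"
    then obtain i j where b: "b = (i, j)" "j < k" "i < l" by blast
    define u where "u = (if j = 0 then 0 else if j < k - 1 then Suc j else if i = 2 then 1 else k)"
    consider "j = 0" | "0 < j" "j < k - 1" | "j = k - 1" "i = 2" | "j = k - 1" "i \<noteq> 2" "0 < j"
      using b(2) by linarith
    then have "b \<in> set (f u) \<and> u < Suc k"
      by cases (use b k in \<open>auto simp: set_f u_def\<close>)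
    then show "b \<in> set (concat (map f [0..<Suc k]))"
      unfolding Un by blast
  qed
  show "shift_separating (concat (map f [0..<Suc k]))"
  proof (rule shift_separating_linked_segments)
    fix j assume j: "j < Suc k"
    show "f j \<noteq> []" by (simp add: f_def S_def link_path_neq_Nil)
    show "snd b = snd b'" if "b \<in> set (f j)" "b' \<in> set (f j)" for b b'
      using that by (auto simp: set_f split: if_split_asm)
    have hd: "fst (hd (S j)) = (if j = 0 then 0 else q (j - 1))" and last: "fst (last (S j)) = q j" for j
      by (simp_all add: S_def last_map hd_map link_path_neq_Nil hd_link_path last_link_path)
    consider "j = 0" | "j = 1" | "2 \<le> j" "Suc j < k" | "2 \<le> j" "Suc j = k" | "j = k"
      using j by linarith
    then show "fst (last (f j)) = fst (hd (f (Suc j mod Suc k)))"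
    proof cases
      case 4
      then have "q (j - 1) = 1" by (auto simp: q_def)
      then show ?thesis using 4 by (simp add: f_def last hd)
    qed (use k in \<open>auto simp: f_def last hd q_def\<close>)
  next
    fix j assume "0 < j" "j < Suc k" "length (f j) = length (f 0)" "length (f (j - 1)) = length (f (Suc k - 1))"
    then show False
      using l k by (auto simp: len_f split: if_splits)
  qed
qed

text \<open>Closed walks are of no use for two rows of equal length \<open>4\<close>, as all of them are periodic. Instead,
  take the first row followed by the second one, and exchange the two cells at the place where the rows
  meet. The three columns \<open>{2 * r + 7, 0}\<close>, \<open>{r + 4, r + 5}\<close> and \<open>{r + 2, r + 3}\<close> of neighbouring places
  suffice: a rotation can fail to move the pair into one row only if it takes the pair to one of the four
  places where the row changes.\<close>

lemma separable_two_rows: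
  "separable {(i, j). i < 2 \<and> j < r + 4}"
  unfolding separable_def
proof (intro exI conjI)
  define g where "g x = (if x = 0 then (0, 0) else if x < r + 2 then (0, x + 2)
      else if x = r + 2 then (0, 2) else if x = r + 3 then (1, 2) else if x = r + 4 then (0, 1)
      else if x = r + 5 then (1, 1) else if x < 2 * r + 7 then (1, x - (r + 3)) else (1::nat, 0::nat))" for x
  define h where "h b = (case b of (i, j) \<Rightarrow> if i = 0
      then (if j = 0 then 0 else if j = 1 then r + 4 else if j = 2 then r + 2 else j - 2)
      else (if j = 0 then 2 * r + 7 else if j = 1 then r + 5 else if j = 2 then r + 3 else j + (r + 3)))"
    for b :: "nat \<times> nat"
  have gh: "h (g x) = x \<and> fst (g x) < 2 \<and> snd (g x) < r + 4 \<and> fst (g x) = (if x < r + 3 \<or> x = r + 4 then 0 else 1)"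
    if lt: "x < 2 * (r + 4)" for x
  proof -
    have "x = 0 \<or> 0 < x \<and> x < r + 2 \<or> x = r + 2 \<or> x = r + 3 \<or> x = r + 4 \<or> x = r + 5
        \<or> r + 6 \<le> x \<and> x < 2 * r + 7 \<or> x = 2 * r + 7"
      using lt by presburger
    then consider "x = 0" | "0 < x" "x < r + 2" | "x = r + 2" | "x = r + 3" | "x = r + 4" | "x = r + 5"
      | "r + 6 \<le> x" "x < 2 * r + 7" | "x = 2 * r + 7"
      by blast
    then show ?thesis
    proof cases
      case 7
      then have "3 \<le> x - (r + 3)" "x - (r + 3) < r + 4"
        by linarith+
      then show ?thesis using 7 by (simp add: g_def h_def)
    qed (simp_all add: g_def h_def)
  qed
  have inj: "inj_on g {..<2 * (r + 4)}"
    by (rule inj_on_inverseI[of _ h]) (use gh in simp)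
  show "distinct (map g [0..<2 * (r + 4)])"
    using inj by (simp add: distinct_map lessThan_atLeast0)
  have "g ` {..<2 * (r + 4)} \<subseteq> {(i, j). i < 2 \<and> j < r + 4}"
  proof (intro image_subsetI)
    fix x assume "x \<in> {..<2 * (r + 4)}"
    then show "g x \<in> {(i, j). i < 2 \<and> j < r + 4}"
      using gh[of x] by (cases "g x") auto
  qed
  moreover have "{(i, j). i < 2 \<and> j < r + 4} = {..<2::nat} \<times> {..<r + 4}"
    by auto
  ultimately have "g ` {..<2 * (r + 4)} = {(i, j). i < 2 \<and> j < r + 4}"
    using card_image[OF inj] by (intro card_subset_eq) auto
  then show "set (map g [0..<2 * (r + 4)]) = {(i, j). i < 2 \<and> j < r + 4}"
    by (simp add: lessThan_atLeast0)
  have row: "fst (g x) = (if x < r + 3 \<or> x = r + 4 then 0 else 1)" if "x < 2 * (r + 4)" for x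
    using gh[OF that] by simp
  have sep: "\<exists>x<2 * (r + 4). \<exists>y<2 * (r + 4). x \<noteq> y \<and> snd (g x) = snd (g y) \<and> fst (g ((x + i) mod (2 * (r + 4)))) = fst (g ((y + i) mod (2 * (r + 4))))"
    if i: "0 < i" "i < 2 * (r + 4)" for i
  proof -
    have wit: ?thesis if "x < 2 * (r + 4)" "y < 2 * (r + 4)" "x \<noteq> y" "snd (g x) = snd (g y)"
        "x' < 2 * (r + 4)" "y' < 2 * (r + 4)" "x + i = x' \<or> x + i = x' + 2 * (r + 4)" "y + i = y' \<or> y + i = y' + 2 * (r + 4)"
        "fst (g x') = fst (g y')" for x y x' y'
    proof -
      have "(x + i) mod (2 * (r + 4)) = x'" "(y + i) mod (2 * (r + 4)) = y'"
        using that(5-8) by auto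
      then show ?thesis using that by metis
    qed
    have "i = r + 3 \<or> i < r + 3 \<or> r + 4 \<le> i \<and> i < 2 * r + 6 \<or> i = 2 * r + 6 \<or> i = 2 * r + 7"
      using i by presburger
    then consider "i = r + 3" | "i < r + 3" | "r + 4 \<le> i" "i < 2 * r + 6" | "i = 2 * r + 6" | "i = 2 * r + 7"
      by blast
    then show ?thesis
    proof cases
      case 1
      show ?thesis
        by (rule wit[of "r + 2" "r + 3" "2 * r + 5" "2 * r + 6"]) (use 1 in \<open>simp_all add: row\<close>, simp add: g_def)
    next
      case 2
      show ?thesis
        by (rule wit[of "r + 4" "r + 5" "r + 4 + i" "r + 5 + i"]) (use i 2 in \<open>simp_all add: row\<close>, simp add: g_def)
    next
      case 3
      obtain u where u: "i = u + (r + 4)" "u < r + 2"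
        using 3 by (intro that[of "i - (r + 4)"]) linarith+
      show ?thesis
        by (rule wit[of "r + 4" "r + 5" u "u + 1"]) (use u in \<open>simp_all add: row\<close>, simp add: g_def)
    next
      case 4
      show ?thesis
        by (rule wit[of "2 * r + 7" 0 "2 * r + 5" "2 * r + 6"]) (use 4 in \<open>simp_all add: row\<close>, simp add: g_def)
    next
      case 5
      show ?thesis
        by (rule wit[of "2 * r + 7" 0 "2 * r + 6" "2 * r + 7"]) (use 5 in \<open>simp_all add: row\<close>, simp add: g_def)
    qed
  qed
  have "2 * (r + 4) > 0" by simp
  then show "shift_separating (map g [0..<2 * (r + 4)])"
    using sep unfolding shift_separating_def
    by (simp only: length_map length_upt diff_zero nth_map nth_upt mod_less_divisor add_0 cong: conj_cong) blast
qed

text \<open>The corner is the only cell of a hook that has neighbours both in its row and in its column. Put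
  the first column on an interval of places that begins with the cell \<open>(1, 0)\<close> and continues with the
  corner. The first row then occupies an interval with one place left out, and every proper
  rotation of the column meets it at least twice.\<close>

lemma separable_hook:
  assumes a: "3 \<le> a" and b: "2 \<le> b"
  shows "separable {(i, j). i = 0 \<and> j < a \<or> j = 0 \<and> i \<le> b}"
  unfolding separable_def
proof (intro exI conjI)
  define n where "n = a + b"
  define g where "g x = (if x < a - 1 then (0::nat, x + 1) else if x = a - 1 then (1, 0)
      else if x = a then (0, 0) else (x + 1 - a, 0))" for x
  have inj: "inj_on g {..<n}"
    by (rule inj_onI) (use a in \<open>auto simp: g_def split: if_splits\<close>)
  show "distinct (map g [0..<n])"
    using inj by (simp add: distinct_map lessThan_atLeast0)
  have "g ` {..<n} = {(i, j). i = 0 \<and> j < a \<or> j = 0 \<and> i \<le> b}"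
  proof (intro equalityI subsetI)
    fix z assume "z \<in> {(i, j). i = 0 \<and> j < a \<or> j = 0 \<and> i \<le> b}"
    then obtain i j where z: "z = (i, j)" "i = 0 \<and> j < a \<or> j = 0 \<and> i \<le> b" by auto
    define x where "x = (if j > 0 then j - 1 else if i = 0 then a else if i = 1 then a - 1 else i + a - 1)"
    have "x < n" "z = g x"
      using z a b by (auto simp: x_def g_def n_def)
    then show "z \<in> g ` {..<n}" by blast
  qed (use a b in \<open>auto simp: g_def n_def split: if_splits\<close>)
  then show "set (map g [0..<n]) = {(i, j). i = 0 \<and> j < a \<or> j = 0 \<and> i \<le> b}"
    by (simp add: lessThan_atLeast0)
  have row: "fst (g x) = 0" if "x \<le> a - 2 \<or> x = a" for x
    using that a by (auto simp: g_def)
  have col: "snd (g x) = 0" if "a - 1 \<le> x" for x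
    using that a by (auto simp: g_def)
  have sep: "\<exists>x<n. \<exists>y<n. x \<noteq> y \<and> snd (g x) = snd (g y) \<and> fst (g ((x + i) mod n)) = fst (g ((y + i) mod n))"
    if i: "0 < i" "i < n" for i
  proof -
    have wit: ?thesis if "a - 1 \<le> x" "a - 1 \<le> y" "x < n" "y < n" "x \<noteq> y" "x' < n" "y' < n"
        "x + i = x' \<or> x + i = x' + n" "y + i = y' \<or> y + i = y' + n"
        "x' \<le> a - 2 \<or> x' = a" "y' \<le> a - 2 \<or> y' = a" for x y x' y'
    proof -
      have "(x + i) mod n = x'" "(y + i) mod n = y'"
        using that(6-9) by auto
      then show ?thesis using that row col by metis
    qed
    consider "i = 1" | "2 \<le> i" "i \<le> b + 1" | "b + 2 \<le> i" "i < n - 1" | "i = n - 1" "b + 2 \<le> i"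
      using i a b unfolding n_def by linarith
    then show ?thesis
    proof cases
      case 1
      show ?thesis
        by (rule wit[of "a - 1" "n - 1" a 0]) (use a b 1 in \<open>auto simp: n_def\<close>)
    next
      case 2
      show ?thesis
        by (rule wit[of "n - i" "n + 1 - i" 0 1]) (use a b 2 in \<open>auto simp: n_def\<close>)
    next
      case 3
      show ?thesis
        by (rule wit[of "a - 1" a "i - b - 1" "i - b"]) (use a b 3 in \<open>auto simp: n_def\<close>)
    next
      case 4
      show ?thesis
        by (rule wit[of "a - 1" "a + 1" "a - 2" a]) (use a b 4 in \<open>auto simp: n_def\<close>)
    qed
  qed
  have "n > 0" using a by (simp add: n_def)
  then show "shift_separating (map g [0..<n])"
    using sep unfolding shift_separating_def
    by (simp only: length_map length_upt diff_zero nth_map nth_upt mod_less_divisor add_0 cong: conj_cong) blast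
qed

lemma partition_of_nth_mono:
  assumes "partition_of lam n" "i \<le> j" "j < length lam"
  shows "lam ! j \<le> lam ! i"
  using assms sorted_wrt_nth_less[of "(\<ge>)" lam i j] unfolding partition_of_def
  by (cases "i = j") auto

lemma partition_of_nth_pos:
  assumes "partition_of lam n" "i < length lam"
  shows "0 < lam ! i"
  using assms nth_mem[of i lam] unfolding partition_of_def by (metis gr0I)

definition column_length :: "nat list \<Rightarrow> nat \<Rightarrow> nat" where
  "column_length lam j = length (takeWhile (\<lambda>x. j < x) lam)"

lemma less_column_length_iff:
  assumes "partition_of lam n"
  shows "i < column_length lam j \<longleftrightarrow> i < length lam \<and> j < lam ! i"
proof
  assume i: "i < column_length lam j"
  then have "i < length lam"
    unfolding column_length_def using length_takeWhile_le le_trans less_le_trans by blast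
  moreover have "j < takeWhile (\<lambda>x. j < x) lam ! i"
    using i nth_mem set_takeWhileD unfolding column_length_def by fastforce
  ultimately show "i < length lam \<and> j < lam ! i"
    using i by (simp add: column_length_def takeWhile_nth)
next
  assume i: "i < length lam \<and> j < lam ! i"
  show "i < column_length lam j"
  proof (rule ccontr)
    assume not: "\<not> i < column_length lam j"
    then have "column_length lam j < length lam" using i by simp
    then have "\<not> j < lam ! column_length lam j"
      unfolding column_length_def by (rule nth_length_takeWhile)
    then show False
      using partition_of_nth_mono[OF assms, of "column_length lam j" i] not i by simp
  qed
qed

lemma young_diagram_columns:
  assumes "partition_of lam n" "lam \<noteq> []"
  shows "young_diagram lam = {(i, j). j < lam ! 0 \<and> i < column_length lam j}"
  unfolding young_diagram_def less_column_length_iff[OF assms(1)]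
  using partition_of_nth_mono[OF assms(1), of 0] by (auto intro: less_le_trans)

text \<open>If the third row is longer than one cell, then the second column has length at least three and the
  columns can be linked. Otherwise only the first two rows are longer than one cell; these can be linked
  to each other in the columns \<open>1\<close> and \<open>0\<close>, that is, the conjugate diagram has linked columns.\<close>

lemma separable_not_rectangle:
  assumes lam: "partition_of lam n" and len: "2 \<le> length lam" and k: "2 \<le> lam ! 1"
    and nrect: "lam ! (length lam - 1) < lam ! 0"
  shows "separable (young_diagram lam)"
proof (cases "3 \<le> length lam \<and> 2 \<le> lam ! 2")
  case True
  have "separable {(i, j). j < lam ! 0 \<and> i < column_length lam j}"
  proof (rule separable_long_columns)
    note iff = less_column_length_iff[OF lam]
    show "2 \<le> lam ! 1" by (rule k)
    show "lam ! 1 \<le> lam ! 0"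
      using len by (intro partition_of_nth_mono[OF lam]) auto
    show "2 \<le> column_length lam j" if "j < lam ! 1" for j
      using iff[of 1 j] that len by simp
    show "column_length lam j = 1" if "lam ! 1 \<le> j" "j < lam ! 0" for j
    proof -
      have "0 < length lam" using len by linarith
      then have "0 < column_length lam j" "\<not> 1 < column_length lam j"
        using iff[of 0 j] iff[of 1 j] that by auto
      then show ?thesis by simp
    qed
    show "3 \<le> column_length lam 1"
      using iff[of 2 1] True by simp
    show "column_length lam j \<le> column_length lam i" if "i \<le> j" for i j
      using iff[of "column_length lam j - 1" j] iff[of "column_length lam j - 1" i] that
      by (cases "column_length lam j") auto
    have "length lam - 1 < column_length lam 0"
      using iff[of "length lam - 1" 0] len partition_of_nth_pos[OF lam, of "length lam - 1"] by simp
    moreover have "\<not> length lam - 1 < column_length lam (lam ! 0 - 1)"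
    proof -
      have "\<not> lam ! 0 - 1 < lam ! (length lam - 1)" using nrect by linarith
      then show ?thesis unfolding iff by blast
    qed
    ultimately show "column_length lam (lam ! 0 - 1) < column_length lam 0" by simp
  qed
  then show ?thesis
    using young_diagram_columns[OF lam] len by force
next
  case False
  have "separable {(i, j). j < length lam \<and> i < lam ! j}"
  proof (rule separable_linked_columns[where q = "\<lambda>j. if j = 0 then 1 else 0"])
    fix j assume j: "j < length lam"
    have "1 < lam ! 0"
      using k partition_of_nth_mono[OF lam, of 0 1] len by simp
    have one: "lam ! j = 1" if "2 \<le> j"
      using that j False partition_of_nth_mono[OF lam, of 2 j] partition_of_nth_pos[OF lam j] by simp
    consider "j = 0" | "j = 1" | "2 \<le> j" by linarith
    then show "(if j = 0 then 0 else if j - 1 = 0 then 1 else 0) \<noteq> (if j = 0 then 1 else 0 :: nat) \<and>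
        (if j = 0 then 0 else if j - 1 = 0 then 1 else 0) < lam ! j \<and> (if j = 0 then 1 else 0) < lam ! j \<or>
        (if j = 0 then 0 else if j - 1 = 0 then 1 else 0) = 0 \<and> (if j = 0 then 1 else 0) = 0 \<and> lam ! j = 1"
    proof cases
      case 3
      then show ?thesis using one[OF 3] by simp
    qed (use k \<open>1 < lam ! 0\<close> in simp_all)
  next
    show "0 < length lam" "(if length lam - 1 = 0 then 1 else 0) = (0::nat)"
      using len by auto
    show "lam ! (length lam - 1) < lam ! 0" by (rule nrect)
    show "lam ! j \<le> lam ! i" if "i \<le> j" "j < length lam" for i j
      using partition_of_nth_mono[OF lam that] .
  qed
  moreover have "prod.swap ` {(i, j). j < length lam \<and> i < lam ! j} = young_diagram lam"
    by (auto simp: young_diagram_def)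
  ultimately show ?thesis
    using separable_swap by metis
qed

lemma separable_young_diagram:
  assumes lam: "partition_of lam n" and n: "n > 0"
    and not_exceptional: "\<not> (lam = [n] \<and> n > 1)" "lam \<noteq> [n - 1, 1]" "lam \<noteq> 2 # replicate (n - 2) 1"
      "lam \<noteq> replicate n 1" "lam \<noteq> [3, 3]" "lam \<noteq> [2, 2, 2]" "lam \<noteq> [2, 2]"
  shows "separable (young_diagram lam)"
proof -
  define a L where "a = lam ! 0" and "L = length lam"
  have sum: "sum_list lam = n"
    using lam by (simp add: partition_of_def)
  have L2: "2 \<le> L"
  proof (rule ccontr)
    assume "\<not> 2 \<le> L"
    then have "lam = [n]"
      using sum n unfolding L_def by (cases lam) (auto simp: Suc_le_eq)
    then show False
      using not_exceptional(1,4) n by (cases "n = 1") auto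
  qed
  have a1: "lam ! 1 \<le> a"
    using L2 unfolding a_def L_def by (intro partition_of_nth_mono[OF lam]) auto
  consider "lam ! 1 = 1" | "2 \<le> lam ! 1" "lam ! (L - 1) < a" | "2 \<le> lam ! 1" "lam ! (L - 1) = a"
    using partition_of_nth_pos[OF lam, of 1] partition_of_nth_mono[OF lam, of 0 "L - 1"] L2
    unfolding L_def a_def by fastforce
  then show ?thesis
  proof cases
    case 1
    have row: "lam ! i = (if i = 0 then a else 1)" if "i < L" for i
      using that 1 partition_of_nth_mono[OF lam, of 1 i] partition_of_nth_pos[OF lam, of i]
      unfolding L_def a_def by (cases i) (auto simp: le_antisym)
    have eq: "lam = a # replicate (L - 1) 1"
      using L2 row by (intro nth_equalityI) (auto simp: L_def nth_Cons split: nat.split)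
    then have n_eq: "n = a + (L - 1)"
    proof -
      have "sum_list (a # replicate (L - 1) 1) = n"
        using sum eq by simp
      then show ?thesis by (simp add: sum_list_replicate)
    qed
    have "a \<noteq> 1"
    proof
      assume "a = 1"
      then have "lam = replicate n 1"
        using eq n_eq by (simp add: replicate_Suc[symmetric] del: replicate_Suc)
      then show False using not_exceptional(4) by simp
    qed
    moreover have "a \<noteq> 2"
    proof
      assume "a = 2"
      then have "lam = 2 # replicate (n - 2) 1"
        using eq n_eq L2 by simp
      then show False using not_exceptional(3) by simp
    qed
    moreover have "L - 1 \<noteq> 1"
    proof
      assume "L - 1 = 1"
      then have "lam = [n - 1, 1]"
        using eq n_eq by simp
      then show False using not_exceptional(2) by simp
    qed
    ultimately have "3 \<le> a" "2 \<le> L - 1"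
      using a1 1 L2 by linarith+
    moreover have "young_diagram lam = {(i, j). i = 0 \<and> j < a \<or> j = 0 \<and> i \<le> L - 1}"
      using \<open>3 \<le> a\<close> L2 by (auto simp: young_diagram_def row L_def[symmetric] split: if_splits)
    ultimately show ?thesis
      using separable_hook by simp
  next
    case 2
    then show ?thesis
      using separable_not_rectangle[OF lam] L2 by (simp add: L_def a_def)
  next
    case 3
    have row: "lam ! i = a" if "i < L" for i
      using that 3 partition_of_nth_mono[OF lam, of 0 i] partition_of_nth_mono[OF lam, of i "L - 1"]
      unfolding L_def a_def by (simp add: le_antisym)
    have eq: "lam = replicate L a"
      using row by (intro nth_equalityI) (auto simp: L_def)
    have D: "young_diagram lam = {(i, j). i < L \<and> j < a}"
      by (auto simp: young_diagram_def row L_def[symmetric])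
    have a2: "2 \<le> a" using 3 a1 by simp
    have ne: "\<not> (L = 2 \<and> a = 2)" "\<not> (L = 2 \<and> a = 3)" "\<not> (L = 3 \<and> a = 2)"
      using eq not_exceptional(5-7) by (metis (no_types) numeral_2_eq_2 numeral_3_eq_3 replicate_0 replicate_Suc)+
    consider "3 \<le> L" "3 \<le> a" | "L = 2" "4 \<le> a" | "a = 2" "4 \<le> L"
      using ne a2 L2 by linarith
    then show ?thesis
    proof cases
      case 1
      then show ?thesis
        using separable_rectangle[OF 1] unfolding D by (simp add: conj_commute)
    next
      case 2
      then show ?thesis
        using separable_two_rows[of "a - 4"] unfolding D by simp
    next
      case 3
      have "prod.swap ` {(i, j). i < 2 \<and> j < L} = {(i, j). i < L \<and> j < a}"
        using 3 by auto
      then show ?thesis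
        using separable_swap[OF separable_two_rows[of "L - 4"]] 3 unfolding D by simp
    qed
  qed
qed

section \<open>The exceptional shapes in every degree\<close>

lemma tableau_exists: "\<exists>t. tableau lam t"
  unfolding tableau_def
  by (intro finite_same_card_bij) (simp_all add: finite_young_diagram card_young_diagram)

lemma minimal_polynomial_linear:
  assumes n: "sum_list lam = n"
    and eig: "\<And>t Y. tableau lam t \<Longrightarrow> polytabloid lam (long_cycle n \<circ> t) Y = r * polytabloid lam t Y"
  shows "is_minimal_polynomial [:- r, 1:] (specht_module lam) (specht_rep (long_cycle n))"
proof -
  obtain t where t: "tableau lam t"
    using tableau_exists by blast
  show ?thesis
  proof (rule minimal_polynomial_spechtI[OF n _ _ _ t, of _ 1])
    fix t' assume "tableau lam t'"
    then show "poly_op [:- r, 1:] (specht_rep (long_cycle n)) (polytabloid lam t') = 0"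
      by (intro ext) (simp add: poly_op_polytabloid[OF n] eig)
  next
    fix j :: nat assume "j < 1"
    then show "\<exists>Y. polytabloid lam (long_cycle n ^^ j \<circ> t) Y \<noteq> 0 \<and>
        (\<forall>i. j < i \<and> i < 1 \<longrightarrow> polytabloid lam (long_cycle n ^^ i \<circ> t) Y = 0)"
      using polytabloid_apply_same_columns[OF t t] by auto
  qed simp_all
qed

lemma minimal_polynomial_one_row:
  "is_minimal_polynomial [:-1, 1:] (specht_module [n]) (specht_rep (long_cycle n))"
proof (rule minimal_polynomial_linear[of "[n]" n 1, simplified])
  fix t Y assume t: "tableau [n] t"
  have D: "young_diagram [n] = {(i, j). i = 0 \<and> j < n}"
    by (auto simp: young_diagram_def)
  have ran: "t ` young_diagram [n] = {1..n}"
    using t by (simp add: tableau_def bij_betw_def)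
  have cs: "column_stabilizer [n] s = {id}" if s: "s ` young_diagram [n] = {1..n}" for s
  proof -
    have "\<pi> = id" if p: "\<pi> \<in> column_stabilizer [n] s" for \<pi>
    proof
      fix x
      show "\<pi> x = id x"
      proof (cases "x \<in> {1..n}")
        case True
        then obtain b where b: "b \<in> young_diagram [n]" "x = s b"
          using s by blast
        then obtain j where j: "j < n" "x = s (0, j)"
          unfolding D by auto
        have "column_of [n] s j = {x}"
          using j by (auto simp: column_of_def D)
        then have "\<pi> ` {x} = {x}"
          using p by (metis (mono_tags, lifting) column_stabilizer_def mem_Collect_eq)
        then show ?thesis by simp
      next
        case False
        then show ?thesis
          using column_stabilizer_permutes[OF p] by (auto simp: permutes_def)
      qed
    qed
    moreover have "id \<in> column_stabilizer [n] s"
      by (simp add: column_stabilizer_def permutes_id)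
    ultimately show ?thesis by blast
  qed
  have tab: "tabloid_of [n] s = (\<lambda>i. if i = 0 then {1..n} else {})" if s: "s ` young_diagram [n] = {1..n}" for s
  proof
    fix i
    show "tabloid_of [n] s i = (if i = 0 then {1..n} else {})"
    proof (cases "i = 0")
      case True
      then have "{b \<in> young_diagram [n]. fst b = i} = young_diagram [n]"
        by (auto simp: D)
      then show ?thesis using True s by (simp add: tabloid_of_def)
    qed (auto simp: tabloid_of_def D)
  qed
  have ran': "(long_cycle n \<circ> t) ` young_diagram [n] = {1..n}"
    unfolding image_comp[symmetric] ran by (rule permutes_image[OF long_cycle_permutes])
  show "polytabloid [n] (long_cycle n \<circ> t) Y = polytabloid [n] t Y"
    unfolding polytabloid_apply cs[OF ran] cs[OF ran'] using tab[OF ran] tab[OF ran'] by simp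
qed

text \<open>The single column is preserved by all permutations, which therefore act by their sign.\<close>

lemma minimal_polynomial_one_column:
  "is_minimal_polynomial [:- ((-1) ^ (n - 1)), 1:] (specht_module (replicate n 1)) (specht_rep (long_cycle n))"
proof (rule minimal_polynomial_linear)
  show n: "sum_list (replicate n 1) = n"
    by (simp add: sum_list_replicate)
  fix t Y assume t: "tableau (replicate n 1) t"
  have D: "young_diagram (replicate n 1) = {(i, j). i < n \<and> j = 0}"
    by (auto simp: young_diagram_def)
  have "t ` young_diagram (replicate n 1) = {1..n}"
    using t by (simp add: tableau_def bij_betw_def sum_list_replicate)
  moreover have "{b \<in> young_diagram (replicate n 1). snd b = j} = (if j = 0 then young_diagram (replicate n 1) else {})" for j
    unfolding D by auto
  ultimately have "column_of (replicate n 1) t j = (if j = 0 then {1..n} else {})" for j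
    by (simp add: column_of_def)
  then have "long_cycle n \<in> column_stabilizer (replicate n 1) t"
    using long_cycle_permutes permutes_image[OF long_cycle_permutes]
    by (simp add: column_stabilizer_def sum_list_replicate)
  from polytabloid_column_perm[OF this]
  show "polytabloid (replicate n 1) (long_cycle n \<circ> t) Y = (-1) ^ (n - 1) * polytabloid (replicate n 1) t Y"
    by (simp add: sign_long_cycle cscale_def)
qed

text \<open>The quotient of \<open>x\<^sup>n - 1\<close> by \<open>x - r\<close>, for an \<open>n\<close>-th root of unity \<open>r\<close>.\<close>

definition cofactor :: "complex \<Rightarrow> nat \<Rightarrow> complex poly" where
  "cofactor r n = (\<Sum>i<n. monom (r ^ (n - Suc i)) i)"

lemma coeff_cofactor: "coeff (cofactor r n) i = (if i < n then r ^ (n - Suc i) else 0)"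
  by (simp add: cofactor_def coeff_sum)

lemma degree_cofactor:
  assumes "n > 0"
  shows "degree (cofactor r n) = n - 1"
  using assms by (intro antisym degree_le le_degree) (auto simp: coeff_cofactor)

lemma monom_minus_1_div_linear:
  assumes "r ^ n = 1"
  shows "(monom 1 n - 1) div [:- r, 1:] = cofactor r n"
proof -
  have *: "[:0, 1:] ^ n - [:r:] ^ n = ([:0, 1:] - [:r:]) * (\<Sum>i<n. [:r:] ^ (n - Suc i) * [:0, 1:] ^ i)"
    by (rule power_diff_sumr2)
  have "(monom 1 n - 1 :: complex poly) = [:- r, 1:] * cofactor r n"
    using * assms by (simp add: cofactor_def monom_altdef poly_const_pow one_pCons)
  then show ?thesis
    by (metis nonzero_mult_div_cancel_left pCons_eq_0_iff one_neq_zero)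
qed

lemma sum_cofactor: "(\<Sum>i\<le>n - 1. coeff (cofactor r n) i * f i) = (\<Sum>i<n. r ^ (n - Suc i) * f i)"
proof (cases n)
  case (Suc m)
  then have "{..n - Suc 0} = {..<n}" by auto
  then show ?thesis by (simp add: coeff_cofactor)
qed (simp add: coeff_cofactor)

lemma long_cycle_orbit:
  assumes "b \<in> {1..n}"
  shows "bij_betw (\<lambda>i. (long_cycle n ^^ i) b) {..<n} {1..n}"
proof -
  have inj: "inj_on (\<lambda>i. (long_cycle n ^^ i) b) {..<n}"
  proof (rule inj_onI)
    fix i j assume ij: "i \<in> {..<n}" "j \<in> {..<n}" "(long_cycle n ^^ i) b = (long_cycle n ^^ j) b"
    have "((long_cycle n ^^ i) b - 1 + (n - (b - 1))) mod n = i" if "i < n" for i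
    proof -
      have "((long_cycle n ^^ i) b - 1 + (n - (b - 1))) mod n = ((b - 1 + i) mod n + (n - (b - 1))) mod n"
        by (simp add: long_cycle_funpow_apply'[OF assms])
      also have "\<dots> = (b - 1 + i + (n - (b - 1))) mod n"
        by (rule mod_add_left_eq)
      also have "b - 1 + i + (n - (b - 1)) = i + n"
        using assms by auto
      finally show ?thesis using that by simp
    qed
    then show "i = j" using ij by (metis lessThan_iff)
  qed
  have sub: "(\<lambda>i. (long_cycle n ^^ i) b) ` {..<n} \<subseteq> {1..n}"
    using assms permutes_in_image[OF long_cycle_funpow_permutes] by blast
  then have "(\<lambda>i. (long_cycle n ^^ i) b) ` {..<n} = {1..n}"
    by (intro card_subset_eq) (simp_all add: card_image[OF inj])
  then show ?thesis using inj by (simp add: bij_betw_def)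
qed

text \<open>A tabloid of this shape is determined by the entry \<open>b\<close> of its second row, so call it \<open>R b\<close>. A
  polytabloid is a difference \<open>R b - R a\<close>. Adding up its \<open>n\<close> rotations gives \<open>0\<close>, as both terms
  run through all tabloids, whereas the rotations \<open>R 2 - R 1, R 3 - R 2, \<dots>, R n - R (n - 1)\<close>
  are linearly independent.\<close>

lemma minimal_polynomial_standard:
  assumes n: "n > 1"
  shows "is_minimal_polynomial (cofactor 1 n) (specht_module [n - 1, 1]) (specht_rep (long_cycle n))"
proof -
  note One_nat_def [simp del]
  let ?lam = "[n - 1, 1]"
  have sum: "sum_list ?lam = n" using n by simp
  have D: "young_diagram ?lam = {(i, j). i = 0 \<and> j < n - 1 \<or> i = 1 \<and> j = 0}"
    by (auto simp: young_diagram_def less_Suc_eq)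
  define R where "R b = (\<lambda>i::nat. if i = 0 then {1..n} - {b} else if i = 1 then {b} else {})" for b :: nat
  have R_inj: "R x = R y \<longleftrightarrow> x = y" for x y
  proof
    assume "R x = R y"
    then have "R x 1 = R y 1" by simp
    then show "x = y" by (simp add: R_def)
  qed simp
  have tab: "tabloid_of ?lam t = R (t (1, 0))" if t: "tableau ?lam t" for t
  proof
    fix i
    have ran: "t ` young_diagram ?lam = {1..n}" and inj: "inj_on t (young_diagram ?lam)"
      using t sum by (simp_all add: tableau_def bij_betw_def)
    show "tabloid_of ?lam t i = R (t (1, 0)) i"
    proof (cases "i = 0")
      case True
      then have "{b \<in> young_diagram ?lam. fst b = i} = young_diagram ?lam - {(1, 0)}"
        unfolding D by auto
      then have "tabloid_of ?lam t i = {1..n} - {t (1, 0)}"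
        unfolding tabloid_of_def ran[symmetric]
        using inj_on_image_set_diff[OF inj, of "young_diagram ?lam" "{(1, 0)}"] by (simp add: D del: One_nat_def)
      then show ?thesis using True by (simp add: R_def)
    qed (auto simp: tabloid_of_def D R_def simp del: One_nat_def)
  qed
  have val: "polytabloid ?lam t Y = (if Y = R (t (1, 0)) then 1 else 0) - (if Y = R (t (0, 0)) then 1 else 0)"
    if t: "tableau ?lam t" for t Y
  proof -
    define s where "s = transpose (t (0, 0)) (t (1, 0))"
    have cells: "(0, 0) \<in> young_diagram ?lam" "(1, 0) \<in> young_diagram ?lam"
      using n by (auto simp: D)
    have ne: "t (0, 0) \<noteq> t (1, 0)"
      using tableau_eqD[OF t _ cells] by auto
    have ran: "t ` young_diagram ?lam = {1..n}"
      using t sum by (simp add: tableau_def bij_betw_def)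
    have col: "column_of ?lam t j = (if j = 0 then {t (0, 0), t (1, 0)} else if j < n - 1 then {t (0, j)} else {})" for j
      using n by (auto simp: column_of_def D)
    have s_perm: "s permutes {1..n}"
      unfolding s_def using cells ran by (intro permutes_swap_id) blast+
    have fix_else: "s (t (0, j)) = t (0, j)" if "0 < j" "j < n - 1" for j
      using tableau_eqD[OF t _ _ cells(1), of "(0, j)"] tableau_eqD[OF t _ _ cells(2), of "(0, j)"] that
      by (auto simp: s_def transpose_def D)
    have "column_stabilizer ?lam t = {id, s}"
    proof (intro equalityI subsetI)
      fix \<pi> assume "\<pi> \<in> column_stabilizer ?lam t"
      then have p: "\<pi> permutes {1..n}" and pc: "\<And>j. \<pi> ` column_of ?lam t j = column_of ?lam t j"
        using sum by (simp_all add: column_stabilizer_def)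
      have fix_p: "\<pi> (t (0, j)) = t (0, j)" if "0 < j" "j < n - 1" for j
        using pc[of j] that by (simp add: col)
      have col0: "{\<pi> (t (0, 0)), \<pi> (t (1, 0))} = {t (0, 0), t (1, 0)}"
        using pc[of 0] by (simp add: col)
      have ext: "\<pi> = \<sigma>" if "\<sigma> permutes {1..n}" "\<And>b. b \<in> young_diagram ?lam \<Longrightarrow> \<pi> (t b) = \<sigma> (t b)" for \<sigma>
      proof
        fix x show "\<pi> x = \<sigma> x"
        proof (cases "x \<in> {1..n}")
          case True
          then show ?thesis using that(2) ran by (metis imageE)
        next
          case False
          then show ?thesis using p that(1) by (simp add: permutes_def)
        qed
      qed
      consider "\<pi> (t (0, 0)) = t (0, 0)" "\<pi> (t (1, 0)) = t (1, 0)"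
        | "\<pi> (t (0, 0)) = t (1, 0)" "\<pi> (t (1, 0)) = t (0, 0)"
        using col0 ne by (auto simp: doubleton_eq_iff)
      then show "\<pi> \<in> {id, s}"
      proof cases
        case 1
        have "\<pi> = id"
        proof (rule ext)
          fix b assume "b \<in> young_diagram ?lam"
          then show "\<pi> (t b) = id (t b)"
            using 1 fix_p by (cases "b = (0, 0)") (auto simp: D)
        qed (rule permutes_id)
        then show ?thesis by simp
      next
        case 2
        have "\<pi> = s"
        proof (rule ext[OF s_perm])
          fix b assume "b \<in> young_diagram ?lam"
          then consider "b = (0, 0)" | "b = (1, 0)" | j where "b = (0, j)" "0 < j" "j < n - 1"
            by (cases b) (auto simp: D)
          then show "\<pi> (t b) = s (t b)"
            by cases (simp_all add: 2 s_def fix_p fix_else[unfolded s_def])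
        qed
        then show ?thesis by simp
      qed
    next
      fix \<pi> assume "\<pi> \<in> {id, s}"
      moreover have "s ` column_of ?lam t j = column_of ?lam t j" for j
        using fix_else by (auto simp: col s_def)
      ultimately show "\<pi> \<in> column_stabilizer ?lam t"
        using s_perm sum by (auto simp: column_stabilizer_def permutes_id)
    qed
    moreover have "id \<noteq> s"
      using ne by (metis id_apply s_def transpose_apply_first)
    moreover have "sign s = -1"
      using ne by (simp add: s_def sign_swap_id)
    moreover have "tableau ?lam (s \<circ> t)"
      using tableau_comp[OF t] s_perm sum by simp
    from tab[OF this] have "tabloid_of ?lam (s \<circ> t) = R (t (0, 0))"
      by (simp add: s_def)
    ultimately show ?thesis
      using tab[OF t] by (simp add: polytabloid_apply)
  qed
  have val_w: "polytabloid ?lam (long_cycle n ^^ i \<circ> t) Y =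
      (if Y = R ((long_cycle n ^^ i) (t (1, 0))) then 1 else 0) - (if Y = R ((long_cycle n ^^ i) (t (0, 0))) then 1 else 0)"
    if t: "tableau ?lam t" for t Y i
    using val[OF tableau_comp[OF t, of "long_cycle n ^^ i"]] long_cycle_funpow_permutes sum by simp
  define t where "t b = (case b of (i, j) \<Rightarrow> if i = 0 then if j = 0 then 1 else j + 2 else 2)" for b :: "nat \<times> nat"
  have t: "tableau ?lam t"
    unfolding tableau_def sum
  proof (rule bij_betwI[where g = "\<lambda>x. if x = 1 then (0, 0) else if x = 2 then (1, 0) else (0, x - 2)"])
    show "t \<in> young_diagram ?lam \<rightarrow> {1..n}"
      using n by (auto simp: D t_def)
    show "(\<lambda>x. if x = 1 then (0, 0) else if x = 2 then (1, 0) else (0, x - 2)) \<in> {1..n} \<rightarrow> young_diagram ?lam"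
    proof (rule funcsetI)
      fix x assume "x \<in> {1..n}"
      then consider "x = 1" | "x = 2" | "2 < x" "x - 2 < n - 1"
        by fastforce
      then show "(if x = 1 then (0, 0) else if x = 2 then (1, 0) else (0, x - 2)) \<in> young_diagram ?lam"
        using n by cases (simp_all add: D)
    qed
  qed (auto simp: D t_def split: if_splits)
  show ?thesis
  proof (rule minimal_polynomial_spechtI[OF sum _ degree_cofactor _ t])
    show "lead_coeff (cofactor 1 n) = 1"
      using n by (simp add: degree_cofactor coeff_cofactor)
  next
    fix t assume t: "tableau ?lam t"
    have ran: "t ` young_diagram ?lam = {1..n}"
      using t sum by (simp add: tableau_def bij_betw_def)
    have "(\<Sum>i<n. if Y = R ((long_cycle n ^^ i) b) then 1 else 0 :: complex) = (\<Sum>x\<in>{1..n}. if Y = R x then 1 else 0)"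
      if "b \<in> {1..n}" for b Y
      by (rule sum.reindex_bij_betw[OF long_cycle_orbit[OF that], of "\<lambda>x. if Y = R x then 1 else 0"])
    moreover have "t (0, 0) \<in> {1..n}" "t (1, 0) \<in> {1..n}"
      using ran n by (auto simp: D)
    ultimately show "poly_op (cofactor 1 n) (specht_rep (long_cycle n)) (polytabloid ?lam t) = 0"
      using n by (intro ext)
        (simp add: poly_op_polytabloid[OF sum] degree_cofactor sum_cofactor
          val_w[OF t] sum_subtractf)
  next
    fix j assume j: "j < n - 1"
    have w: "(long_cycle n ^^ i) 1 = Suc i" "(long_cycle n ^^ i) 2 = Suc (Suc i)" if "i < n - 1" for i
      using that n by (simp_all add: long_cycle_funpow_apply')
    have "t (0, 0) = 1" "t (1, 0) = 2" by (simp_all add: t_def)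
    then show "\<exists>Y. polytabloid ?lam (long_cycle n ^^ j \<circ> t) Y \<noteq> 0 \<and>
        (\<forall>i. j < i \<and> i < n - 1 \<longrightarrow> polytabloid ?lam (long_cycle n ^^ i \<circ> t) Y = 0)"
      using j by (intro exI[of _ "R (Suc j)"]) (auto simp: val_w[OF t] w R_inj simp del: One_nat_def)
  qed (use n in simp)
qed

text \<open>Up to sign, a polytabloid is determined by the entry \<open>b\<close> of its second column, so the exchange
  relation between the two columns is a linear relation between its \<open>n\<close> rotations. The coefficients
  are the signs of the powers of the long cycle. A tabloid with first row \<open>{b, b'}\<close> can occur only in the
  polytabloids that belong to \<open>b\<close> and \<open>b'\<close>, so \<open>n - 1\<close> successive rotations are independent.\<close>

lemma minimal_polynomial_standard_sign:
  assumes n: "n > 1"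
  shows "is_minimal_polynomial (cofactor ((-1) ^ (n - 1)) n) (specht_module (2 # replicate (n - 2) 1)) (specht_rep (long_cycle n))"
proof -
  define lam :: "nat list" where "lam = 2 # replicate (n - 2) 1"
  define \<epsilon> :: complex where "\<epsilon> = (-1) ^ (n - 1)"
  let ?w = "\<lambda>i. long_cycle n ^^ i"
  have sum: "sum_list lam = n"
    using n by (simp add: lam_def sum_list_replicate)
  have D: "young_diagram lam = {(i, j). i < n - 1 \<and> j = 0 \<or> i = 0 \<and> j = 1}"
  proof -
    have "(i, j) \<in> young_diagram lam \<longleftrightarrow> i < n - 1 \<and> j = 0 \<or> i = 0 \<and> j = 1" for i j
      using n by (cases i) (auto simp: young_diagram_def lam_def less_Suc_eq)
    then show ?thesis
      unfolding set_eq_iff split_paired_All by simp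
  qed
  have eps: "\<epsilon> ^ i * \<epsilon> ^ i = 1" for i
    by (simp add: \<epsilon>_def flip: power_mult_distrib power_add)
  have ran: "t ` young_diagram lam = {1..n}" if "tableau lam t" for t
    using that sum by (simp add: tableau_def bij_betw_def)
  have col: "column_of lam t j = (if j = 0 then {1..n} - {t (0, 1)} else if j = 1 then {t (0, 1)} else {})"
    if t: "tableau lam t" for t j
  proof -
    have "{b \<in> young_diagram lam. snd b = 0} = young_diagram lam - {(0, 1)}"
      by (auto simp: D)
    moreover have "inj_on t (young_diagram lam)" "{(0, 1)} \<subseteq> young_diagram lam"
      using t by (simp_all add: tableau_def bij_betw_def D)
    ultimately have "column_of lam t 0 = {1..n} - {t (0, 1)}"
      using inj_on_image_set_diff[of t "young_diagram lam" "young_diagram lam" "{(0, 1)}"]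
      by (simp add: column_of_def ran[OF t])
    moreover have "{b \<in> young_diagram lam. snd b = j} = (if j = 1 then {(0, 1)} else {})" if "j \<noteq> 0"
      using that by (auto simp: D)
    ultimately show ?thesis
      by (simp add: column_of_def)
  qed
  have tw: "tableau lam (?w i \<circ> t)" if "tableau lam t" for t i
    using tableau_comp[OF that] long_cycle_funpow_permutes sum by simp
  have in_n: "t (0, 1) \<in> {1..n}" if t: "tableau lam t" for t
    using ran[OF t] by (auto simp: D)
  have sgn_w: "of_int (sign (?w i)) = \<epsilon> ^ i" for i
  proof (induction i)
    case (Suc i)
    have "permutation (long_cycle n)" "permutation (?w i)"
      using long_cycle_permutes long_cycle_funpow_permutes by (auto simp: permutation_permutes)
    then have "sign (?w (Suc i)) = sign (long_cycle n) * sign (?w i)"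
      by (simp add: sign_compose del: o_apply)
    then have "of_int (sign (?w (Suc i))) = of_int (sign (long_cycle n)) * of_int (sign (?w i))"
      by (simp only: of_int_mult)
    also have "\<dots> = \<epsilon> ^ Suc i"
      unfolding Suc by (simp add: sign_long_cycle \<epsilon>_def)
    finally show ?case .
  qed (simp add: id_def[symmetric])
  have swap: "polytabloid lam (transpose ((?w i) (t (0, 1))) (t (0, 1)) \<circ> t) Y = - (\<epsilon> ^ i * polytabloid lam (?w i \<circ> t) Y)"
    if t: "tableau lam t" and i: "(?w i) (t (0, 1)) \<noteq> t (0, 1)" for t i Y
  proof -
    let ?b = "t (0, 1)" and ?a = "(?w i) (t (0, 1))"
    define \<tau> where "\<tau> = inv (?w i) \<circ> transpose ?a ?b"
    have wp: "?w i permutes {1..n}" by (rule long_cycle_funpow_permutes)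
    have "?a \<in> {1..n}"
      using in_n[OF t] permutes_in_image[OF wp] by blast
    then have tp: "transpose ?a ?b permutes {1..n}"
      using in_n[OF t] by (intro permutes_swap_id)
    have \<tau>p: "\<tau> permutes {1..n}"
      unfolding \<tau>_def by (intro permutes_compose tp permutes_inv wp)
    have "\<tau> ?b = ?b"
      using permutes_inverses[OF wp] by (simp add: \<tau>_def)
    moreover have "\<tau> ` ({1..n} - {?b}) = {1..n} - {\<tau> ?b}"
      using permutes_image[OF \<tau>p] permutes_inj[OF \<tau>p] by (simp add: image_set_diff)
    ultimately have "\<tau> \<in> column_stabilizer lam t"
      using \<tau>p sum by (simp add: column_stabilizer_def col[OF t])
    from polytabloid_column_perm[OF this]
    have 1: "polytabloid lam (\<tau> \<circ> t) = cscale (of_int (sign \<tau>)) (polytabloid lam t)" .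
    have "transpose ?a ?b \<circ> t = ?w i \<circ> (\<tau> \<circ> t)"
      using permutes_inverses[OF wp] by (simp add: \<tau>_def fun_eq_iff)
    then have "polytabloid lam (transpose ?a ?b \<circ> t) = specht_rep (?w i) (polytabloid lam (\<tau> \<circ> t))"
      using specht_rep_polytabloid[of "?w i" lam] wp sum by simp
    also have "\<dots> = cscale (of_int (sign \<tau>)) (polytabloid lam (?w i \<circ> t))"
      using specht_rep_polytabloid[of "?w i" lam] wp sum by (simp add: 1 specht_rep_cscale)
    finally have 2: "polytabloid lam (transpose ?a ?b \<circ> t) Y = of_int (sign \<tau>) * polytabloid lam (?w i \<circ> t) Y"
      by (simp add: cscale_def)
    have "permutation (?w i)" "permutation (transpose ?a ?b)"
      using wp tp by (auto simp: permutation_permutes)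
    then have "sign \<tau> = - sign (?w i)"
      using i unfolding \<tau>_def
      by (subst sign_compose) (simp_all add: permutation_inverse sign_inverse sign_swap_id)
    then show ?thesis
      unfolding 2 by (simp add: sgn_w)
  qed
  have rel: "(\<Sum>i<n. \<epsilon> ^ i * polytabloid lam (?w i \<circ> t) Y) = 0" if t: "tableau lam t" for t Y
  proof -
    let ?b = "t (0, 1)"
    have bij: "bij_betw (\<lambda>i. (?w i) ?b) ({..<n} - {0}) ({1..n} - {?b})"
      using bij_betw_DiffI[OF long_cycle_orbit[OF in_n[OF t]], of "{0}" "{?b}"] in_n[OF t] n by simp
    have "polytabloid lam t Y = (\<Sum>a\<in>column_of lam t 0. polytabloid lam (transpose a ?b \<circ> t) Y)"
      by (rule polytabloid_exchange[OF t, of _ 1]) (use n in \<open>auto simp: col[OF t] D\<close>)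
    also have "\<dots> = (\<Sum>i\<in>{..<n} - {0}. polytabloid lam (transpose ((?w i) ?b) ?b \<circ> t) Y)"
      unfolding col[OF t]
      using sum.reindex_bij_betw[OF bij, of "\<lambda>a. polytabloid lam (transpose a ?b \<circ> t) Y"] by simp
    also have "\<dots> = (\<Sum>i\<in>{..<n} - {0}. - (\<epsilon> ^ i * polytabloid lam (?w i \<circ> t) Y))"
    proof (rule sum.cong[OF refl])
      fix i assume "i \<in> {..<n} - {0}"
      then have "(?w i) ?b \<noteq> ?b"
        using bij by (auto simp: bij_betw_def)
      then show "polytabloid lam (transpose ((?w i) ?b) ?b \<circ> t) Y = - (\<epsilon> ^ i * polytabloid lam (?w i \<circ> t) Y)"
        by (rule swap[OF t])
    qed
    finally show ?thesis
      using n by (simp add: sum.remove[of "{..<n}" 0] sum_negf)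
  qed
  obtain t where t: "tableau lam t"
    using tableau_exists by blast
  have "is_minimal_polynomial (cofactor \<epsilon> n) (specht_module lam) (specht_rep (long_cycle n))"
  proof (rule minimal_polynomial_spechtI[OF sum _ degree_cofactor _ t])
    show "lead_coeff (cofactor \<epsilon> n) = 1"
      using n by (simp add: degree_cofactor coeff_cofactor)
  next
    fix t assume t: "tableau lam t"
    have pw: "\<epsilon> ^ (n - Suc i) = \<epsilon> ^ (n - 1) * \<epsilon> ^ i" if "i < n" for i
    proof -
      have "\<epsilon> ^ (n - 1) = \<epsilon> ^ (n - Suc i) * \<epsilon> ^ i"
        using that by (simp flip: power_add)
      then show ?thesis using eps[of i] by (simp add: mult.assoc)
    qed
    have "(\<Sum>i<n. \<epsilon> ^ (n - Suc i) * polytabloid lam (?w i \<circ> t) Y) =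
        \<epsilon> ^ (n - 1) * (\<Sum>i<n. \<epsilon> ^ i * polytabloid lam (?w i \<circ> t) Y)" for Y
      unfolding sum_distrib_left mult.assoc[symmetric]
    proof (rule sum.cong[OF refl])
      fix i assume "i \<in> {..<n}"
      then show "\<epsilon> ^ (n - Suc i) * polytabloid lam (?w i \<circ> t) Y = \<epsilon> ^ (n - 1) * \<epsilon> ^ i * polytabloid lam (?w i \<circ> t) Y"
        using pw[of i] by simp
    qed
    then show "poly_op (cofactor \<epsilon> n) (specht_rep (long_cycle n)) (polytabloid lam t) = 0"
      using n by (intro ext) (simp add: poly_op_polytabloid[OF sum] degree_cofactor sum_cofactor[unfolded One_nat_def] rel[OF t])
  next
    fix j assume j: "j < n - 1"
    let ?b = "\<lambda>i. (?w i) (t (0, 1))"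
    have b_ne: "?b i \<noteq> ?b k" if "i < k" "k < n" for i k
      using long_cycle_orbit[OF in_n[OF t]] that by (auto simp: bij_betw_def dest: inj_onD)
    have b_in: "?b i \<in> {1..n}" for i
      using in_n[OF t] permutes_in_image[OF long_cycle_funpow_permutes] by blast
    let ?t = "?w j \<circ> t"
    have cell: "(0, 0) \<in> young_diagram lam" "(0, 1) \<in> young_diagram lam"
      using n by (auto simp: D)
    \<comment> \<open>The first row of \<open>Y\<close> consists of the entries that belong to the rotations \<open>j\<close> and \<open>n - 1\<close>.\<close>
    define \<sigma> where "\<sigma> = transpose (?t (0, 0)) (?b (n - 1))"
    define Y where "Y = tabloid_of lam (\<sigma> \<circ> ?t)"
    have ne: "?t (0, 0) \<noteq> ?b j"
      using tableau_eqD[OF tw[OF t] _ cell, of j] by auto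
    have "?t (0, 0) \<in> {1..n}"
      using ran[OF tw[OF t], of j] cell by blast
    then have sp: "\<sigma> permutes {1..n}"
      unfolding \<sigma>_def using b_in by (intro permutes_swap_id)
    have "\<sigma> (?b j) = ?b j"
      using ne b_ne[of j "n - 1"] j by (simp add: \<sigma>_def transpose_def)
    moreover have "\<sigma> ` ({1..n} - {?b j}) = {1..n} - {\<sigma> (?b j)}"
      using permutes_image[OF sp] permutes_inj[OF sp] by (simp add: image_set_diff)
    ultimately have sc: "\<sigma> \<in> column_stabilizer lam ?t"
      using sp sum by (simp add: column_stabilizer_def col[OF tw[OF t]])
    have "polytabloid lam ?t Y \<noteq> 0"
      unfolding Y_def polytabloid_apply_column_perm[OF tw[OF t] sc] by (simp add: sign_def)
    moreover have "polytabloid lam (?w i \<circ> t) Y = 0" if i: "j < i" "i < n - 1" for i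
    proof (rule polytabloid_eq_0[OF tw[OF t], of "?b j" i 0 "?b (n - 1)" Y 0])
      show "?b j \<in> column_of lam (?w i \<circ> t) 0" "?b (n - 1) \<in> column_of lam (?w i \<circ> t) 0"
        using b_in b_ne[of j i] b_ne[of i "n - 1"] i by (auto simp: col[OF tw[OF t]])
      show "?b j \<noteq> ?b (n - 1)"
        using b_ne[of j "n - 1"] j by simp
      show "?b j \<in> Y 0" "?b (n - 1) \<in> Y 0"
        using tabloid_ofI[OF cell(2), of "\<sigma> \<circ> ?t"] tabloid_ofI[OF cell(1), of "\<sigma> \<circ> ?t"] \<open>\<sigma> (?b j) = ?b j\<close>
        by (simp_all add: Y_def \<sigma>_def)
    qed
    ultimately show "\<exists>Y. polytabloid lam (?w j \<circ> t) Y \<noteq> 0 \<and>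
        (\<forall>i. j < i \<and> i < n - 1 \<longrightarrow> polytabloid lam (?w i \<circ> t) Y = 0)"
      by blast
  qed (use n in simp)
  then show ?thesis by (simp add: lam_def \<epsilon>_def)
qed

section \<open>Rectangular shapes, column by column\<close>

text \<open>The tableau with columns of length \<open>l\<close> whose entries, read column by column, form the
  given list.\<close>

definition columns_tableau :: "nat \<Rightarrow> nat list \<Rightarrow> nat \<times> nat \<Rightarrow> nat" where
  "columns_tableau l xs = (\<lambda>(i, j). xs ! (l * j + i))"

definition rect_polytabloid :: "nat \<Rightarrow> nat \<Rightarrow> nat list \<Rightarrow> tabloid \<Rightarrow> complex" where
  "rect_polytabloid l k xs = polytabloid (replicate l k) (columns_tableau l xs)"

definition rect_filling :: "nat \<Rightarrow> nat \<Rightarrow> nat list \<Rightarrow> bool" where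
  "rect_filling l k xs \<longleftrightarrow> length xs = l * k \<and> distinct xs \<and> set xs = {1..l * k}"

lemma young_diagram_rect: "young_diagram (replicate l k) = {(i, j). i < l \<and> j < k}"
  by (auto simp: young_diagram_def)

lemma rect_index_less:
  assumes "i < l" "j < k"
  shows "l * j + i < l * (k::nat)"
proof -
  have "l * j + i < l * Suc j" using assms by simp
  also have "\<dots> \<le> l * k" using assms by (intro mult_le_mono2) simp
  finally show ?thesis .
qed

lemma rect_index_bounds:
  assumes "x < l * (k::nat)"
  shows "x mod l < l" "x div l < k"
  using assms by (cases "l = 0"; simp add: less_mult_imp_div_less mult.commute)+

lemma bij_betw_rect_index: "bij_betw (\<lambda>(i, j). l * j + i) {(i, j). i < l \<and> j < k} {..<l * k :: nat}"
  by (rule bij_betwI[where g = "\<lambda>x. (x mod l, x div l)"])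
     (auto simp: rect_index_less rect_index_bounds)

lemma bij_betw_rect_index_inverse:
  "bij_betw (\<lambda>x. (x mod l, x div l)) {..<l * k :: nat} {(i, j). i < l \<and> j < k}"
  by (rule bij_betwI[where g = "\<lambda>(i, j). l * j + i"])
     (auto simp: rect_index_less rect_index_bounds)

lemma tableau_columns_tableau:
  assumes "rect_filling l k xs"
  shows "tableau (replicate l k) (columns_tableau l xs)"
proof -
  have "columns_tableau l xs = (!) xs \<circ> (\<lambda>(i, j). l * j + i)"
    by (auto simp: columns_tableau_def)
  moreover have "bij_betw ((!) xs) {..<l * k} {1..l * k}"
    using assms bij_betw_nth[of xs] by (simp add: rect_filling_def)
  moreover have sum: "sum_list (replicate l k) = l * k"
    by (simp add: sum_list_replicate)
  ultimately show ?thesis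
    unfolding tableau_def young_diagram_rect sum by (simp only: bij_betw_trans[OF bij_betw_rect_index])
qed

lemma tableau_rect_filling:
  assumes t: "tableau (replicate l k) t"
  obtains xs where "rect_filling l k xs" "polytabloid (replicate l k) t = rect_polytabloid l k xs"
proof
  let ?xs = "map (\<lambda>x. t (x mod l, x div l)) [0..<l * k]"
  have bij: "bij_betw t {(i, j). i < l \<and> j < k} {1..l * k}"
    using t by (simp add: tableau_def young_diagram_rect sum_list_replicate)
  have "bij_betw (\<lambda>x. t (x mod l, x div l)) {..<l * k} {1..l * k}"
    using bij_betw_trans[OF bij_betw_rect_index_inverse bij] by (simp add: comp_def)
  then show "rect_filling l k ?xs"
    by (simp add: rect_filling_def bij_betw_def distinct_map lessThan_atLeast0)
  show "polytabloid (replicate l k) t = rect_polytabloid l k ?xs"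
    unfolding rect_polytabloid_def
    by (rule polytabloid_cong) (auto simp: young_diagram_rect columns_tableau_def rect_index_less)
qed

lemma rect_polytabloid_map:
  assumes "length xs = l * k"
  shows "polytabloid (replicate l k) (\<pi> \<circ> columns_tableau l xs) = rect_polytabloid l k (map \<pi> xs)"
  unfolding rect_polytabloid_def
  by (rule polytabloid_cong) (auto simp: assms young_diagram_rect columns_tableau_def rect_index_less)

lemma column_of_rect:
  "column_of (replicate l k) (columns_tableau l xs) j =
     (if j < k then set (map (\<lambda>i. xs ! (l * j + i)) [0..<l]) else {})"
  by (auto simp: column_of_def young_diagram_rect columns_tableau_def)

lemma tabloid_of_rect:
  "tabloid_of (replicate l k) (columns_tableau l xs) i =
     (if i < l then set (map (\<lambda>j. xs ! (l * j + i)) [0..<k]) else {})"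
  by (auto simp: tabloid_of_def young_diagram_rect columns_tableau_def)

lemma rect_polytabloid_swap_entries:
  assumes xs: "rect_filling l k xs" and j: "j < k" and i: "i < l" "i' < l" "i \<noteq> i'"
  shows "rect_polytabloid l k (map (transpose (xs ! (l * j + i)) (xs ! (l * j + i'))) xs) Y = - rect_polytabloid l k xs Y"
proof -
  let ?t = "columns_tableau l xs" and ?s = "transpose (xs ! (l * j + i)) (xs ! (l * j + i'))"
  have mem: "xs ! (l * j + i) \<in> column_of (replicate l k) ?t j" if "i < l" for i
    using that j by (auto simp: column_of_rect)
  have t: "tableau (replicate l k) ?t" by (rule tableau_columns_tableau[OF xs])
  have lt: "l * j + i < length xs" if "i < l" for i
    using rect_index_less[OF that j] xs by (simp add: rect_filling_def)
  have ne: "xs ! (l * j + i) \<noteq> xs ! (l * j + i')"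
    using xs i lt by (simp add: rect_filling_def nth_eq_iff_index_eq)
  have sp: "?s permutes {1..l * k}"
    using xs lt i nth_mem by (intro permutes_swap_id) (auto simp: rect_filling_def)
  have "?s ` column_of (replicate l k) ?t c = column_of (replicate l k) ?t c" for c
  proof (cases "c = j")
    case True
    then show ?thesis
      using mem i by (intro permutes_image permutes_swap_id) auto
  next
    case False
    then have "?s ` column_of (replicate l k) ?t c = id ` column_of (replicate l k) ?t c"
      using mem[OF i(1)] mem[OF i(2)] column_of_unique[OF t] by (intro image_cong) (auto simp: transpose_def)
    then show ?thesis by simp
  qed
  then have "?s \<in> column_stabilizer (replicate l k) ?t"
    using sp by (simp add: column_stabilizer_def sum_list_replicate)
  from polytabloid_column_perm[OF this] show ?thesis
    using xs ne by (simp add: rect_polytabloid_map rect_filling_def sign_swap_id cscale_def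
        flip: rect_polytabloid_def)
qed

lemma rect_polytabloid_permute_columns:
  assumes s: "\<sigma> permutes {..<k}"
    and ys: "\<And>i j. i < l \<Longrightarrow> j < k \<Longrightarrow> ys ! (l * j + i) = xs ! (l * \<sigma> j + i)"
  shows "rect_polytabloid l k ys = rect_polytabloid l k xs"
proof -
  let ?c = "\<lambda>xs. column_of (replicate l k) (columns_tableau l xs)"
  have lt: "\<sigma> j < k \<longleftrightarrow> j < k" for j
    using permutes_in_image[OF s] by simp
  have col: "?c ys j = ?c xs (\<sigma> j)" for j
    using ys by (auto simp: column_of_rect lt)
  have "(\<forall>j. \<pi> ` ?c ys j = ?c ys j) \<longleftrightarrow> (\<forall>j. \<pi> ` ?c xs j = ?c xs j)" for \<pi>
    unfolding col using permutes_surj[OF s] by (metis surjD)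
  then have "column_stabilizer (replicate l k) (columns_tableau l ys) = column_stabilizer (replicate l k) (columns_tableau l xs)"
    by (simp add: column_stabilizer_def)
  moreover have "tabloid_of (replicate l k) (columns_tableau l ys) = tabloid_of (replicate l k) (columns_tableau l xs)"
  proof
    fix i
    have "(\<lambda>j. ys ! (l * j + i)) ` {..<k} = (\<lambda>j. xs ! (l * j + i)) ` {..<k}" if "i < l"
    proof -
      have "(\<lambda>j. ys ! (l * j + i)) ` {..<k} = (\<lambda>j. xs ! (l * j + i)) ` \<sigma> ` {..<k}"
        unfolding image_image using ys that by (intro image_cong) auto
      then show ?thesis by (simp add: permutes_image[OF s])
    qed
    then show "tabloid_of (replicate l k) (columns_tableau l ys) i = tabloid_of (replicate l k) (columns_tableau l xs) i"
      by (simp add: tabloid_of_rect lessThan_atLeast0)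
  qed
  ultimately show ?thesis
    by (simp add: rect_polytabloid_def polytabloid_def)
qed

lemma rect_polytabloid_exchange:
  assumes xs: "rect_filling l k xs" and j: "j < k" "j' < k" "j \<noteq> j'" and i: "i' < l"
  shows "rect_polytabloid l k xs Y =
    (\<Sum>i<l. rect_polytabloid l k (map (transpose (xs ! (l * j + i)) (xs ! (l * j' + i'))) xs) Y)"
proof -
  let ?t = "columns_tableau l xs"
  have t: "tableau (replicate l k) ?t" by (rule tableau_columns_tableau[OF xs])
  have len: "length xs = l * k" using xs by (simp add: rect_filling_def)
  have inj: "inj_on (\<lambda>i. xs ! (l * j + i)) {..<l}"
    using xs rect_index_less[OF _ j(1)]
    by (auto simp: inj_on_def rect_filling_def nth_eq_iff_index_eq)
  have "rect_polytabloid l k xs Y = (\<Sum>a\<in>column_of (replicate l k) ?t j.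
      polytabloid (replicate l k) (transpose a (xs ! (l * j' + i')) \<circ> ?t) Y)"
    unfolding rect_polytabloid_def
    by (rule polytabloid_exchange[OF t, of _ j']) (use i j in \<open>auto simp: column_of_rect young_diagram_rect\<close>)
  also have "column_of (replicate l k) ?t j = (\<lambda>i. xs ! (l * j + i)) ` {..<l}"
    using j by (simp add: column_of_rect lessThan_atLeast0)
  finally show ?thesis
    by (simp add: sum.reindex[OF inj] comp_def flip: rect_polytabloid_map[OF len])
qed

lemma rect_filling_map:
  assumes "rect_filling l k xs" "\<pi> permutes {1..l * k}"
  shows "rect_filling l k (map \<pi> xs)"
  using assms permutes_image[OF assms(2)] permutes_inj[OF assms(2)]
  by (auto simp: rect_filling_def distinct_map intro: inj_on_subset)

lemma rect_filling_iff:
  "rect_filling l k xs \<longleftrightarrow> length xs = l * k \<and> distinct xs \<and> (\<forall>x\<in>set xs. 0 < x \<and> x \<le> l * k)"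
proof -
  have "set xs = {1..l * k}" if "length xs = l * k" "distinct xs" "\<forall>x\<in>set xs. 0 < x \<and> x \<le> l * k"
    using that distinct_card[of xs] by (intro card_subset_eq) (auto simp: Suc_le_eq)
  then show ?thesis
    by (auto simp: rect_filling_def)
qed

text \<open>\<open>rotate_entries\<close> is the action of the powers of the long cycle in a form suited for computation.\<close>

definition rotate_entries :: "nat \<Rightarrow> nat \<Rightarrow> nat list \<Rightarrow> nat list" where
  "rotate_entries n i xs = map (\<lambda>x. (x + i - 1) mod n + 1) xs"

lemma rect_polytabloid_long_cycle:
  assumes xs: "rect_filling l k xs"
  shows "polytabloid (replicate l k) (long_cycle (l * k) ^^ i \<circ> columns_tableau l xs) =
    rect_polytabloid l k (rotate_entries (l * k) i xs)"
proof -
  have "map (long_cycle (l * k) ^^ i) xs = rotate_entries (l * k) i xs"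
    unfolding rotate_entries_def using xs
    by (intro map_cong refl) (auto simp: rect_filling_def long_cycle_funpow_apply')
  then show ?thesis
    using xs by (simp add: rect_polytabloid_map rect_filling_def)
qed

lemma rect_filling_rotate_entries:
  assumes xs: "rect_filling l k xs"
  shows "rect_filling l k (rotate_entries (l * k) i xs)"
proof -
  have "map (long_cycle (l * k) ^^ i) xs = rotate_entries (l * k) i xs"
    unfolding rotate_entries_def using xs
    by (intro map_cong refl) (auto simp: rect_filling_def long_cycle_funpow_apply')
  then show ?thesis
    using rect_filling_map[OF xs long_cycle_funpow_permutes[of i "l * k"]] by simp
qed

lemma rect_polytabloid_neq_0:
  assumes "rect_filling l k xs" "rect_filling l k ys"
    and "\<forall>j\<in>set [0..<k]. set (map (\<lambda>i. ys ! (l * j + i)) [0..<l]) = set (map (\<lambda>i. xs ! (l * j + i)) [0..<l])"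
  shows "rect_polytabloid l k xs (tabloid_of (replicate l k) (columns_tableau l ys)) \<noteq> 0"
  unfolding rect_polytabloid_def
proof (rule polytabloid_apply_same_columns)
  show "column_of (replicate l k) (columns_tableau l ys) j = column_of (replicate l k) (columns_tableau l xs) j" for j
    using assms(3) by (cases "j < k") (simp_all add: column_of_rect)
qed (use assms tableau_columns_tableau in auto)

lemma rect_polytabloid_eq_0:
  assumes "rect_filling l k xs"
    and "\<exists>j\<in>set [0..<k]. \<exists>r\<in>set [0..<l]. \<exists>i\<in>set [0..<l]. \<exists>i'\<in>set [0..<l]. xs ! (l * j + i) \<noteq> xs ! (l * j + i') \<and>
      xs ! (l * j + i) \<in> set (map (\<lambda>c. ys ! (l * c + r)) [0..<k]) \<and>
      xs ! (l * j + i') \<in> set (map (\<lambda>c. ys ! (l * c + r)) [0..<k])"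
  shows "rect_polytabloid l k xs (tabloid_of (replicate l k) (columns_tableau l ys)) = 0"
proof -
  obtain j r i i' where *: "j < k" "r < l" "i < l" "i' < l" "xs ! (l * j + i) \<noteq> xs ! (l * j + i')"
      "xs ! (l * j + i) \<in> set (map (\<lambda>c. ys ! (l * c + r)) [0..<k])"
      "xs ! (l * j + i') \<in> set (map (\<lambda>c. ys ! (l * c + r)) [0..<k])"
    using assms(2) by (auto simp del: set_map)
  then show ?thesis
    unfolding rect_polytabloid_def
    by (intro polytabloid_eq_0[OF tableau_columns_tableau[OF assms(1)], of "xs ! (l * j + i)" j "xs ! (l * j + i')" _ r])
       (simp_all add: column_of_rect tabloid_of_rect)
qed

lemma minimal_polynomial_rect:
  assumes n: "n = l * k" and lead: "lead_coeff p = 1" and d: "degree p = d"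
    and ann: "\<And>xs Y. rect_filling l k xs \<Longrightarrow>
      (\<Sum>i\<le>d. coeff p i * rect_polytabloid l k (rotate_entries n i xs) Y) = 0"
    and xs: "rect_filling l k xs"
    and tri: "\<And>j. j < d \<Longrightarrow> \<exists>Y. rect_polytabloid l k (rotate_entries n j xs) Y \<noteq> 0 \<and>
        (\<forall>i. j < i \<and> i < d \<longrightarrow> rect_polytabloid l k (rotate_entries n i xs) Y = 0)"
  shows "is_minimal_polynomial p (specht_module (replicate l k)) (specht_rep (long_cycle n))"
proof (rule minimal_polynomial_spechtI[OF _ lead d _ tableau_columns_tableau[OF xs]])
  show sum: "sum_list (replicate l k) = n"
    by (simp add: n sum_list_replicate)
  fix t assume "tableau (replicate l k) t"
  then obtain ys where ys: "rect_filling l k ys" "polytabloid (replicate l k) t = rect_polytabloid l k ys"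
    by (rule tableau_rect_filling)
  show "poly_op p (specht_rep (long_cycle n)) (polytabloid (replicate l k) t) = 0"
    unfolding ys(2) rect_polytabloid_def
    using ann[OF ys(1)] unfolding n rect_polytabloid_long_cycle[OF ys(1), symmetric]
    by (intro ext) (simp only: poly_op_polytabloid[OF sum[unfolded n]] d zero_fun_apply)
next
  fix j assume "j < d"
  from tri[OF this]
  show "\<exists>Y. polytabloid (replicate l k) (long_cycle n ^^ j \<circ> columns_tableau l xs) Y \<noteq> 0 \<and>
      (\<forall>i. j < i \<and> i < d \<longrightarrow> polytabloid (replicate l k) (long_cycle n ^^ i \<circ> columns_tableau l xs) Y = 0)"
    using rect_polytabloid_long_cycle[OF xs] by (simp add: n)
qed

section \<open>The three exceptional rectangles\<close>


lemma rect_filling_distinct: "rect_filling l k xs \<Longrightarrow> distinct xs \<and> distinct (rev xs)"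
  by (simp add: rect_filling_def)

subsection \<open>Relations between their polytabloids\<close>

text \<open>For concrete entries, these relations are a straightening algorithm: swap the entries of a column
  until they increase, sort the columns by their first entries, and resolve a pair of columns that is
  not in normal form by an exchange.\<close>

lemma polytabloid_22_swap:
  assumes xs: "rect_filling 2 2 [a, b, c, d]"
  shows "rect_polytabloid 2 2 [b, a, c, d] Y = - rect_polytabloid 2 2 [a, b, c, d] Y"
    "rect_polytabloid 2 2 [a, b, d, c] Y = - rect_polytabloid 2 2 [a, b, c, d] Y"
  using rect_filling_distinct[OF xs] rect_polytabloid_swap_entries[OF xs, of 0 0 1] rect_polytabloid_swap_entries[OF xs, of 1 0 1]
  by (simp_all add: eval_nat_numeral transpose_def)

lemma polytabloid_22_columns:
  "rect_polytabloid 2 2 [c, d, a, b] = rect_polytabloid 2 2 [a, b, c, d]"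
  by (rule rect_polytabloid_permute_columns[of "transpose 0 1"])
     (auto simp: permutes_swap_id less_2_cases_iff)

lemma polytabloid_33_swap:
  assumes xs: "rect_filling 2 3 [a, b, c, d, e, f]"
  shows "rect_polytabloid 2 3 [b, a, c, d, e, f] Y = - rect_polytabloid 2 3 [a, b, c, d, e, f] Y"
    "rect_polytabloid 2 3 [a, b, d, c, e, f] Y = - rect_polytabloid 2 3 [a, b, c, d, e, f] Y"
    "rect_polytabloid 2 3 [a, b, c, d, f, e] Y = - rect_polytabloid 2 3 [a, b, c, d, e, f] Y"
  using rect_filling_distinct[OF xs] rect_polytabloid_swap_entries[OF xs, of 0 0 1] rect_polytabloid_swap_entries[OF xs, of 1 0 1]
    rect_polytabloid_swap_entries[OF xs, of 2 0 1]
  by (simp_all add: eval_nat_numeral transpose_def)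

lemma less_3_cases: "(j::nat) < 3 \<longleftrightarrow> j = 0 \<or> j = 1 \<or> j = 2"
  by auto

lemma polytabloid_33_columns:
  "rect_polytabloid 2 3 [c, d, a, b, e, f] = rect_polytabloid 2 3 [a, b, c, d, e, f]"
  "rect_polytabloid 2 3 [a, b, e, f, c, d] = rect_polytabloid 2 3 [a, b, c, d, e, f]"
  by (rule rect_polytabloid_permute_columns[of "transpose 0 1"] rect_polytabloid_permute_columns[of "transpose 1 2"];
      auto simp: permutes_swap_id less_2_cases_iff less_3_cases transpose_def)+

lemma polytabloid_33_exchange:
  assumes xs: "rect_filling 2 3 [a, b, c, d, e, f]"
  shows "rect_polytabloid 2 3 [a, b, c, d, e, f] Y =
      rect_polytabloid 2 3 [c, b, a, d, e, f] Y + rect_polytabloid 2 3 [a, c, b, d, e, f] Y"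
    "rect_polytabloid 2 3 [a, b, c, d, e, f] Y =
      rect_polytabloid 2 3 [e, b, c, d, a, f] Y + rect_polytabloid 2 3 [a, e, c, d, b, f] Y"
    "rect_polytabloid 2 3 [a, b, c, d, e, f] Y =
      rect_polytabloid 2 3 [a, b, e, d, c, f] Y + rect_polytabloid 2 3 [a, b, c, e, d, f] Y"
  using rect_filling_distinct[OF xs] rect_polytabloid_exchange[OF xs, of 0 1 0 Y] rect_polytabloid_exchange[OF xs, of 0 2 0 Y]
    rect_polytabloid_exchange[OF xs, of 1 2 0 Y]
  by (simp_all add: eval_nat_numeral transpose_def)

lemma polytabloid_222_swap:
  assumes xs: "rect_filling 3 2 [a, b, c, d, e, f]"
  shows "rect_polytabloid 3 2 [b, a, c, d, e, f] Y = - rect_polytabloid 3 2 [a, b, c, d, e, f] Y"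
    "rect_polytabloid 3 2 [a, c, b, d, e, f] Y = - rect_polytabloid 3 2 [a, b, c, d, e, f] Y"
    "rect_polytabloid 3 2 [a, b, c, e, d, f] Y = - rect_polytabloid 3 2 [a, b, c, d, e, f] Y"
    "rect_polytabloid 3 2 [a, b, c, d, f, e] Y = - rect_polytabloid 3 2 [a, b, c, d, e, f] Y"
  using rect_filling_distinct[OF xs] rect_polytabloid_swap_entries[OF xs, of 0 0 1] rect_polytabloid_swap_entries[OF xs, of 0 1 2]
    rect_polytabloid_swap_entries[OF xs, of 1 0 1] rect_polytabloid_swap_entries[OF xs, of 1 1 2]
  by (simp_all add: eval_nat_numeral transpose_def)

lemma polytabloid_222_columns:
  "rect_polytabloid 3 2 [d, e, f, a, b, c] = rect_polytabloid 3 2 [a, b, c, d, e, f]"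
  by (rule rect_polytabloid_permute_columns[of "transpose 0 1"])
     (auto simp: permutes_swap_id less_2_cases_iff less_3_cases)

lemma polytabloid_222_exchange:
  assumes xs: "rect_filling 3 2 [a, b, c, d, e, f]"
  shows "rect_polytabloid 3 2 [a, b, c, d, e, f] Y = rect_polytabloid 3 2 [d, b, c, a, e, f] Y +
      rect_polytabloid 3 2 [a, d, c, b, e, f] Y + rect_polytabloid 3 2 [a, b, d, c, e, f] Y"
    "rect_polytabloid 3 2 [a, b, c, d, e, f] Y = rect_polytabloid 3 2 [e, b, c, d, a, f] Y +
      rect_polytabloid 3 2 [a, e, c, d, b, f] Y + rect_polytabloid 3 2 [a, b, e, d, c, f] Y"
    "rect_polytabloid 3 2 [a, b, c, d, e, f] Y = rect_polytabloid 3 2 [f, b, c, d, e, a] Y +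
      rect_polytabloid 3 2 [a, f, c, d, e, b] Y + rect_polytabloid 3 2 [a, b, f, d, e, c] Y"
  using rect_filling_distinct[OF xs] rect_polytabloid_exchange[OF xs, of 0 1 0 Y] rect_polytabloid_exchange[OF xs, of 0 1 1 Y]
    rect_polytabloid_exchange[OF xs, of 0 1 2 Y]
  by (simp_all add: eval_nat_numeral transpose_def)

text \<open>Whether a polynomial in the long cycle kills the polytabloid of a given filling. This is unchanged
  if the polytabloids of the filling and of all its rotations change by the same scalar, so it has to be checked only for
  fillings that are sorted within the columns and by the first entries of the columns.\<close>

definition rect_annihilated :: "nat \<Rightarrow> nat \<Rightarrow> complex poly \<Rightarrow> nat list \<Rightarrow> bool" where
  "rect_annihilated l k p xs \<longleftrightarrow>
     (\<forall>Y. (\<Sum>i\<le>degree p. coeff p i * rect_polytabloid l k (rotate_entries (l * k) i xs) Y) = 0)"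

lemma rect_annihilated_cong:
  assumes "rect_annihilated l k p xs"
    and "\<And>i Y. rect_polytabloid l k (rotate_entries (l * k) i ys) Y = s * rect_polytabloid l k (rotate_entries (l * k) i xs) Y"
  shows "rect_annihilated l k p ys"
  unfolding rect_annihilated_def
proof
  fix Y
  have "(\<Sum>i\<le>degree p. coeff p i * rect_polytabloid l k (rotate_entries (l * k) i ys) Y) =
      s * (\<Sum>i\<le>degree p. coeff p i * rect_polytabloid l k (rotate_entries (l * k) i xs) Y)"
    by (simp add: assms(2) sum_distrib_left mult.left_commute)
  then show "(\<Sum>i\<le>degree p. coeff p i * rect_polytabloid l k (rotate_entries (l * k) i ys) Y) = 0"
    using assms(1) by (simp add: rect_annihilated_def)
qed

lemma rotate_entries_Nil: "rotate_entries n i [] = []"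
  and rotate_entries_Cons: "rotate_entries n i (x # xs) = ((x + i - 1) mod n + 1) # rotate_entries n i xs"
  by (simp_all add: rotate_entries_def)

subsection \<open>Two rows of length three\<close>

lemma wlog_three_pairs:
  fixes P :: "nat \<Rightarrow> nat \<Rightarrow> nat \<Rightarrow> nat \<Rightarrow> nat \<Rightarrow> nat \<Rightarrow> bool"
  assumes p: "\<And>a b c d e f. P a b c d e f \<Longrightarrow> P b a c d e f" "\<And>a b c d e f. P a b c d e f \<Longrightarrow> P a b d c e f"
      "\<And>a b c d e f. P a b c d e f \<Longrightarrow> P a b c d f e"
    and q: "\<And>a b c d e f. P a b c d e f \<Longrightarrow> P c d a b e f" "\<And>a b c d e f. P a b c d e f \<Longrightarrow> P a b e f c d"
    and base: "\<And>a b c d e f. a \<le> b \<Longrightarrow> c \<le> d \<Longrightarrow> e \<le> f \<Longrightarrow> a \<le> c \<Longrightarrow> c \<le> e \<Longrightarrow> P a b c d e f"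
  shows "P a b c d e f"
proof -
  have sorted: "P a b c d e f" if "a \<le> b" "c \<le> d" "e \<le> f" for a b c d e f
  proof (cases "a \<le> c")
    case True
    then show ?thesis using that base q(1)[OF q(2)] q(2) by (metis nat_le_linear)
  next
    case False
    then have *: "P c d a b e f"
      using that base q(1)[OF q(2)] q(2) by (metis nat_le_linear)
    then show ?thesis by (rule q(1))
  qed
  show ?thesis using sorted p by (metis nat_le_linear)
qed

lemma rect_annihilated_33_iff:
  "rect_annihilated 2 3 [:-1, 1, 0, -1, 1:] xs \<longleftrightarrow>
     (\<forall>Y. rect_polytabloid 2 3 (rotate_entries 6 4 xs) Y + rect_polytabloid 2 3 (rotate_entries 6 1 xs) Y =
       rect_polytabloid 2 3 (rotate_entries 6 3 xs) Y + rect_polytabloid 2 3 (rotate_entries 6 0 xs) Y)"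
  by (simp add: rect_annihilated_def algebra_simps eval_nat_numeral)

text \<open>The columns of a sorted filling are a perfect matching of six points on a circle. The exchange
  relation replaces two crossing pairs by pairs that do not cross, and the five matchings without
  crossings are independent; so the identities are verified by rewriting all terms into these.\<close>

lemma rect_annihilated_33_rotations:
  "rect_annihilated 2 3 [:-1, 1, 0, -1, 1:] [1,2,3,4,5,6]"
  "rect_annihilated 2 3 [:-1, 1, 0, -1, 1:] [1,2,3,5,4,6]"
  "rect_annihilated 2 3 [:-1, 1, 0, -1, 1:] [1,2,3,6,4,5]"
  "rect_annihilated 2 3 [:-1, 1, 0, -1, 1:] [1,3,2,4,5,6]"
  "rect_annihilated 2 3 [:-1, 1, 0, -1, 1:] [1,3,2,5,4,6]"
  "rect_annihilated 2 3 [:-1, 1, 0, -1, 1:] [1,3,2,6,4,5]"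
  "rect_annihilated 2 3 [:-1, 1, 0, -1, 1:] [1,4,2,3,5,6]"
  "rect_annihilated 2 3 [:-1, 1, 0, -1, 1:] [1,4,2,5,3,6]"
  "rect_annihilated 2 3 [:-1, 1, 0, -1, 1:] [1,4,2,6,3,5]"
  "rect_annihilated 2 3 [:-1, 1, 0, -1, 1:] [1,5,2,3,4,6]"
  "rect_annihilated 2 3 [:-1, 1, 0, -1, 1:] [1,5,2,4,3,6]"
  "rect_annihilated 2 3 [:-1, 1, 0, -1, 1:] [1,5,2,6,3,4]"
  "rect_annihilated 2 3 [:-1, 1, 0, -1, 1:] [1,6,2,3,4,5]"
  "rect_annihilated 2 3 [:-1, 1, 0, -1, 1:] [1,6,2,4,3,5]"
  "rect_annihilated 2 3 [:-1, 1, 0, -1, 1:] [1,6,2,5,3,4]"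
proof -
  let ?F = "rect_polytabloid 2 3"
  have sw: "?F [a, b, c, d, e, f] Y = - ?F [b, a, c, d, e, f] Y" if "rect_filling 2 3 [a, b, c, d, e, f]" "b < a"
      for a b c d e f Y
    using polytabloid_33_swap(1)[OF that(1)] by simp
  have sw2: "?F [a, b, c, d, e, f] Y = - ?F [a, b, d, c, e, f] Y" if "rect_filling 2 3 [a, b, c, d, e, f]" "d < c"
      for a b c d e f Y
    using polytabloid_33_swap(2)[OF that(1)] by simp
  have sw3: "?F [a, b, c, d, e, f] Y = - ?F [a, b, c, d, f, e] Y" if "rect_filling 2 3 [a, b, c, d, e, f]" "f < e"
      for a b c d e f Y
    using polytabloid_33_swap(3)[OF that(1)] by simp
  have co: "?F [a, b, c, d, e, f] = ?F [c, d, a, b, e, f]" if "c < a" for a b c d e f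
    by (simp add: polytabloid_33_columns)
  have co2: "?F [a, b, c, d, e, f] = ?F [a, b, e, f, c, d]" if "e < c" for a b c d e f
    by (simp add: polytabloid_33_columns)
  have ex: "?F [a, b, c, d, e, f] Y = ?F [c, b, a, d, e, f] Y + ?F [a, c, b, d, e, f] Y"
    if "rect_filling 2 3 [a, b, c, d, e, f]" "a < c" "c < b" "b < d" for a b c d e f Y
    by (rule polytabloid_33_exchange(1)[OF that(1)])
  have ex2: "?F [a, b, c, d, e, f] Y = ?F [e, b, c, d, a, f] Y + ?F [a, e, c, d, b, f] Y"
    if "rect_filling 2 3 [a, b, c, d, e, f]" "a < e" "e < b" "b < f" for a b c d e f Y
    by (rule polytabloid_33_exchange(2)[OF that(1)])
  have ex3: "?F [a, b, c, d, e, f] Y = ?F [a, b, e, d, c, f] Y + ?F [a, b, c, e, d, f] Y"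
    if "rect_filling 2 3 [a, b, c, d, e, f]" "c < e" "e < d" "d < f" for a b c d e f Y
    by (rule polytabloid_33_exchange(3)[OF that(1)])
  note rules = sw sw2 sw3 co co2 ex ex2 ex3
  show "rect_annihilated 2 3 [:-1, 1, 0, -1, 1:] [1,2,3,4,5,6]"
  "rect_annihilated 2 3 [:-1, 1, 0, -1, 1:] [1,2,3,5,4,6]"
  "rect_annihilated 2 3 [:-1, 1, 0, -1, 1:] [1,2,3,6,4,5]"
  "rect_annihilated 2 3 [:-1, 1, 0, -1, 1:] [1,3,2,4,5,6]"
  "rect_annihilated 2 3 [:-1, 1, 0, -1, 1:] [1,3,2,5,4,6]"
  "rect_annihilated 2 3 [:-1, 1, 0, -1, 1:] [1,3,2,6,4,5]"
  "rect_annihilated 2 3 [:-1, 1, 0, -1, 1:] [1,4,2,3,5,6]"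
  "rect_annihilated 2 3 [:-1, 1, 0, -1, 1:] [1,4,2,5,3,6]"
  "rect_annihilated 2 3 [:-1, 1, 0, -1, 1:] [1,4,2,6,3,5]"
  "rect_annihilated 2 3 [:-1, 1, 0, -1, 1:] [1,5,2,3,4,6]"
  "rect_annihilated 2 3 [:-1, 1, 0, -1, 1:] [1,5,2,4,3,6]"
  "rect_annihilated 2 3 [:-1, 1, 0, -1, 1:] [1,5,2,6,3,4]"
  "rect_annihilated 2 3 [:-1, 1, 0, -1, 1:] [1,6,2,3,4,5]"
  "rect_annihilated 2 3 [:-1, 1, 0, -1, 1:] [1,6,2,4,3,5]"
  "rect_annihilated 2 3 [:-1, 1, 0, -1, 1:] [1,6,2,5,3,4]"
    unfolding rect_annihilated_33_iff
    by (simp_all add: rotate_entries_Nil rotate_entries_Cons rules rect_filling_iff)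
qed

lemma rect_annihilated_33:
  assumes "rect_filling 2 3 xs"
  shows "rect_annihilated 2 3 [:-1, 1, 0, -1, 1:] xs"
proof -
  let ?A = "rect_annihilated 2 3 [:-1, 1, 0, -1, 1:]"
  have fill: "rect_filling 2 3 (rotate_entries 6 i ys)" if "rect_filling 2 3 ys" for i ys
    using rect_filling_rotate_entries[OF that] by simp
  have P: "rect_filling 2 3 [a, b, c, d, e, f] \<longrightarrow> ?A [a, b, c, d, e, f]" for a b c d e f
  proof (induction a b c d e f rule: wlog_three_pairs)
    case (1 a b c d e f)
    show ?case
    proof
      assume "rect_filling 2 3 [b, a, c, d, e, f]"
      then have xs: "rect_filling 2 3 [a, b, c, d, e, f]" by (auto simp: rect_filling_iff)
      show "?A [b, a, c, d, e, f]"
        by (rule rect_annihilated_cong[of _ _ _ "[a, b, c, d, e, f]" _ "-1"])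
           (use 1 xs fill[OF xs] in \<open>simp_all add: rotate_entries_Cons rotate_entries_Nil polytabloid_33_swap(1)\<close>)
    qed
  next
    case (2 a b c d e f)
    show ?case
    proof
      assume "rect_filling 2 3 [a, b, d, c, e, f]"
      then have xs: "rect_filling 2 3 [a, b, c, d, e, f]" by (auto simp: rect_filling_iff)
      show "?A [a, b, d, c, e, f]"
        by (rule rect_annihilated_cong[of _ _ _ "[a, b, c, d, e, f]" _ "-1"])
           (use 2 xs fill[OF xs] in \<open>simp_all add: rotate_entries_Cons rotate_entries_Nil polytabloid_33_swap(2)\<close>)
    qed
  next
    case (3 a b c d e f)
    show ?case
    proof
      assume "rect_filling 2 3 [a, b, c, d, f, e]"
      then have xs: "rect_filling 2 3 [a, b, c, d, e, f]" by (auto simp: rect_filling_iff)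
      show "?A [a, b, c, d, f, e]"
        by (rule rect_annihilated_cong[of _ _ _ "[a, b, c, d, e, f]" _ "-1"])
           (use 3 xs fill[OF xs] in \<open>simp_all add: rotate_entries_Cons rotate_entries_Nil polytabloid_33_swap(3)\<close>)
    qed
  next
    case (4 a b c d e f)
    show ?case
    proof
      assume "rect_filling 2 3 [c, d, a, b, e, f]"
      then have xs: "rect_filling 2 3 [a, b, c, d, e, f]" by (auto simp: rect_filling_iff)
      show "?A [c, d, a, b, e, f]"
        by (rule rect_annihilated_cong[of _ _ _ "[a, b, c, d, e, f]" _ 1])
           (use 4 xs in \<open>simp_all add: rotate_entries_Cons rotate_entries_Nil polytabloid_33_columns(1)\<close>)
    qed
  next
    case (5 a b c d e f)
    show ?case
    proof
      assume "rect_filling 2 3 [a, b, e, f, c, d]"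
      then have xs: "rect_filling 2 3 [a, b, c, d, e, f]" by (auto simp: rect_filling_iff)
      show "?A [a, b, e, f, c, d]"
        by (rule rect_annihilated_cong[of _ _ _ "[a, b, c, d, e, f]" _ 1])
           (use 5 xs in \<open>simp_all add: rotate_entries_Cons rotate_entries_Nil polytabloid_33_columns(2)\<close>)
    qed
  next
    case (6 a b c d e f)
    have S: "{1..6} = {1, 2, 3, 4, 5, 6 :: nat}" by auto
    have all: "\<forall>a\<in>{1..6}. \<forall>b\<in>{1..6}. a < b \<longrightarrow> (\<forall>c\<in>{1..6}. a < c \<and> c \<noteq> b \<longrightarrow> (\<forall>d\<in>{1..6}. c < d \<and> d \<noteq> b \<longrightarrow>
        (\<forall>e\<in>{1..6}. c < e \<and> e \<noteq> b \<and> e \<noteq> d \<longrightarrow> (\<forall>f\<in>{1..6}. e < f \<and> f \<noteq> b \<and> f \<noteq> d \<longrightarrow>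
          ?A [a, b, c, d, e, f]))))"
      unfolding S using rect_annihilated_33_rotations by simp
    show ?case
    proof
      assume "rect_filling 2 3 [a, b, c, d, e, f]"
      then have *: "distinct [a, b, c, d, e, f]" "set [a, b, c, d, e, f] \<subseteq> {1..6}"
        by (simp_all add: rect_filling_def)
      then have "a < b" "c < d" "e < f" "a < c" "c < e"
        using 6 by (simp_all add: order_less_le)
      then show "?A [a, b, c, d, e, f]"
        by (intro all[rule_format]) (use * in auto)
    qed
  qed
  have "length xs = 6"
    using assms by (simp add: rect_filling_def)
  then obtain a b c d e f where "xs = [a, b, c, d, e, f]"
    by (auto simp: eval_nat_numeral length_Suc_conv)
  then show ?thesis using P assms by simp
qed

lemma less_4_cases: "(i::nat) < 4 \<longleftrightarrow> i = 0 \<or> i = 1 \<or> i = 2 \<or> i = 3"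
  by auto

lemma upt_small: "[0..<2] = [0, 1::nat]" "[0..<3] = [0, 1, 2::nat]"
  by (simp_all add: eval_nat_numeral)

lemma Suc_small: "Suc (Suc 0) = 2" "Suc 2 = 3" "Suc 3 = 4" "Suc 4 = 5" "Suc 5 = 6"
  by simp_all

text \<open>In the lower bound, the tabloids are listed by their fillings; for the chosen tableau, tabloid \<open>j\<close>
  occurs in the \<open>j\<close>-th rotation of the polytabloid, but in no later one up to the third.\<close>

lemma minimal_polynomial_33:
  "is_minimal_polynomial [:-1, 1, 0, -1, 1:] (specht_module [3, 3]) (specht_rep (long_cycle 6))"
proof -
  let ?xs = "[1, 2, 3, 5, 4, 6] :: nat list"
  let ?T = "\<lambda>ys. tabloid_of (replicate 2 3) (columns_tableau 2 ys)"
  let ?F = "\<lambda>i. rect_polytabloid 2 3 (rotate_entries 6 i ?xs)"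
  have rot: "rotate_entries 6 0 ?xs = [1,2,3,5,4,6]" "rotate_entries 6 1 ?xs = [2,3,4,6,5,1]"
      "rotate_entries 6 2 ?xs = [3,4,5,1,6,2]" "rotate_entries 6 3 ?xs = [4,5,6,2,1,3]"
    by (simp_all add: rotate_entries_def)
  have nz: "?F 0 (?T [2,1,3,5,6,4]) \<noteq> 0" "?F 1 (?T [2,3,6,4,1,5]) \<noteq> 0"
      "?F 2 (?T [3,4,1,5,2,6]) \<noteq> 0" "?F 3 (?T [5,4,2,6,1,3]) \<noteq> 0"
    unfolding rot by (rule rect_polytabloid_neq_0; auto simp: rect_filling_iff upt_small)+
  have z: "?F 1 (?T [2,1,3,5,6,4]) = 0" "?F 2 (?T [2,1,3,5,6,4]) = 0" "?F 3 (?T [2,1,3,5,6,4]) = 0"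
      "?F 2 (?T [2,3,6,4,1,5]) = 0" "?F 3 (?T [2,3,6,4,1,5]) = 0" "?F 3 (?T [3,4,1,5,2,6]) = 0"
    unfolding rot by (rule rect_polytabloid_eq_0; simp add: rect_filling_iff upt_small)+
  have "is_minimal_polynomial [:-1, 1, 0, -1, 1:] (specht_module (replicate 2 3)) (specht_rep (long_cycle 6))"
  proof (rule minimal_polynomial_rect[of 6 2 3 _ 4 ?xs])
    fix zs Y assume "rect_filling 2 3 zs"
    from rect_annihilated_33[OF this]
    show "(\<Sum>i\<le>4. coeff [:-1, 1, 0, -1, 1:] i * rect_polytabloid 2 3 (rotate_entries 6 i zs) Y) = 0"
      by (simp add: rect_annihilated_def eval_nat_numeral)
  next
    show "rect_filling 2 3 ?xs" by (simp add: rect_filling_iff)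
    fix j :: nat assume "j < 4"
    then consider "j = 0" | "j = 1" | "j = 2" | "j = 3" by (auto simp: less_4_cases)
    then show "\<exists>Y. ?F j Y \<noteq> 0 \<and> (\<forall>i. j < i \<and> i < 4 \<longrightarrow> ?F i Y = 0)"
    proof cases
      case 1
      then show ?thesis
        using nz(1) z(1-3) unfolding less_4_cases by blast
    next
      case 2
      then show ?thesis
        using nz(2) z(4,5) unfolding less_4_cases by (intro exI[of _ "?T [2,3,6,4,1,5]"]) auto
    next
      case 3
      then show ?thesis
        using nz(3) z(6) unfolding less_4_cases by (intro exI[of _ "?T [3,4,1,5,2,6]"]) auto
    next
      case 4
      then show ?thesis
        using nz(4) unfolding less_4_cases by (intro exI[of _ "?T [5,4,2,6,1,3]"]) auto
    qed
  qed simp_all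
  moreover have "replicate 2 3 = [3, 3::nat]" by (simp add: eval_nat_numeral)
  ultimately show ?thesis by simp
qed


subsection \<open>Two columns of length three\<close>

lemma wlog_two_triples:
  fixes P :: "nat \<Rightarrow> nat \<Rightarrow> nat \<Rightarrow> nat \<Rightarrow> nat \<Rightarrow> nat \<Rightarrow> bool"
  assumes p: "\<And>a b c d e f. P a b c d e f \<Longrightarrow> P b a c d e f" "\<And>a b c d e f. P a b c d e f \<Longrightarrow> P a c b d e f"
      "\<And>a b c d e f. P a b c d e f \<Longrightarrow> P a b c e d f" "\<And>a b c d e f. P a b c d e f \<Longrightarrow> P a b c d f e"
    and q: "\<And>a b c d e f. P a b c d e f \<Longrightarrow> P d e f a b c"
    and base: "\<And>a b c d e f. a \<le> b \<Longrightarrow> b \<le> c \<Longrightarrow> d \<le> e \<Longrightarrow> e \<le> f \<Longrightarrow> a \<le> d \<Longrightarrow> P a b c d e f"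
  shows "P a b c d e f"
proof -
  have sort: "Q a b c" if sorted: "\<And>a b c. a \<le> b \<Longrightarrow> b \<le> c \<Longrightarrow> Q a b c" and swap: "\<And>a b c. Q a b c \<Longrightarrow> Q b a c" "\<And>a b c. Q a b c \<Longrightarrow> Q a c b"
    for Q :: "nat \<Rightarrow> nat \<Rightarrow> nat \<Rightarrow> bool" and a b c
  proof -
    have le: "Q a b c" if "a \<le> b" for a b c
    proof -
      consider "b \<le> c" | "a \<le> c" "c \<le> b" | "c \<le> a" by linarith
      then show ?thesis
      proof cases
        case 1
        then show ?thesis by (rule sorted[OF that])
      next
        case 2
        then show ?thesis by (rule swap(2)[OF sorted])
      next
        case 3
        then show ?thesis by (rule swap(2)[OF swap(1)[OF sorted[OF _ that]]])
      qed
    qed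
    show ?thesis
      using le[of a b] swap(1)[OF le[of b a]] by (cases "a \<le> b") simp_all
  qed
  have 1: "P a b c d e f" if "a \<le> b" "b \<le> c" "d \<le> e" "e \<le> f" for a b c d e f
    using that base q by (metis nat_le_linear)
  have 2: "P a b c d e f" if "a \<le> b" "b \<le> c" for a b c d e f
  proof (rule sort[of "P a b c"])
    show "P a b c d e f" if "d \<le> e" "e \<le> f" for d e f
      by (rule 1[OF \<open>a \<le> b\<close> \<open>b \<le> c\<close> that])
  qed (fact p)+
  show ?thesis
    by (rule sort[of "\<lambda>a b c. P a b c d e f"]) (fact 2 p)+
qed

lemma rect_annihilated_222_iff:
  "rect_annihilated 3 2 [:-1, -1, 0, 1, 1:] xs \<longleftrightarrow>
     (\<forall>Y. rect_polytabloid 3 2 (rotate_entries 6 4 xs) Y + rect_polytabloid 3 2 (rotate_entries 6 3 xs) Y =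
       rect_polytabloid 3 2 (rotate_entries 6 1 xs) Y + rect_polytabloid 3 2 (rotate_entries 6 0 xs) Y)"
  by (simp add: rect_annihilated_def algebra_simps eval_nat_numeral)

text \<open>Five of the ten sorted fillings are standard. The facts \<open>s1\<close> to \<open>s5\<close> reduce the polytabloids
  of the other five to the standard ones; each is one instance of the exchange relation, followed by
  sorting.\<close>

lemma rect_annihilated_222_rotations:
  "rect_annihilated 3 2 [:-1, -1, 0, 1, 1:] [1,2,3,4,5,6]"
  "rect_annihilated 3 2 [:-1, -1, 0, 1, 1:] [1,2,4,3,5,6]"
  "rect_annihilated 3 2 [:-1, -1, 0, 1, 1:] [1,2,5,3,4,6]"
  "rect_annihilated 3 2 [:-1, -1, 0, 1, 1:] [1,2,6,3,4,5]"
  "rect_annihilated 3 2 [:-1, -1, 0, 1, 1:] [1,3,4,2,5,6]"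
  "rect_annihilated 3 2 [:-1, -1, 0, 1, 1:] [1,3,5,2,4,6]"
  "rect_annihilated 3 2 [:-1, -1, 0, 1, 1:] [1,3,6,2,4,5]"
  "rect_annihilated 3 2 [:-1, -1, 0, 1, 1:] [1,4,5,2,3,6]"
  "rect_annihilated 3 2 [:-1, -1, 0, 1, 1:] [1,4,6,2,3,5]"
  "rect_annihilated 3 2 [:-1, -1, 0, 1, 1:] [1,5,6,2,3,4]"
proof -
  let ?F = "rect_polytabloid 3 2"
  have sw: "?F [a, b, c, d, e, f] Y = - ?F [b, a, c, d, e, f] Y" if "rect_filling 3 2 [a, b, c, d, e, f]" "b < a"
      for a b c d e f Y
    using polytabloid_222_swap(1)[OF that(1)] by simp
  have sw2: "?F [a, b, c, d, e, f] Y = - ?F [a, c, b, d, e, f] Y" if "rect_filling 3 2 [a, b, c, d, e, f]" "c < b"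
      for a b c d e f Y
    using polytabloid_222_swap(2)[OF that(1)] by simp
  have sw3: "?F [a, b, c, d, e, f] Y = - ?F [a, b, c, e, d, f] Y" if "rect_filling 3 2 [a, b, c, d, e, f]" "e < d"
      for a b c d e f Y
    using polytabloid_222_swap(3)[OF that(1)] by simp
  have sw4: "?F [a, b, c, d, e, f] Y = - ?F [a, b, c, d, f, e] Y" if "rect_filling 3 2 [a, b, c, d, e, f]" "f < e"
      for a b c d e f Y
    using polytabloid_222_swap(4)[OF that(1)] by simp
  have co: "?F [a, b, c, d, e, f] = ?F [d, e, f, a, b, c]" if "d < a" for a b c d e f
    by (simp add: polytabloid_222_columns)
  note sort = sw sw2 sw3 sw4 co rect_filling_iff
  have s1: "?F [1,2,6,3,4,5] Y = ?F [1,2,3,4,5,6] Y - ?F [1,2,4,3,5,6] Y + ?F [1,2,5,3,4,6] Y" for Y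
    using polytabloid_222_exchange(3)[of 3 4 5 1 2 6 Y] by (simp add: sort)
  have s2: "?F [1,3,6,2,4,5] Y = - ?F [1,2,3,4,5,6] Y - ?F [1,3,4,2,5,6] Y + ?F [1,3,5,2,4,6] Y" for Y
    using polytabloid_222_exchange(3)[of 2 4 5 1 3 6 Y] by (simp add: sort)
  have s3: "?F [1,4,5,2,3,6] Y = - ?F [1,2,6,3,4,5] Y + ?F [1,3,5,2,4,6] Y - ?F [1,3,4,2,5,6] Y" for Y
    using polytabloid_222_exchange(2)[of 1 4 5 2 3 6 Y] by (simp add: sort)
  have s4: "?F [1,4,6,2,3,5] Y = - ?F [1,2,4,3,5,6] Y + ?F [1,3,4,2,5,6] Y + ?F [1,4,5,2,3,6] Y" for Y
    using polytabloid_222_exchange(3)[of 2 3 5 1 4 6 Y] by (simp add: sort)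
  have s5: "?F [1,5,6,2,3,4] Y = ?F [1,3,4,2,5,6] Y + ?F [1,2,6,3,4,5] Y - ?F [1,2,5,3,4,6] Y" for Y
    using polytabloid_222_exchange(1)[of 1 5 6 2 3 4 Y] by (simp add: sort)
  note rules = sort s1[simplified] s2[simplified] s3[simplified] s4[simplified] s5[simplified]
    rotate_entries_Nil rotate_entries_Cons
  show "rect_annihilated 3 2 [:-1, -1, 0, 1, 1:] [1,2,3,4,5,6]"
    "rect_annihilated 3 2 [:-1, -1, 0, 1, 1:] [1,2,4,3,5,6]"
    "rect_annihilated 3 2 [:-1, -1, 0, 1, 1:] [1,2,5,3,4,6]"
    "rect_annihilated 3 2 [:-1, -1, 0, 1, 1:] [1,2,6,3,4,5]"
    "rect_annihilated 3 2 [:-1, -1, 0, 1, 1:] [1,3,4,2,5,6]"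
    "rect_annihilated 3 2 [:-1, -1, 0, 1, 1:] [1,3,5,2,4,6]"
    "rect_annihilated 3 2 [:-1, -1, 0, 1, 1:] [1,3,6,2,4,5]"
    "rect_annihilated 3 2 [:-1, -1, 0, 1, 1:] [1,4,5,2,3,6]"
    "rect_annihilated 3 2 [:-1, -1, 0, 1, 1:] [1,4,6,2,3,5]"
    "rect_annihilated 3 2 [:-1, -1, 0, 1, 1:] [1,5,6,2,3,4]"
    unfolding rect_annihilated_222_iff by (simp_all add: rules Suc_small)
qed

lemma rect_annihilated_222:
  assumes "rect_filling 3 2 xs"
  shows "rect_annihilated 3 2 [:-1, -1, 0, 1, 1:] xs"
proof -
  let ?A = "rect_annihilated 3 2 [:-1, -1, 0, 1, 1:]"
  have fill: "rect_filling 3 2 (rotate_entries 6 i ys)" if "rect_filling 3 2 ys" for i ys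
    using rect_filling_rotate_entries[OF that] by simp
  have P: "rect_filling 3 2 [a, b, c, d, e, f] \<longrightarrow> ?A [a, b, c, d, e, f]" for a b c d e f
  proof (induction a b c d e f rule: wlog_two_triples)
    case (1 a b c d e f)
    show ?case
    proof
      assume "rect_filling 3 2 [b, a, c, d, e, f]"
      then have xs: "rect_filling 3 2 [a, b, c, d, e, f]" by (auto simp: rect_filling_iff)
      show "?A [b, a, c, d, e, f]"
        by (rule rect_annihilated_cong[of _ _ _ "[a, b, c, d, e, f]" _ "-1"])
           (use 1 xs fill[OF xs] in \<open>simp_all add: rotate_entries_Cons rotate_entries_Nil polytabloid_222_swap(1)\<close>)
    qed
  next
    case (2 a b c d e f)
    show ?case
    proof
      assume "rect_filling 3 2 [a, c, b, d, e, f]"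
      then have xs: "rect_filling 3 2 [a, b, c, d, e, f]" by (auto simp: rect_filling_iff)
      show "?A [a, c, b, d, e, f]"
        by (rule rect_annihilated_cong[of _ _ _ "[a, b, c, d, e, f]" _ "-1"])
           (use 2 xs fill[OF xs] in \<open>simp_all add: rotate_entries_Cons rotate_entries_Nil polytabloid_222_swap(2)\<close>)
    qed
  next
    case (3 a b c d e f)
    show ?case
    proof
      assume "rect_filling 3 2 [a, b, c, e, d, f]"
      then have xs: "rect_filling 3 2 [a, b, c, d, e, f]" by (auto simp: rect_filling_iff)
      show "?A [a, b, c, e, d, f]"
        by (rule rect_annihilated_cong[of _ _ _ "[a, b, c, d, e, f]" _ "-1"])
           (use 3 xs fill[OF xs] in \<open>simp_all add: rotate_entries_Cons rotate_entries_Nil polytabloid_222_swap(3)\<close>)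
    qed
  next
    case (4 a b c d e f)
    show ?case
    proof
      assume "rect_filling 3 2 [a, b, c, d, f, e]"
      then have xs: "rect_filling 3 2 [a, b, c, d, e, f]" by (auto simp: rect_filling_iff)
      show "?A [a, b, c, d, f, e]"
        by (rule rect_annihilated_cong[of _ _ _ "[a, b, c, d, e, f]" _ "-1"])
           (use 4 xs fill[OF xs] in \<open>simp_all add: rotate_entries_Cons rotate_entries_Nil polytabloid_222_swap(4)\<close>)
    qed
  next
    case (5 a b c d e f)
    show ?case
    proof
      assume "rect_filling 3 2 [d, e, f, a, b, c]"
      then have xs: "rect_filling 3 2 [a, b, c, d, e, f]" by (auto simp: rect_filling_iff)
      show "?A [d, e, f, a, b, c]"
        by (rule rect_annihilated_cong[of _ _ _ "[a, b, c, d, e, f]" _ 1])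
           (use 5 xs in \<open>simp_all add: rotate_entries_Cons rotate_entries_Nil polytabloid_222_columns\<close>)
    qed
  next
    case (6 a b c d e f)
    have S: "{1..6} = {1, 2, 3, 4, 5, 6 :: nat}" by auto
    have all: "\<forall>a\<in>{1..6}. \<forall>b\<in>{1..6}. a < b \<longrightarrow> (\<forall>c\<in>{1..6}. b < c \<longrightarrow> (\<forall>d\<in>{1..6}. a < d \<and> d \<noteq> b \<and> d \<noteq> c \<longrightarrow>
        (\<forall>e\<in>{1..6}. d < e \<and> e \<noteq> b \<and> e \<noteq> c \<longrightarrow> (\<forall>f\<in>{1..6}. e < f \<and> f \<noteq> b \<and> f \<noteq> c \<longrightarrow>
          ?A [a, b, c, d, e, f]))))"
      unfolding S using rect_annihilated_222_rotations by simp
    show ?case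
    proof
      assume "rect_filling 3 2 [a, b, c, d, e, f]"
      then have *: "distinct [a, b, c, d, e, f]" "set [a, b, c, d, e, f] \<subseteq> {1..6}"
        by (simp_all add: rect_filling_def)
      then have "a < b" "b < c" "d < e" "e < f" "a < d"
        using 6 by (simp_all add: order_less_le)
      then show "?A [a, b, c, d, e, f]"
        by (intro all[rule_format]) (use * in auto)
    qed
  qed
  have "length xs = 6"
    using assms by (simp add: rect_filling_def)
  then obtain a b c d e f where "xs = [a, b, c, d, e, f]"
    by (auto simp: eval_nat_numeral length_Suc_conv)
  then show ?thesis using P assms by simp
qed

lemma minimal_polynomial_222:
  "is_minimal_polynomial [:-1, -1, 0, 1, 1:] (specht_module [2, 2, 2]) (specht_rep (long_cycle 6))"
proof -
  let ?xs = "[1, 2, 4, 3, 5, 6] :: nat list"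
  let ?T = "\<lambda>ys. tabloid_of (replicate 3 2) (columns_tableau 3 ys)"
  let ?F = "\<lambda>i. rect_polytabloid 3 2 (rotate_entries 6 i ?xs)"
  have rot: "rotate_entries 6 0 ?xs = [1,2,4,3,5,6]" "rotate_entries 6 1 ?xs = [2,3,5,4,6,1]"
      "rotate_entries 6 2 ?xs = [3,4,6,5,1,2]" "rotate_entries 6 3 ?xs = [4,5,1,6,2,3]"
    by (simp_all add: rotate_entries_def)
  have nz: "?F 0 (?T [2,4,1,3,6,5]) \<noteq> 0" "?F 1 (?T [5,3,2,1,6,4]) \<noteq> 0"
      "?F 2 (?T [3,4,6,5,1,2]) \<noteq> 0" "?F 3 (?T [4,5,1,6,3,2]) \<noteq> 0"
    unfolding rot by (rule rect_polytabloid_neq_0; auto simp: rect_filling_iff upt_small)+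
  have z: "?F 1 (?T [2,4,1,3,6,5]) = 0" "?F 2 (?T [2,4,1,3,6,5]) = 0" "?F 3 (?T [2,4,1,3,6,5]) = 0"
      "?F 2 (?T [5,3,2,1,6,4]) = 0" "?F 3 (?T [5,3,2,1,6,4]) = 0" "?F 3 (?T [3,4,6,5,1,2]) = 0"
    unfolding rot by (rule rect_polytabloid_eq_0; simp add: rect_filling_iff upt_small)+
  have "is_minimal_polynomial [:-1, -1, 0, 1, 1:] (specht_module (replicate 3 2)) (specht_rep (long_cycle 6))"
  proof (rule minimal_polynomial_rect[of 6 3 2 _ 4 ?xs])
    fix zs Y assume "rect_filling 3 2 zs"
    from rect_annihilated_222[OF this]
    show "(\<Sum>i\<le>4. coeff [:-1, -1, 0, 1, 1:] i * rect_polytabloid 3 2 (rotate_entries 6 i zs) Y) = 0"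
      by (simp add: rect_annihilated_def eval_nat_numeral)
  next
    show "rect_filling 3 2 ?xs" by (simp add: rect_filling_iff)
    fix j :: nat assume "j < 4"
    then consider "j = 0" | "j = 1" | "j = 2" | "j = 3" by (auto simp: less_4_cases)
    then show "\<exists>Y. ?F j Y \<noteq> 0 \<and> (\<forall>i. j < i \<and> i < 4 \<longrightarrow> ?F i Y = 0)"
    proof cases
      case 1
      then show ?thesis
        using nz(1) z(1-3) unfolding less_4_cases by blast
    next
      case 2
      then show ?thesis
        using nz(2) z(4,5) unfolding less_4_cases by (intro exI[of _ "?T [5,3,2,1,6,4]"]) auto
    next
      case 3
      then show ?thesis
        using nz(3) z(6) unfolding less_4_cases by (intro exI[of _ "?T [3,4,6,5,1,2]"]) auto
    next
      case 4
      then show ?thesis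
        using nz(4) unfolding less_4_cases by (intro exI[of _ "?T [4,5,1,6,3,2]"]) auto
    qed
  qed simp_all
  moreover have "replicate 3 2 = [2, 2, 2::nat]" by (simp add: eval_nat_numeral)
  ultimately show ?thesis by simp
qed


subsection \<open>Two rows of length two\<close>

lemma wlog_two_pairs:
  fixes P :: "nat \<Rightarrow> nat \<Rightarrow> nat \<Rightarrow> nat \<Rightarrow> bool"
  assumes p: "\<And>a b c d. P a b c d \<Longrightarrow> P b a c d" "\<And>a b c d. P a b c d \<Longrightarrow> P a b d c"
    and q: "\<And>a b c d. P a b c d \<Longrightarrow> P c d a b"
    and base: "\<And>a b c d. a \<le> b \<Longrightarrow> c \<le> d \<Longrightarrow> a \<le> c \<Longrightarrow> P a b c d"
  shows "P a b c d"
proof -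
  have "P a b c d" if "a \<le> b" "c \<le> d" for a b c d
    using that base q by (metis nat_le_linear)
  then show ?thesis using p by (metis nat_le_linear)
qed

lemma rect_annihilated_22_iff:
  "rect_annihilated 2 2 [:-1, 0, 1:] xs \<longleftrightarrow>
     (\<forall>Y. rect_polytabloid 2 2 (rotate_entries 4 2 xs) Y = rect_polytabloid 2 2 (rotate_entries 4 0 xs) Y)"
  by (simp add: rect_annihilated_def algebra_simps eval_nat_numeral)

text \<open>The square of the long cycle is a product of two disjoint transpositions. It maps the columns
  of each sorted filling to each other or to themselves, up to the order of their entries, and the signs
  cancel.\<close>

lemma rect_annihilated_22_rotations:
  "rect_annihilated 2 2 [:-1, 0, 1:] [1,2,3,4]"
  "rect_annihilated 2 2 [:-1, 0, 1:] [1,3,2,4]"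
  "rect_annihilated 2 2 [:-1, 0, 1:] [1,4,2,3]"
proof -
  let ?F = "rect_polytabloid 2 2"
  have sw: "?F [a, b, c, d] Y = - ?F [b, a, c, d] Y" if "rect_filling 2 2 [a, b, c, d]" "b < a" for a b c d Y
    using polytabloid_22_swap(1)[OF that(1)] by simp
  have sw2: "?F [a, b, c, d] Y = - ?F [a, b, d, c] Y" if "rect_filling 2 2 [a, b, c, d]" "d < c" for a b c d Y
    using polytabloid_22_swap(2)[OF that(1)] by simp
  have co: "?F [a, b, c, d] = ?F [c, d, a, b]" if "c < a" for a b c d
    by (simp add: polytabloid_22_columns)
  show "rect_annihilated 2 2 [:-1, 0, 1:] [1,2,3,4]"
    "rect_annihilated 2 2 [:-1, 0, 1:] [1,3,2,4]"
    "rect_annihilated 2 2 [:-1, 0, 1:] [1,4,2,3]"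
    unfolding rect_annihilated_22_iff
    by (simp_all add: sw sw2 co rotate_entries_Nil rotate_entries_Cons rect_filling_iff Suc_small)
qed

lemma rect_annihilated_22:
  assumes "rect_filling 2 2 xs"
  shows "rect_annihilated 2 2 [:-1, 0, 1:] xs"
proof -
  let ?A = "rect_annihilated 2 2 [:-1, 0, 1:]"
  have fill: "rect_filling 2 2 (rotate_entries 4 i ys)" if "rect_filling 2 2 ys" for i ys
    using rect_filling_rotate_entries[OF that] by simp
  have P: "rect_filling 2 2 [a, b, c, d] \<longrightarrow> ?A [a, b, c, d]" for a b c d
  proof (induction a b c d rule: wlog_two_pairs)
    case (1 a b c d)
    show ?case
    proof
      assume "rect_filling 2 2 [b, a, c, d]"
      then have xs: "rect_filling 2 2 [a, b, c, d]" by (auto simp: rect_filling_iff)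
      show "?A [b, a, c, d]"
        by (rule rect_annihilated_cong[of _ _ _ "[a, b, c, d]" _ "-1"])
           (use 1 xs fill[OF xs] in \<open>simp_all add: rotate_entries_Cons rotate_entries_Nil polytabloid_22_swap(1)\<close>)
    qed
  next
    case (2 a b c d)
    show ?case
    proof
      assume "rect_filling 2 2 [a, b, d, c]"
      then have xs: "rect_filling 2 2 [a, b, c, d]" by (auto simp: rect_filling_iff)
      show "?A [a, b, d, c]"
        by (rule rect_annihilated_cong[of _ _ _ "[a, b, c, d]" _ "-1"])
           (use 2 xs fill[OF xs] in \<open>simp_all add: rotate_entries_Cons rotate_entries_Nil polytabloid_22_swap(2)\<close>)
    qed
  next
    case (3 a b c d)
    show ?case
    proof
      assume "rect_filling 2 2 [c, d, a, b]"
      then have xs: "rect_filling 2 2 [a, b, c, d]" by (auto simp: rect_filling_iff)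
      show "?A [c, d, a, b]"
        by (rule rect_annihilated_cong[of _ _ _ "[a, b, c, d]" _ 1])
           (use 3 xs in \<open>simp_all add: rotate_entries_Cons rotate_entries_Nil polytabloid_22_columns\<close>)
    qed
  next
    case (4 a b c d)
    have S: "{1..4} = {1, 2, 3, 4 :: nat}" by auto
    have all: "\<forall>a\<in>{1..4}. \<forall>b\<in>{1..4}. a < b \<longrightarrow> (\<forall>c\<in>{1..4}. a < c \<and> c \<noteq> b \<longrightarrow> (\<forall>d\<in>{1..4}. c < d \<and> d \<noteq> b \<longrightarrow>
        ?A [a, b, c, d]))"
      unfolding S using rect_annihilated_22_rotations by simp
    show ?case
    proof
      assume "rect_filling 2 2 [a, b, c, d]"
      then have *: "distinct [a, b, c, d]" "set [a, b, c, d] \<subseteq> {1..4}"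
        by (simp_all add: rect_filling_def)
      then have "a < b" "c < d" "a < c"
        using 4 by (simp_all add: order_less_le)
      then show "?A [a, b, c, d]"
        by (intro all[rule_format]) (use * in auto)
    qed
  qed
  have "length xs = 4"
    using assms by (simp add: rect_filling_def)
  then obtain a b c d where "xs = [a, b, c, d]"
    by (auto simp: eval_nat_numeral length_Suc_conv)
  then show ?thesis using P assms by simp
qed

lemma minimal_polynomial_22:
  "is_minimal_polynomial [:-1, 0, 1:] (specht_module [2, 2]) (specht_rep (long_cycle 4))"
proof -
  let ?xs = "[1, 2, 3, 4] :: nat list"
  let ?T = "\<lambda>ys. tabloid_of (replicate 2 2) (columns_tableau 2 ys)"
  let ?F = "\<lambda>i. rect_polytabloid 2 2 (rotate_entries 4 i ?xs)"
  have rot: "rotate_entries 4 0 ?xs = [1,2,3,4]" "rotate_entries 4 1 ?xs = [2,3,4,1]"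
    by (simp_all add: rotate_entries_def)
  have nz: "?F 0 (?T [2,1,3,4]) \<noteq> 0" "?F 1 (?T [3,2,4,1]) \<noteq> 0"
    unfolding rot by (rule rect_polytabloid_neq_0; auto simp: rect_filling_iff upt_small)+
  have z: "?F 1 (?T [2,1,3,4]) = 0"
    unfolding rot by (rule rect_polytabloid_eq_0; simp add: rect_filling_iff upt_small)+
  have "is_minimal_polynomial [:-1, 0, 1:] (specht_module (replicate 2 2)) (specht_rep (long_cycle 4))"
  proof (rule minimal_polynomial_rect[of 4 2 2 _ 2 ?xs])
    fix zs Y assume "rect_filling 2 2 zs"
    from rect_annihilated_22[OF this]
    show "(\<Sum>i\<le>2. coeff [:-1, 0, 1:] i * rect_polytabloid 2 2 (rotate_entries 4 i zs) Y) = 0"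
      by (simp add: rect_annihilated_def eval_nat_numeral)
  next
    show "rect_filling 2 2 ?xs" by (simp add: rect_filling_iff)
    fix j :: nat assume "j < 2"
    then consider "j = 0" | "j = 1" by (auto simp: less_2_cases_iff)
    then show "\<exists>Y. ?F j Y \<noteq> 0 \<and> (\<forall>i. j < i \<and> i < 2 \<longrightarrow> ?F i Y = 0)"
    proof cases
      case 1
      then show ?thesis
        using nz(1) z unfolding less_2_cases_iff by (intro exI[of _ "?T [2,1,3,4]"]) auto
    next
      case 2
      then show ?thesis
        using nz(2) unfolding less_2_cases_iff by (intro exI[of _ "?T [3,2,4,1]"]) auto
    qed
  qed simp_all
  moreover have "replicate 2 2 = [2, 2::nat]" by (simp add: eval_nat_numeral)
  ultimately show ?thesis by simp
qed

section \<open>The minimal polynomials\<close>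

lemma conjugate_root_of_unity:
  fixes z :: complex
  assumes "z ^ k = 1" "k > 0"
  shows "z * cnj z = 1"
proof -
  have "norm z = 1"
    using assms power_eq_1_iff by blast
  then show ?thesis
    using complex_norm_square[of z] by simp
qed

text \<open>The complex conjugate of a root of unity is its inverse, so the two factors are the conjugate roots
  of the third, respectively sixth, cyclotomic polynomial.\<close>

lemma primitive_cube_root_factor:
  assumes "primitive_root_of_unity 3 z"
  shows "[:- z, 1:] * [:- cnj z, 1:] = [:1, 1, 1:]"
proof -
  have z: "z ^ 3 = 1" "z \<noteq> 1"
    using assms by (auto simp: primitive_root_of_unity_def)
  have "(z - 1) * (z\<^sup>2 + z + 1) = z ^ 3 - 1"
    by (simp add: algebra_simps power2_eq_square power3_eq_cube)
  then have q: "z\<^sup>2 + z + 1 = 0"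
    using z by simp
  have c: "z * cnj z = 1"
    using conjugate_root_of_unity[OF z(1)] by simp
  have "z * (z + cnj z + 1) = 0"
    using q c by (simp add: algebra_simps power2_eq_square)
  then have "z + cnj z = - 1"
    using c by (auto simp: eq_neg_iff_add_eq_0)
  moreover have "[:- z, 1:] * [:- cnj z, 1:] = [:z * cnj z, - (z + cnj z), 1:]"
    by simp
  ultimately show ?thesis
    using c by simp
qed

lemma primitive_sixth_root_factor:
  assumes "primitive_root_of_unity 6 z"
  shows "[:- z, 1:] * [:- cnj z, 1:] = [:1, -1, 1:]"
proof -
  have z: "z ^ 6 = 1" "z ^ 3 \<noteq> 1" "z ^ 2 \<noteq> 1"
    using assms by (auto simp: primitive_root_of_unity_def)
  have "(z ^ 3 - 1) * (z ^ 3 + 1) = z ^ 6 - 1"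
    by (simp add: algebra_simps flip: power_add)
  then have "z ^ 3 = - 1"
    using z by (simp add: eq_neg_iff_add_eq_0)
  moreover have "(z + 1) * (z\<^sup>2 - z + 1) = z ^ 3 + 1"
    by (simp add: algebra_simps power2_eq_square power3_eq_cube)
  moreover have "z \<noteq> - 1"
    using z(3) by auto
  ultimately have q: "z\<^sup>2 - z + 1 = 0"
    by (simp add: add_eq_0_iff2)
  have c: "z * cnj z = 1"
    using conjugate_root_of_unity[OF z(1)] by simp
  have "z * (z + cnj z - 1) = 0"
    using q c by (simp add: algebra_simps power2_eq_square)
  then have "z + cnj z = 1"
    using c by auto
  moreover have "[:- z, 1:] * [:- cnj z, 1:] = [:z * cnj z, - (z + cnj z), 1:]"
    by simp
  ultimately show ?thesis
    using c by simp
qed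

lemma monom_minus_1_quotients:
  "(monom 1 4 - 1) div [:1, 0, 1:] = [:-1, 0, 1 :: complex:]"
  "(monom 1 6 - 1) div [:1, 1, 1:] = [:-1, 1, 0, -1, 1 :: complex:]"
  "(monom 1 6 - 1) div [:1, -1, 1:] = [:-1, -1, 0, 1, 1 :: complex:]"
proof -
  have "monom 1 4 - 1 = [:1, 0, 1:] * [:-1, 0, 1 :: complex:]"
    "monom 1 6 - 1 = [:1, 1, 1:] * [:-1, 1, 0, -1, 1 :: complex:]"
    "monom 1 6 - 1 = [:1, -1, 1:] * [:-1, -1, 0, 1, 1 :: complex:]"
    by (simp_all add: eval_nat_numeral monom_Suc monom_0 one_pCons)
  then show "(monom 1 4 - 1) div [:1, 0, 1:] = [:-1, 0, 1 :: complex:]"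
    "(monom 1 6 - 1) div [:1, 1, 1:] = [:-1, 1, 0, -1, 1 :: complex:]"
    "(monom 1 6 - 1) div [:1, -1, 1:] = [:-1, -1, 0, 1, 1 :: complex:]"
    by (metis nonzero_mult_div_cancel_left pCons_eq_0_iff one_neq_zero)+
qed

theorem theorem1p7:
  fixes n :: nat and lam :: "nat list"
  assumes "n > 0" and "partition_of lam n"
  defines "w \<equiv> cycle_of_list [1..<Suc n]"
  defines "min_pol \<equiv> \<lambda>p. is_minimal_polynomial p (specht_module lam) (specht_rep w)"
  shows
    "(lam = [n] \<and> n > 1 \<longrightarrow> min_pol [:-1, 1:]) \<and>
     (lam = [n - 1, 1] \<longrightarrow> min_pol ((monom 1 n - 1) div [:-1, 1:])) \<and>
     (lam = 2 # replicate (n - 2) 1 \<longrightarrow> min_pol ((monom 1 n - 1) div [:- ((-1) ^ (n - 1)), 1:])) \<and>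
     (lam = replicate n 1 \<longrightarrow> min_pol [:- ((-1) ^ (n - 1)), 1:]) \<and>
     (lam = [3, 3] \<longrightarrow>
        (\<forall>\<zeta>. primitive_root_of_unity 3 \<zeta> \<longrightarrow>
           min_pol ((monom 1 6 - 1) div ([:- \<zeta>, 1:] * [:- cnj \<zeta>, 1:])))) \<and>
     (lam = [2, 2, 2] \<longrightarrow>
        (\<forall>\<zeta>. primitive_root_of_unity 6 \<zeta> \<longrightarrow>
           min_pol ((monom 1 6 - 1) div ([:- \<zeta>, 1:] * [:- cnj \<zeta>, 1:])))) \<and>
     (lam = [2, 2] \<longrightarrow> min_pol ((monom 1 4 - 1) div [:1, 0, 1:])) \<and>
     (\<not> (lam = [n] \<and> n > 1) \<and> lam \<noteq> [n - 1, 1] \<and> lam \<noteq> 2 # replicate (n - 2) 1 \<and>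
      lam \<noteq> replicate n 1 \<and> lam \<noteq> [3, 3] \<and> lam \<noteq> [2, 2, 2] \<and> lam \<noteq> [2, 2] \<longrightarrow>
        min_pol (monom 1 n - 1))"
proof -
  have sum: "sum_list lam = n" and zero: "0 \<notin> set lam"
    using assms(2) by (simp_all add: partition_of_def)
  have mp: "min_pol p \<longleftrightarrow> is_minimal_polynomial p (specht_module lam) (specht_rep (long_cycle n))" for p
    by (simp add: min_pol_def w_def long_cycle_def)
  have sign_pow: "((-1) ^ (n - 1) :: complex) ^ n = 1"
  proof -
    have "even ((n - 1) * n)"
      using assms(1) by (cases n) auto
    then show ?thesis by (simp flip: power_mult)
  qed
  show ?thesis
  proof (intro conjI impI allI)
    assume "lam = [n] \<and> n > 1"
    then show "min_pol [:-1, 1:]"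
      unfolding mp using minimal_polynomial_one_row by simp
  next
    assume lam: "lam = [n - 1, 1]"
    then have "n > 1" using zero by (cases "n = 1") auto
    then show "min_pol ((monom 1 n - 1) div [:-1, 1:])"
      unfolding mp lam using minimal_polynomial_standard monom_minus_1_div_linear[of 1 n] by simp
  next
    assume lam: "lam = 2 # replicate (n - 2) 1"
    then have "n > 1" using sum by simp
    then show "min_pol ((monom 1 n - 1) div [:- ((-1) ^ (n - 1)), 1:])"
      unfolding mp lam monom_minus_1_div_linear[OF sign_pow] by (rule minimal_polynomial_standard_sign)
  next
    assume lam: "lam = replicate n 1"
    show "min_pol [:- ((-1) ^ (n - 1)), 1:]"
      unfolding mp lam by (rule minimal_polynomial_one_column)
  next
    fix \<zeta> assume lam: "lam = [3, 3]" and "primitive_root_of_unity 3 \<zeta>"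
    moreover from lam have "n = 6" using sum by simp
    ultimately show "min_pol ((monom 1 6 - 1) div ([:- \<zeta>, 1:] * [:- cnj \<zeta>, 1:]))"
      unfolding mp using minimal_polynomial_33
      by (simp only: primitive_cube_root_factor monom_minus_1_quotients)
  next
    fix \<zeta> assume lam: "lam = [2, 2, 2]" and "primitive_root_of_unity 6 \<zeta>"
    moreover from lam have "n = 6" using sum by simp
    ultimately show "min_pol ((monom 1 6 - 1) div ([:- \<zeta>, 1:] * [:- cnj \<zeta>, 1:]))"
      unfolding mp using minimal_polynomial_222
      by (simp only: primitive_sixth_root_factor monom_minus_1_quotients)
  next
    assume lam: "lam = [2, 2]"
    then have "n = 4" using sum by simp
    then show "min_pol ((monom 1 4 - 1) div [:1, 0, 1:])"
      unfolding mp lam using minimal_polynomial_22 by (simp only: monom_minus_1_quotients)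
  next
    assume "\<not> (lam = [n] \<and> n > 1) \<and> lam \<noteq> [n - 1, 1] \<and> lam \<noteq> 2 # replicate (n - 2) 1 \<and>
      lam \<noteq> replicate n 1 \<and> lam \<noteq> [3, 3] \<and> lam \<noteq> [2, 2, 2] \<and> lam \<noteq> [2, 2]"
    then have "separable (young_diagram lam)"
      using separable_young_diagram[OF assms(2,1)] by blast
    then show "min_pol (monom 1 n - 1)"
      unfolding mp separable_def using minimal_polynomial_shift_separating[OF sum assms(1)] by blast
  qed
qed

end
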